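(* There is an absolute constant $C>0$ such that the following holds. Let $f$ be a Lipschitz function on $\mathbb{R}$ and let $E_1$ and $E_2$ be Borel spectral measures on $\mathbb{R}$ (acting on a Hilbert space $H$). Then the linear map $T\mapsto\mathcal{I}_{E_1,E_2}(f,T)$, defined on the Hilbert--Schmidt class $\boldsymbol{S}_2$, extends to a bounded linear operator from the Matsaev ideal $\boldsymbol{S}_\omega$ to the ideal of all compact operators (with the operator norm), and, denoting the extension by the same symbol, $$\|\mathcal{I}_{E_1,E_2}(f,T)\|\le C\,\|f\|_{\mathrm{Lip}}\,\|T\|_{\boldsymbol{S}_\omega},\qquad T\in\boldsymbol{S}_\omega.$$
   Context: Lipschitz functions may be complex-valued; $\|f\|_{\mathrm{Lip}}=\sup_{x\neq y}|f(x)-f(y)|\,|x-y|^{-1}$. Singular values: $s_j(T)=\inf\{\|T-R\|:\operatorname{rank}R\le j\}$, $j\ge 0$. The Matsaev ideal $\boldsymbol{S}_\omega$ consists of the operators $T$ with $$\|T\|_{\boldsymbol{S}_\omega}=\sum_{j=0}^\infty\frac{s_j(T)}{1+j}<\infty;$$ it contains $\boldsymbol{S}_2$ as a dense subspace. Double operator integral: a Borel spectral measure on $\mathbb{R}$ is a projection-valued (orthogonal projections), countably additive measure $E$ on the Borel sets of $\mathbb{R}$ with $E(\mathbb{R})=I$. Given $E_1,E_2$ on $H$, there is a unique spectral measure $\mathcal{E}$ on the Borel sets of $\mathbb{R}^2$, acting on the Hilbert space $\boldsymbol{S}_2$ of operators on $H$, with $\mathcal{E}(\Delta\times\delta)T=E_1(\Delta)TE_2(\delta)$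 for Borel $\Delta,\delta\subset\mathbb{R}$ and $T\in\boldsymbol{S}_2$. For bounded Borel $\Phi$ on $\mathbb{R}^2$ and $T\in\boldsymbol{S}_2$, $\iint\Phi(x,y)\,dE_1(x)\,T\,dE_2(y)$ denotes $\left(\int\Phi\,d\mathcal{E}\right)T\in\boldsymbol{S}_2$. For $f$ Lipschitz and $T\in\boldsymbol{S}_2$, $$\mathcal{I}_{E_1,E_2}(f,T)=\iint\frac{f(x)-f(y)}{x-y}\,dE_1(x)\,T\,dE_2(y),$$ where the divided difference $(f(x)-f(y))/(x-y)$ is taken to be $0$ on the diagonal $x=y$. *)

theory Defs
  imports "HOL-Analysis.Analysis"
begin

section \<open>Complex Hilbert spaces\<close>

text \<open>The inner product is linear in the first argument; its real part is the inner product of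
  the underlying real Hilbert space, so \<open>norm x = sqrt (Re (cinner x x))\<close>.\<close>

class chilbert_space = banach + real_inner +
  fixes scaleC :: "complex \<Rightarrow> 'a \<Rightarrow> 'a"
    and cinner :: "'a \<Rightarrow> 'a \<Rightarrow> complex"
  assumes scaleC_add_right: "scaleC c (x + y) = scaleC c x + scaleC c y"
    and scaleC_add_left: "scaleC (c + d) x = scaleC c x + scaleC d x"
    and scaleC_scaleC: "scaleC c (scaleC d x) = scaleC (c * d) x"
    and scaleC_of_real: "scaleC (complex_of_real r) x = scaleR r x"
    and cinner_add_left: "cinner (x + y) z = cinner x z + cinner y z"
    and cinner_scaleC_left: "cinner (scaleC c x) y = c * cinner x y"
    and cinner_commute: "cinner x y = cnj (cinner y x)"
    and inner_eq_Re_cinner: "inner x y = Re (cinner x y)"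

lemma scaleC_one: "scaleC 1 x = (x::'a::chilbert_space)"
  using scaleC_of_real[of 1 x] by simp

global_interpretation complex_vector: vector_space "scaleC :: complex \<Rightarrow> 'a \<Rightarrow> 'a::chilbert_space"
  by unfold_locales (auto simp: scaleC_add_right scaleC_add_left scaleC_scaleC scaleC_one)

abbreviation cspan :: "'a::chilbert_space set \<Rightarrow> 'a set"
  where "cspan \<equiv> complex_vector.span"

lemma scaleR_scaleC: "scaleR r x = scaleC (complex_of_real r) (x::'a::chilbert_space)"
  by (simp add: scaleC_of_real)

lemma cinner_add_right: "cinner x (y + z) = cinner x y + cinner x (z::'a::chilbert_space)"
  by (metis cinner_add_left cinner_commute complex_cnj_add)

lemma cinner_scaleC_right: "cinner x (scaleC c y) = cnj c * cinner x (y::'a::chilbert_space)"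
  by (metis cinner_commute cinner_scaleC_left complex_cnj_mult)

lemma cinner_zero_left [simp]: "cinner 0 (y::'a::chilbert_space) = 0"
  using cinner_add_left[of 0 0 y] by simp

lemma cinner_zero_right [simp]: "cinner (y::'a::chilbert_space) 0 = 0"
  using cinner_add_right[of y 0 0] by simp

lemma cinner_minus_left: "cinner (- x) (y::'a::chilbert_space) = - cinner x y"
  using cinner_add_left[of x "- x" y] by (simp add: eq_neg_iff_add_eq_0 add.commute)

lemma cinner_diff_left: "cinner (x - y) (z::'a::chilbert_space) = cinner x z - cinner y z"
  using cinner_add_left[of x "- y" z] by (simp add: cinner_minus_left)

lemma cinner_sum_left: "cinner (sum f A) (y::'a::chilbert_space) = (\<Sum>x\<in>A. cinner (f x) y)"
  by (induction A rule: infinite_finite_induct) (auto simp: cinner_add_left)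

lemma cinner_sum_right: "cinner y (sum f A) = (\<Sum>x\<in>A. cinner (y::'a::chilbert_space) (f x))"
  by (induction A rule: infinite_finite_induct) (auto simp: cinner_add_right)

lemma cinner_self: "cinner x x = complex_of_real ((norm (x::'a::chilbert_space))\<^sup>2)"
proof -
  have "Im (cinner x x) = 0"
    using cinner_commute[of x x] by (metis complex_cnj_cancel_iff Reals_cnj_iff complex_is_Real_iff)
  moreover have "Re (cinner x x) = (norm x)\<^sup>2"
    by (simp add: inner_eq_Re_cinner[symmetric] power2_norm_eq_inner)
  ultimately show ?thesis by (simp add: complex_eq_iff)
qed

lemma norm_scaleC: "norm (scaleC c x) = cmod c * norm (x::'a::chilbert_space)"
proof -
  have "complex_of_real ((norm (scaleC c x))\<^sup>2) = c * cnj c * cinner x x"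
    by (simp only: cinner_self[symmetric] cinner_scaleC_left cinner_scaleC_right mult.assoc mult.left_commute)
  also have "\<dots> = complex_of_real ((cmod c * norm x)\<^sup>2)"
    by (simp add: cinner_self complex_norm_square[symmetric] power_mult_distrib)
  finally have "(norm (scaleC c x))\<^sup>2 = (cmod c * norm x)\<^sup>2"
    using of_real_eq_iff by blast
  then show ?thesis by (simp add: power2_eq_iff_nonneg)
qed

lemma norm_cinner_le: "cmod (cinner x y) \<le> norm x * norm (y::'a::chilbert_space)"
proof (cases "cinner x y = 0")
  case False
  define c where "c = cnj (cinner x y) / cmod (cinner x y)"
  have c: "cmod c = 1" using False by (simp add: c_def norm_divide)
  have "c * cinner x y = complex_of_real (cmod (cinner x y))"
    using False by (simp add: c_def complex_norm_square[symmetric] mult.commute power2_eq_square)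
  then have "cmod (cinner x y) = inner (scaleC c x) y"
    by (simp add: inner_eq_Re_cinner cinner_scaleC_left)
  also have "\<dots> \<le> norm (scaleC c x) * norm y" by (rule norm_cauchy_schwarz)
  finally show ?thesis by (simp add: norm_scaleC c)
qed auto

instantiation complex :: chilbert_space
begin
definition scaleC_complex :: "complex \<Rightarrow> complex \<Rightarrow> complex" where "scaleC_complex c x = c * x"
definition cinner_complex :: "complex \<Rightarrow> complex \<Rightarrow> complex" where "cinner_complex x y = x * cnj y"
instance
  by standard (auto simp: scaleC_complex_def cinner_complex_def algebra_simps scaleR_conv_of_real
      inner_complex_def)
end

section \<open>The Hilbert space of square summable families\<close>

typedef (overloaded) ('i, 'a::chilbert_space) ell2 =
  "{a :: 'i \<Rightarrow> 'a. (\<lambda>i. (norm (a i))\<^sup>2) summable_on UNIV}"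
  morphisms ell2_coord Abs_ell2
  by (rule exI[of _ "\<lambda>_. 0"]) simp

setup_lifting type_definition_ell2

lemma sq_summable_add:
  fixes a b :: "'i \<Rightarrow> 'a::chilbert_space"
  assumes "(\<lambda>i. (norm (a i))\<^sup>2) summable_on UNIV" "(\<lambda>i. (norm (b i))\<^sup>2) summable_on UNIV"
  shows "(\<lambda>i. (norm (a i + b i))\<^sup>2) summable_on UNIV"
proof (rule summable_on_comparison_test)
  show "(\<lambda>i. 2 * ((norm (a i))\<^sup>2 + (norm (b i))\<^sup>2)) summable_on UNIV"
    by (intro summable_on_cmult_right summable_on_add assms)
  show "(norm (a i + b i))\<^sup>2 \<le> 2 * ((norm (a i))\<^sup>2 + (norm (b i))\<^sup>2)" for i
  proof -
    have "(norm (a i + b i))\<^sup>2 \<le> (norm (a i) + norm (b i))\<^sup>2"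
      by (intro power_mono norm_triangle_ineq) auto
    also have "\<dots> \<le> 2 * ((norm (a i))\<^sup>2 + (norm (b i))\<^sup>2)"
      using sum_squares_bound[of "norm (a i)" "norm (b i)"] by (simp add: power2_sum)
    finally show ?thesis .
  qed
qed auto

lemma sq_summable_scaleC:
  fixes a :: "'i \<Rightarrow> 'a::chilbert_space"
  assumes "(\<lambda>i. (norm (a i))\<^sup>2) summable_on UNIV"
  shows "(\<lambda>i. (norm (scaleC c (a i)))\<^sup>2) summable_on UNIV"
  using summable_on_cmult_right[OF assms, of "(cmod c)\<^sup>2"]
  by (simp add: norm_scaleC power_mult_distrib)

lemma cinner_summable:
  fixes a b :: "'i \<Rightarrow> 'a::chilbert_space"
  assumes "(\<lambda>i. (norm (a i))\<^sup>2) summable_on UNIV" "(\<lambda>i. (norm (b i))\<^sup>2) summable_on UNIV"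
  shows "(\<lambda>i. cinner (a i) (b i)) summable_on UNIV"
proof (rule abs_summable_summable, rule summable_on_comparison_test)
  show "(\<lambda>i. (norm (a i))\<^sup>2 + (norm (b i))\<^sup>2) summable_on UNIV"
    by (intro summable_on_add assms)
  show "cmod (cinner (a i) (b i)) \<le> (norm (a i))\<^sup>2 + (norm (b i))\<^sup>2" for i
  proof -
    have "cmod (cinner (a i) (b i)) \<le> norm (a i) * norm (b i)" by (rule norm_cinner_le)
    also have "\<dots> \<le> (norm (a i))\<^sup>2 + (norm (b i))\<^sup>2"
      using sum_squares_bound[of "norm (a i)" "norm (b i)"]
        mult_nonneg_nonneg[OF norm_ge_zero[of "a i"] norm_ge_zero[of "b i"]]
      by linarith
    finally show ?thesis .
  qed
qed auto

instantiation ell2 :: (type, chilbert_space) real_inner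
begin

lift_definition zero_ell2 :: "('a, 'b) ell2" is "\<lambda>_. 0" by simp

lift_definition plus_ell2 :: "('a, 'b) ell2 \<Rightarrow> ('a, 'b) ell2 \<Rightarrow> ('a, 'b) ell2"
  is "\<lambda>a b i. a i + b i" by (rule sq_summable_add)

lift_definition uminus_ell2 :: "('a, 'b) ell2 \<Rightarrow> ('a, 'b) ell2"
  is "\<lambda>a i. - a i" by simp

definition minus_ell2 :: "('a, 'b) ell2 \<Rightarrow> ('a, 'b) ell2 \<Rightarrow> ('a, 'b) ell2"
  where "minus_ell2 a b = a + (- b)"

lift_definition scaleR_ell2 :: "real \<Rightarrow> ('a, 'b) ell2 \<Rightarrow> ('a, 'b) ell2"
  is "\<lambda>r a i. r *\<^sub>R a i"
  unfolding scaleR_scaleC by (rule sq_summable_scaleC)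

definition inner_ell2 :: "('a, 'b) ell2 \<Rightarrow> ('a, 'b) ell2 \<Rightarrow> real"
  where "inner_ell2 a b = Re (\<Sum>\<^sub>\<infinity>i. cinner (ell2_coord a i) (ell2_coord b i))"

definition norm_ell2 :: "('a, 'b) ell2 \<Rightarrow> real"
  where "norm_ell2 a = sqrt (inner a a)"

definition dist_ell2 :: "('a, 'b) ell2 \<Rightarrow> ('a, 'b) ell2 \<Rightarrow> real"
  where "dist_ell2 a b = norm (a - b)"

definition sgn_ell2 :: "('a, 'b) ell2 \<Rightarrow> ('a, 'b) ell2"
  where "sgn_ell2 a = scaleR (inverse (norm a)) a"

definition uniformity_ell2 :: "(('a, 'b) ell2 \<times> ('a, 'b) ell2) filter"
  where "uniformity_ell2 = (INF e\<in>{0 <..}. principal {(x, y). dist x y < e})"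

definition open_ell2 :: "('a, 'b) ell2 set \<Rightarrow> bool"
  where "open_ell2 S = (\<forall>x\<in>S. \<forall>\<^sub>F (x', y) in uniformity. x' = x \<longrightarrow> y \<in> S)"

lemma ell2_sq_summable: "(\<lambda>i. (norm (ell2_coord a i))\<^sup>2) summable_on UNIV"
  using ell2_coord[of a] by simp

lemma ell2_cinner_summable: "(\<lambda>i. cinner (ell2_coord a i) (ell2_coord b i)) summable_on UNIV"
  by (intro cinner_summable ell2_sq_summable)

lemma inner_ell2_self: "inner a a = (\<Sum>\<^sub>\<infinity>i. (norm (ell2_coord a i))\<^sup>2)"
proof -
  have "inner a a = (\<Sum>\<^sub>\<infinity>i. Re (cinner (ell2_coord a i) (ell2_coord a i)))"
    unfolding inner_ell2_def by (rule infsum_Re[symmetric]) (rule ell2_cinner_summable)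
  then show ?thesis by (simp add: cinner_self)
qed

instance
proof
  fix a b c :: "('a, 'b) ell2" and r s :: real
  show "a + b + c = a + (b + c)" "a + b = b + a" "0 + a = a" "- a + a = 0"
    by (transfer; simp add: algebra_simps fun_eq_iff)+
  show "a - b = a + - b" by (rule minus_ell2_def)
  show "r *\<^sub>R (a + b) = r *\<^sub>R a + r *\<^sub>R b" "(r + s) *\<^sub>R a = r *\<^sub>R a + s *\<^sub>R a"
    "r *\<^sub>R s *\<^sub>R a = (r * s) *\<^sub>R a" "1 *\<^sub>R a = a"
    by (transfer; simp add: algebra_simps fun_eq_iff)+
  show "sgn a = inverse (norm a) *\<^sub>R a" by (simp add: sgn_ell2_def)
  show "dist a b = norm (a - b)" by (simp add: dist_ell2_def)
  show "(uniformity :: (('a, 'b) ell2 \<times> ('a, 'b) ell2) filter)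
      = (INF e\<in>{0 <..}. principal {(x, y). dist x y < e})" by (simp add: uniformity_ell2_def)
  show "norm a = sqrt (inner a a)" by (simp add: norm_ell2_def)
  show "inner a b = inner b a"
  proof -
    have "(\<Sum>\<^sub>\<infinity>i. cinner (ell2_coord a i) (ell2_coord b i))
        = (\<Sum>\<^sub>\<infinity>i. cnj (cinner (ell2_coord b i) (ell2_coord a i)))"
      by (rule infsum_cong) (rule cinner_commute)
    then show ?thesis by (simp add: inner_ell2_def)
  qed
  show "inner (a + b) c = inner a c + inner b c"
    by (simp add: inner_ell2_def plus_ell2.rep_eq cinner_add_left
        infsum_add[OF ell2_cinner_summable ell2_cinner_summable])
  show "inner (r *\<^sub>R a) b = r * inner a b"
    by (simp add: inner_ell2_def scaleR_ell2.rep_eq scaleR_scaleC cinner_scaleC_left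
        infsum_cmult_right'[where c="complex_of_real r"])
  show "0 \<le> inner a a" unfolding inner_ell2_self by (rule infsum_nonneg) simp
  show "inner a a = 0 \<longleftrightarrow> a = 0"
  proof
    assume "inner a a = 0"
    then have "(norm (ell2_coord a i))\<^sup>2 = 0" for i
      using nonneg_infsum_le_0D[of "\<lambda>i. (norm (ell2_coord a i))\<^sup>2" UNIV i] ell2_sq_summable[of a]
      by (simp add: inner_ell2_self)
    then have "ell2_coord a = ell2_coord 0" by (auto simp: zero_ell2.rep_eq)
    then show "a = 0" by (simp add: ell2_coord_inject)
  qed (simp add: inner_ell2_self zero_ell2.rep_eq)
next
  fix S :: "('a, 'b) ell2 set"
  show "open S = (\<forall>x\<in>S. \<forall>\<^sub>F (x', y) in uniformity. x' = x \<longrightarrow> y \<in> S)"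
    by (simp add: open_ell2_def)
qed

end

lemma ell2_coord_diff: "ell2_coord (a - b) i = ell2_coord a i - ell2_coord b i"
  unfolding minus_ell2_def plus_ell2.rep_eq uminus_ell2.rep_eq by (rule diff_conv_add_uminus[symmetric])

lemma norm_ell2_sq: "(norm a)\<^sup>2 = (\<Sum>\<^sub>\<infinity>i. (norm (ell2_coord a i))\<^sup>2)"
  by (simp only: power2_norm_eq_inner[of a] inner_ell2_self)

lemma sum_le_norm_ell2:
  assumes "finite F"
  shows "(\<Sum>i\<in>F. (norm (ell2_coord a i))\<^sup>2) \<le> (norm a)\<^sup>2"
  unfolding norm_ell2_sq by (rule finite_sum_le_infsum) (use assms ell2_sq_summable in auto)

lemma norm_ell2_coord_le: "norm (ell2_coord a i) \<le> norm a"
  using sum_le_norm_ell2[of "{i}" a] by (simp add: power2_le_iff_abs_le)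

instance ell2 :: (type, chilbert_space) banach
proof
  fix X :: "nat \<Rightarrow> ('a, 'b) ell2"
  assume X: "Cauchy X"
  have "Cauchy (\<lambda>n. ell2_coord (X n) i)" for i
  proof (rule CauchyI)
    fix e :: real assume "0 < e"
    then obtain N where "\<And>m n. m \<ge> N \<Longrightarrow> n \<ge> N \<Longrightarrow> norm (X m - X n) < e"
      using CauchyD[OF X] by blast
    then show "\<exists>M. \<forall>m\<ge>M. \<forall>n\<ge>M. norm (ell2_coord (X m) i - ell2_coord (X n) i) < e"
      by (metis ell2_coord_diff norm_ell2_coord_le order_le_less_trans)
  qed
  then have "\<exists>l. (\<lambda>n. ell2_coord (X n) i) \<longlonglongrightarrow> l" for i
    using Cauchy_convergent convergent_def by blast
  then obtain a where a: "\<And>i. (\<lambda>n. ell2_coord (X n) i) \<longlonglongrightarrow> a i" by metis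
  have key: "(\<Sum>i\<in>F. (norm (ell2_coord (X n) i - a i))\<^sup>2) \<le> e\<^sup>2"
    if N: "\<And>m. m \<ge> N \<Longrightarrow> norm (X n - X m) < e" and "finite F" for N n e F
  proof (rule LIMSEQ_le_const2)
    show "(\<lambda>m. \<Sum>i\<in>F. (norm (ell2_coord (X n) i - ell2_coord (X m) i))\<^sup>2)
        \<longlonglongrightarrow> (\<Sum>i\<in>F. (norm (ell2_coord (X n) i - a i))\<^sup>2)"
      by (intro tendsto_intros a)
    have "(\<Sum>i\<in>F. (norm (ell2_coord (X n) i - ell2_coord (X m) i))\<^sup>2) \<le> e\<^sup>2" if "m \<ge> N" for m
    proof -
      have "(\<Sum>i\<in>F. (norm (ell2_coord (X n) i - ell2_coord (X m) i))\<^sup>2) \<le> (norm (X n - X m))\<^sup>2"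
        using sum_le_norm_ell2[OF \<open>finite F\<close>, of "X n - X m"] by (simp add: ell2_coord_diff)
      also have "\<dots> \<le> e\<^sup>2" by (intro power_mono less_imp_le[OF N[OF that]]) simp
      finally show ?thesis .
    qed
    then show "\<exists>N. \<forall>m\<ge>N. (\<Sum>i\<in>F. (norm (ell2_coord (X n) i - ell2_coord (X m) i))\<^sup>2) \<le> e\<^sup>2"
      by blast
  qed
  have diff: "(\<lambda>i. (norm (ell2_coord (X n) i - a i))\<^sup>2) summable_on UNIV"
    if "\<And>m. m \<ge> N \<Longrightarrow> norm (X n - X m) < e" for N n e
    by (rule nonneg_bdd_above_summable_on)
      (use key[OF that] in \<open>auto intro!: bdd_aboveI[of _ "e\<^sup>2"]\<close>)
  obtain N0 where N0: "\<And>m n. m \<ge> N0 \<Longrightarrow> n \<ge> N0 \<Longrightarrow> norm (X n - X m) < 1"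
    using CauchyD[OF X, of 1] by (metis zero_less_one)
  have "(\<lambda>i. (norm (ell2_coord (X N0) i + - (ell2_coord (X N0) i - a i)))\<^sup>2) summable_on UNIV"
    by (intro sq_summable_add ell2_sq_summable)
      (use diff[of N0 N0 1] N0 in \<open>simp add: norm_minus_commute\<close>)
  then have sa: "(\<lambda>i. (norm (a i))\<^sup>2) summable_on UNIV" by simp
  define L where "L = Abs_ell2 a"
  have L: "ell2_coord L = a" by (simp add: L_def Abs_ell2_inverse sa)
  have "X \<longlonglongrightarrow> L"
  proof (rule LIMSEQ_I)
    fix r :: real assume "0 < r"
    then obtain N where N: "\<And>m n. m \<ge> N \<Longrightarrow> n \<ge> N \<Longrightarrow> norm (X n - X m) < r / 2"
      using CauchyD[OF X, of "r / 2"] by (metis half_gt_zero)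
    have "norm (X n - L) < r" if "n \<ge> N" for n
    proof -
      have "(norm (X n - L))\<^sup>2 \<le> (r / 2)\<^sup>2"
        unfolding norm_ell2_sq ell2_coord_diff L
        by (rule infsum_le_finite_sums[OF diff[of N n "r / 2"]]) (use key[of N n "r / 2"] N that in auto)
      then have "norm (X n - L) \<le> r / 2" using \<open>0 < r\<close> by (simp add: power2_le_iff_abs_le)
      then show ?thesis using \<open>0 < r\<close> by simp
    qed
    then show "\<exists>N. \<forall>n\<ge>N. norm (X n - L) < r" by blast
  qed
  then show "convergent X" by (auto simp: convergent_def)
qed

instantiation ell2 :: (type, chilbert_space) chilbert_space
begin

lift_definition scaleC_ell2 :: "complex \<Rightarrow> ('a, 'b) ell2 \<Rightarrow> ('a, 'b) ell2"
  is "\<lambda>c a i. scaleC c (a i)" by (rule sq_summable_scaleC)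

definition cinner_ell2 :: "('a, 'b) ell2 \<Rightarrow> ('a, 'b) ell2 \<Rightarrow> complex"
  where "cinner_ell2 a b = (\<Sum>\<^sub>\<infinity>i. cinner (ell2_coord a i) (ell2_coord b i))"

instance
proof
  fix a b e :: "('a, 'b) ell2" and c d :: complex and r :: real
  show "scaleC c (a + b) = scaleC c a + scaleC c b" "scaleC (c + d) a = scaleC c a + scaleC d a"
    "scaleC c (scaleC d a) = scaleC (c * d) a" "scaleC (complex_of_real r) a = r *\<^sub>R a"
    by (transfer; simp add: scaleC_add_left scaleC_add_right scaleC_scaleC scaleC_of_real)+
  show "cinner (a + b) e = cinner a e + cinner b e"
    by (simp add: cinner_ell2_def plus_ell2.rep_eq cinner_add_left
        infsum_add[OF ell2_cinner_summable ell2_cinner_summable])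
  show "cinner (scaleC c a) b = c * cinner a b"
    by (simp add: cinner_ell2_def scaleC_ell2.rep_eq cinner_scaleC_left infsum_cmult_right')
  show "cinner a b = cnj (cinner b a)"
    unfolding cinner_ell2_def infsum_cnj[symmetric] by (rule infsum_cong) (rule cinner_commute)
  show "inner a b = Re (cinner a b)" by (simp add: inner_ell2_def cinner_ell2_def)
qed

end

section \<open>Orthonormal bases\<close>

definition orthonormal :: "'a::chilbert_space set \<Rightarrow> bool"
  where "orthonormal B \<longleftrightarrow>
    (\<forall>e\<in>B. norm e = 1) \<and> (\<forall>e\<in>B. \<forall>e'\<in>B. e \<noteq> e' \<longrightarrow> cinner e e' = 0)"

definition orthonormal_basis :: "'a::chilbert_space set \<Rightarrow> bool"
  where "orthonormal_basis B \<longleftrightarrow> orthonormal B \<and> closure (cspan B) = UNIV"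

definition hilbert_basis :: "'a::chilbert_space set"
  where "hilbert_basis = (SOME B. orthonormal_basis B)"

lemma closed_subspace_orthogonal:
  fixes M :: "'a::chilbert_space set"
  assumes M: "complex_vector.subspace M" "closed M" "M \<noteq> UNIV"
  shows "\<exists>z. norm z = 1 \<and> (\<forall>m\<in>M. cinner z m = 0)"
proof -
  obtain x where x: "x \<notin> M" using M(3) by blast
  have ne: "M \<noteq> {}" using complex_vector.subspace_0[OF M(1)] by auto
  define d where "d = infdist x M"
  have d_le: "d \<le> norm (x - m)" if "m \<in> M" for m
    using infdist_le[OF that, of x] by (simp add: d_def dist_norm)
  have d0: "0 \<le> d" by (simp add: d_def infdist_nonneg)
  have "\<exists>m\<in>M. norm (x - m) < d + 1 / real (Suc n)" for n
  proof (rule ccontr)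
    assume "\<not> ?thesis"
    then have "d + 1 / real (Suc n) \<le> infdist x M"
      unfolding infdist_notempty[OF ne] by (intro cINF_greatest ne) (auto simp: dist_norm not_less)
    then show False by (simp add: d_def field_simps)
  qed
  then obtain y where y: "\<And>n. y n \<in> M" "\<And>n. norm (x - y n) < d + 1 / real (Suc n)" by metis
  have lim: "(\<lambda>n. norm (x - y n)) \<longlonglongrightarrow> d"
  proof (rule tendsto_sandwich[where f = "\<lambda>_. d" and h = "\<lambda>n. d + 1 / real (Suc n)"])
    show "(\<lambda>n. d + 1 / real (Suc n)) \<longlonglongrightarrow> d"
      using tendsto_add[OF tendsto_const LIMSEQ_inverse_real_of_nat, of d] by (simp add: inverse_eq_divide)
  qed (use y d_le in \<open>auto intro!: always_eventually less_imp_le\<close>)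
  have par: "(norm (y m - y n))\<^sup>2 \<le> 2 * (norm (x - y m))\<^sup>2 + 2 * (norm (x - y n))\<^sup>2 - 4 * d\<^sup>2" for m n
  proof -
    have mid: "scaleR (1/2) (y m + y n) \<in> M"
      unfolding scaleR_scaleC
      by (intro complex_vector.subspace_scale[OF M(1)] complex_vector.subspace_add[OF M(1)] y)
    have "norm (x - scaleR (1/2) (y m + y n)) \<ge> d" using d_le[OF mid] .
    moreover have "(x - y m) + (x - y n) = scaleR 2 (x - scaleR (1/2) (y m + y n))"
      by (simp add: algebra_simps scaleR_2)
    ultimately have "2 * d \<le> norm ((x - y m) + (x - y n))" by simp
    then have "4 * d\<^sup>2 \<le> (norm ((x - y m) + (x - y n)))\<^sup>2"
      using power_mono[of "2 * d" _ 2] d0 by (simp add: power_mult_distrib)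
    moreover have "(norm ((x - y m) + (x - y n)))\<^sup>2 + (norm ((x - y n) - (x - y m)))\<^sup>2
        = 2 * (norm (x - y m))\<^sup>2 + 2 * (norm (x - y n))\<^sup>2"
      by (simp add: power2_norm_eq_inner inner_add_left inner_add_right inner_diff_left
          inner_diff_right inner_commute)
    ultimately show ?thesis by simp
  qed
  have "Cauchy y"
  proof (rule CauchyI)
    fix e :: real assume e: "0 < e"
    have "(\<lambda>n. 2 * (norm (x - y n))\<^sup>2 - 2 * d\<^sup>2) \<longlonglongrightarrow> 2 * d\<^sup>2 - 2 * d\<^sup>2"
      by (intro tendsto_intros lim)
    then have "(\<lambda>n. 2 * (norm (x - y n))\<^sup>2 - 2 * d\<^sup>2) \<longlonglongrightarrow> 0" by simp
    then have "\<forall>\<^sub>F n in sequentially. 2 * (norm (x - y n))\<^sup>2 - 2 * d\<^sup>2 < e\<^sup>2 / 2"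
      using e by (intro order_tendstoD) auto
    then obtain N where N: "\<And>n. n \<ge> N \<Longrightarrow> 2 * (norm (x - y n))\<^sup>2 - 2 * d\<^sup>2 < e\<^sup>2 / 2"
      by (auto simp: eventually_sequentially)
    have "norm (y m - y n) < e" if "m \<ge> N" "n \<ge> N" for m n
    proof -
      have "(norm (y m - y n))\<^sup>2 < e\<^sup>2" using par[of m n] N[OF that(1)] N[OF that(2)] by linarith
      then show ?thesis using e by (simp add: power2_less_imp_less)
    qed
    then show "\<exists>M. \<forall>m\<ge>M. \<forall>n\<ge>M. norm (y m - y n) < e" by blast
  qed
  then obtain p where p: "y \<longlonglongrightarrow> p" using Cauchy_convergent convergent_def by blast
  have pM: "p \<in> M" using closed_sequentially[OF M(2)] y(1) p by blast
  have "(\<lambda>n. norm (x - y n)) \<longlonglongrightarrow> norm (x - p)" by (intro tendsto_intros p)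
  then have dp: "norm (x - p) = d" using lim LIMSEQ_unique by blast
  have orth: "cinner (x - p) m = 0" if m: "m \<in> M" for m
  proof (cases "m = 0")
    case False
    define c where "c = cinner (x - p) m / (norm m)\<^sup>2"
    have nz: "(norm m)\<^sup>2 > 0" using False by simp
    have "p + scaleC c m \<in> M"
      by (intro complex_vector.subspace_add[OF M(1)] complex_vector.subspace_scale[OF M(1)] pM m)
    then have "d \<le> norm ((x - p) - scaleC c m)" using d_le by (simp add: diff_diff_eq)
    then have "(norm (x - p))\<^sup>2 \<le> (norm ((x - p) - scaleC c m))\<^sup>2"
      using dp d0 by (intro power_mono) auto
    also have "\<dots> = (norm (x - p))\<^sup>2 - 2 * inner (x - p) (scaleC c m) + (norm (scaleC c m))\<^sup>2"
      by (simp add: power2_norm_eq_inner inner_diff_left inner_diff_right inner_commute)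
    finally have le: "(norm (x - p))\<^sup>2
        \<le> (norm (x - p))\<^sup>2 - 2 * inner (x - p) (scaleC c m) + (norm (scaleC c m))\<^sup>2" .
    have "inner (x - p) (scaleC c m) = (cmod (cinner (x - p) m))\<^sup>2 / (norm m)\<^sup>2"
    proof -
      have "cnj c * cinner (x - p) m
          = complex_of_real ((cmod (cinner (x - p) m))\<^sup>2 / (norm m)\<^sup>2)"
        using complex_norm_square[of "cinner (x - p) m"] by (simp add: c_def mult.commute)
      then show ?thesis by (simp only: inner_eq_Re_cinner cinner_scaleC_right Re_complex_of_real)
    qed
    moreover have "(norm (scaleC c m))\<^sup>2 = (cmod (cinner (x - p) m))\<^sup>2 / (norm m)\<^sup>2"
    proof -
      have "norm (scaleC c m) = cmod (cinner (x - p) m) / norm m"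
        using False by (simp add: norm_scaleC c_def norm_divide norm_power norm_mult power2_eq_square)
      then show ?thesis by (simp add: power_divide)
    qed
    ultimately have "(cmod (cinner (x - p) m))\<^sup>2 / (norm m)\<^sup>2 \<le> 0" using le by linarith
    then show ?thesis using nz by (simp add: divide_le_0_iff)
  qed simp
  have xp: "x - p \<noteq> 0" using x pM by auto
  have "norm (scaleR (inverse (norm (x - p))) (x - p)) = 1" using xp by simp
  moreover have "cinner (scaleR (inverse (norm (x - p))) (x - p)) m = 0" if "m \<in> M" for m
    unfolding scaleR_scaleC cinner_scaleC_left orth[OF that] by simp
  ultimately show ?thesis by blast
qed

lemma bounded_linear_scaleC: "bounded_linear (scaleC c :: 'a \<Rightarrow> 'a::chilbert_space)"
  by (rule bounded_linear_intro[where K = "cmod c"])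
    (auto simp: scaleC_add_right scaleR_scaleC scaleC_scaleC norm_scaleC mult.commute)

lemma subspace_closure_cspan: "complex_vector.subspace (closure (cspan (B::'a::chilbert_space set)))"
  unfolding complex_vector.subspace_def
proof (intro conjI ballI allI)
  show "0 \<in> closure (cspan B)"
    using closure_subset complex_vector.span_zero by blast
next
  fix x y assume "x \<in> closure (cspan B)" "y \<in> closure (cspan B)"
  then obtain f g where "\<And>n::nat. f n \<in> cspan B" "f \<longlonglongrightarrow> x" "\<And>n::nat. g n \<in> cspan B" "g \<longlonglongrightarrow> y"
    unfolding closure_sequential by blast
  then show "x + y \<in> closure (cspan B)" unfolding closure_sequential
    by (intro exI[of _ "\<lambda>n. f n + g n"]) (auto intro: tendsto_add complex_vector.span_add)
next
  fix c x assume "x \<in> closure (cspan B)"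
  then obtain f where "\<And>n::nat. f n \<in> cspan B" "f \<longlonglongrightarrow> x"
    unfolding closure_sequential by blast
  then show "scaleC c x \<in> closure (cspan B)" unfolding closure_sequential
    by (intro exI[of _ "\<lambda>n. scaleC c (f n)"])
      (auto intro: bounded_linear.tendsto[OF bounded_linear_scaleC] complex_vector.span_scale)
qed

lemma orthonormal_basis_hilbert_basis: "orthonormal_basis (hilbert_basis :: 'a::chilbert_space set)"
proof -
  have "\<exists>B\<in>Collect orthonormal. \<forall>X\<in>Collect (orthonormal :: 'a set \<Rightarrow> bool). B \<subseteq> X \<longrightarrow> X = B"
  proof (rule subset_Zorn')
    fix C assume C: "subset.chain (Collect (orthonormal :: 'a set \<Rightarrow> bool)) C"
    have on: "orthonormal X" if "X \<in> C" for X
      using C that unfolding subset_chain_def by blast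
    show "\<Union>C \<in> Collect orthonormal"
      unfolding mem_Collect_eq orthonormal_def
    proof (intro conjI ballI impI)
      fix e assume "e \<in> \<Union>C"
      then show "norm e = 1"
        using on unfolding orthonormal_def by blast
      fix e' assume "e' \<in> \<Union>C" "e \<noteq> e'"
      then obtain X where "X \<in> C" "e \<in> X" "e' \<in> X"
        using C \<open>e \<in> \<Union>C\<close> unfolding subset_chain_def by blast
      then show "cinner e e' = 0"
        using on[OF \<open>X \<in> C\<close>] \<open>e \<noteq> e'\<close> unfolding orthonormal_def by blast
    qed
  qed
  then obtain B :: "'a set" where B: "orthonormal B" "\<And>X. orthonormal X \<Longrightarrow> B \<subseteq> X \<Longrightarrow> X = B" by auto
  have "closure (cspan B) = UNIV"
  proof (rule ccontr)
    assume "closure (cspan B) \<noteq> UNIV"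
    then obtain z where z: "norm z = 1" "\<And>m. m \<in> closure (cspan B) \<Longrightarrow> cinner z m = 0"
      using closed_subspace_orthogonal[OF subspace_closure_cspan closed_closure] by blast
    have zB: "cinner z e = 0" if "e \<in> B" for e
      using z(2) closure_subset complex_vector.span_base[OF that] by blast
    moreover have "cinner e z = 0" if "e \<in> B" for e
      using zB[OF that] cinner_commute[of e z] by simp
    ultimately have "orthonormal (insert z B)" using B(1) z(1) by (auto simp: orthonormal_def)
    then have "z \<in> B" using B(2) by blast
    then have "cinner z z = 0" using zB by blast
    then show False using z(1) by (simp add: cinner_self)
  qed
  then have "\<exists>B::'a set. orthonormal_basis B" using B(1) by (auto simp: orthonormal_basis_def)
  then show ?thesis unfolding hilbert_basis_def by (rule someI_ex)
qed

section \<open>Bounded operators, singular values and the Matsaev ideal\<close>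

text \<open>Operators on a Hilbert space are plain functions; the operator norm is \<^const>\<open>onorm\<close>.\<close>

definition bounded_clinear :: "('a::chilbert_space \<Rightarrow> 'b::chilbert_space) \<Rightarrow> bool"
  where "bounded_clinear T \<longleftrightarrow> bounded_linear T \<and> (\<forall>c x. T (scaleC c x) = scaleC c (T x))"

definition compact_operator :: "('a::chilbert_space \<Rightarrow> 'b::chilbert_space) \<Rightarrow> bool"
  where "compact_operator T \<longleftrightarrow> bounded_clinear T \<and> compact (closure (T ` cball 0 1))"

definition rank_le :: "('a::chilbert_space \<Rightarrow> 'b::chilbert_space) \<Rightarrow> nat \<Rightarrow> bool"
  where "rank_le R j \<longleftrightarrow> (\<exists>B. finite B \<and> card B \<le> j \<and> range R \<subseteq> cspan B)"

definition singular_value :: "nat \<Rightarrow> ('a::chilbert_space \<Rightarrow> 'b::chilbert_space) \<Rightarrow> real"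
  where "singular_value j T = Inf {onorm (\<lambda>x. T x - R x) | R. bounded_clinear R \<and> rank_le R j}"

definition matsaev_ideal :: "('a::chilbert_space \<Rightarrow> 'a) set"
  where "matsaev_ideal =
    {T. bounded_clinear T \<and> summable (\<lambda>j. singular_value j T / (1 + real j))}"

definition matsaev_norm :: "('a::chilbert_space \<Rightarrow> 'a) \<Rightarrow> real"
  where "matsaev_norm T = (\<Sum>j. singular_value j T / (1 + real j))"

section \<open>The Hilbert--Schmidt class\<close>

text \<open>As is well known, neither the class nor the inner product below depends on the choice of
  the orthonormal basis.\<close>

definition hilbert_schmidt :: "('a::chilbert_space \<Rightarrow> 'a) \<Rightarrow> bool"
  where "hilbert_schmidt T \<longleftrightarrow>
    bounded_clinear T \<and> (\<lambda>e. (norm (T e))\<^sup>2) summable_on hilbert_basis"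

typedef (overloaded) 'a hs = "{T :: 'a::chilbert_space \<Rightarrow> 'a. hilbert_schmidt T}"
  morphisms hs_op Abs_hs
  by (rule exI[of _ "\<lambda>_. 0"]) (simp add: hilbert_schmidt_def bounded_clinear_def)

setup_lifting type_definition_hs

text \<open>The class is isometrically embedded into the square summable families by restricting
  operators to the basis.\<close>

definition hs_fam :: "('a::chilbert_space \<Rightarrow> 'a) \<Rightarrow> 'a \<Rightarrow> 'a"
  where "hs_fam T e = (if e \<in> hilbert_basis then T e else 0)"

lemma hilbert_schmidt_fam:
  "hilbert_schmidt T \<longleftrightarrow> bounded_clinear T \<and> (\<lambda>e. (norm (hs_fam T e))\<^sup>2) summable_on UNIV"
proof -
  have "(\<lambda>e. (norm (T e))\<^sup>2) summable_on hilbert_basis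
      \<longleftrightarrow> (\<lambda>e. (norm (hs_fam T e))\<^sup>2) summable_on UNIV"
    by (rule summable_on_cong_neutral) (auto simp: hs_fam_def)
  then show ?thesis by (simp add: hilbert_schmidt_def)
qed

lemma bounded_clinear_add:
  "bounded_clinear S \<Longrightarrow> bounded_clinear T \<Longrightarrow> bounded_clinear (\<lambda>x. S x + T x)"
  by (auto simp: bounded_clinear_def bounded_linear_add scaleC_add_right)

lemma bounded_clinear_scaleC:
  assumes "bounded_clinear T" shows "bounded_clinear (\<lambda>x. scaleC c (T x))"
  using assms bounded_linear_compose[OF bounded_linear_scaleC, of T c]
  by (auto simp: bounded_clinear_def scaleC_scaleC mult.commute)

lemma hilbert_schmidt_add:
  assumes "hilbert_schmidt S" "hilbert_schmidt T" shows "hilbert_schmidt (\<lambda>x. S x + T x)"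
proof -
  have "hs_fam (\<lambda>x. S x + T x) = (\<lambda>e. hs_fam S e + hs_fam T e)" by (auto simp: hs_fam_def)
  then show ?thesis using assms unfolding hilbert_schmidt_fam
    by (simp add: bounded_clinear_add sq_summable_add)
qed

lemma hilbert_schmidt_scaleC:
  assumes "hilbert_schmidt T" shows "hilbert_schmidt (\<lambda>x. scaleC c (T x))"
proof -
  have "hs_fam (\<lambda>x. scaleC c (T x)) = (\<lambda>e. scaleC c (hs_fam T e))" by (auto simp: hs_fam_def)
  then show ?thesis using assms unfolding hilbert_schmidt_fam
    by (simp add: bounded_clinear_scaleC sq_summable_scaleC)
qed

lift_definition hs_ell2 :: "'a::chilbert_space hs \<Rightarrow> ('a, 'a) ell2" is hs_fam
  by (simp add: hilbert_schmidt_fam)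

lemma bounded_clinear_hs_op: "bounded_clinear (hs_op T)"
  using hs_op[of T] by (simp add: hilbert_schmidt_def)

lemma orthonormal_sum_norm:
  assumes "orthonormal B" "finite F" "F \<subseteq> B"
  shows "(norm (\<Sum>e\<in>F. scaleC (c e) e))\<^sup>2 = (\<Sum>e\<in>F. (cmod (c e))\<^sup>2)"
proof -
  have *: "cinner e e' = (if e = e' then 1 else 0)" if "e \<in> F" "e' \<in> F" for e e'
    using that assms by (auto simp: orthonormal_def cinner_self)
  have "cinner (\<Sum>e\<in>F. scaleC (c e) e) (\<Sum>e\<in>F. scaleC (c e) e)
      = (\<Sum>e\<in>F. \<Sum>e'\<in>F. c e * (cnj (c e') * cinner e e'))"
    by (subst cinner_sum_left, intro sum.cong refl)
      (simp only: cinner_sum_right cinner_scaleC_left cinner_scaleC_right mult.left_commute)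
  also have "\<dots> = (\<Sum>e\<in>F. \<Sum>e'\<in>F. if e = e' then c e * cnj (c e) else 0)"
    by (intro sum.cong refl) (auto simp: *)
  also have "\<dots> = (\<Sum>e\<in>F. complex_of_real ((cmod (c e))\<^sup>2))"
    using assms(2) by (simp add: complex_norm_square del: of_real_power)
  finally have "complex_of_real ((norm (\<Sum>e\<in>F. scaleC (c e) e))\<^sup>2)
      = complex_of_real (\<Sum>e\<in>F. (cmod (c e))\<^sup>2)" by (simp only: cinner_self of_real_sum)
  then show ?thesis using of_real_eq_iff by blast
qed

lemma norm_hs_op_le: "norm (hs_op T x) \<le> norm (hs_ell2 T) * norm x"
proof -
  let ?B = "hilbert_basis :: 'a set"
  have bl: "bounded_linear (hs_op T)" and sc: "\<And>c x. hs_op T (scaleC c x) = scaleC c (hs_op T x)"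
    using bounded_clinear_hs_op[of T] by (auto simp: bounded_clinear_def)
  have ob: "orthonormal ?B" "closure (cspan ?B) = UNIV"
    using orthonormal_basis_hilbert_basis by (auto simp: orthonormal_basis_def)
  have span: "norm (hs_op T x) \<le> norm (hs_ell2 T) * norm x" if mem: "x \<in> cspan ?B" for x
  proof -
    obtain F c where F: "finite F" "F \<subseteq> ?B" and x: "x = (\<Sum>e\<in>F. scaleC (c e) e)"
      using mem unfolding complex_vector.span_explicit by auto
    have "norm (hs_op T x) = norm (\<Sum>e\<in>F. scaleC (c e) (hs_op T e))"
      by (simp add: x linear_sum[OF bounded_linear.linear[OF bl]] sc)
    also have "\<dots> \<le> (\<Sum>e\<in>F. \<bar>cmod (c e)\<bar> * \<bar>norm (hs_op T e)\<bar>)"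
      by (rule order_trans[OF norm_sum]) (simp add: norm_scaleC)
    also have "\<dots> \<le> L2_set (\<lambda>e. cmod (c e)) F * L2_set (\<lambda>e. norm (hs_op T e)) F"
      by (rule L2_set_mult_ineq)
    also have "\<dots> \<le> norm x * norm (hs_ell2 T)"
    proof (rule mult_mono)
      show "L2_set (\<lambda>e. cmod (c e)) F \<le> norm x"
        unfolding L2_set_def x orthonormal_sum_norm[OF ob(1) F, of c, symmetric] by simp
      have "(\<Sum>e\<in>F. (norm (hs_op T e))\<^sup>2) = (\<Sum>e\<in>F. (norm (ell2_coord (hs_ell2 T) e))\<^sup>2)"
        using F(2) by (intro sum.cong refl) (auto simp: hs_ell2.rep_eq hs_fam_def)
      also have "\<dots> \<le> (norm (hs_ell2 T))\<^sup>2" by (rule sum_le_norm_ell2[OF F(1)])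
      finally show "L2_set (\<lambda>e. norm (hs_op T e)) F \<le> norm (hs_ell2 T)"
        unfolding L2_set_def by (rule real_le_lsqrt[OF norm_ge_zero])
    qed auto
    finally show ?thesis by (simp add: mult.commute)
  qed
  obtain f where f: "\<And>n::nat. f n \<in> cspan ?B" "f \<longlonglongrightarrow> x"
    using ob(2) closure_sequential[of x "cspan ?B"] by auto
  show ?thesis
  proof (rule LIMSEQ_le)
    show "(\<lambda>n. norm (hs_op T (f n))) \<longlonglongrightarrow> norm (hs_op T x)"
      by (intro tendsto_norm bounded_linear.tendsto[OF bl] f)
    show "(\<lambda>n. norm (hs_ell2 T) * norm (f n)) \<longlonglongrightarrow> norm (hs_ell2 T) * norm x"
      by (intro tendsto_intros f)
  qed (use span f in auto)
qed

instantiation hs :: (chilbert_space) real_inner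
begin

lift_definition zero_hs :: "'a hs" is "\<lambda>_. 0"
  by (simp add: hilbert_schmidt_def bounded_clinear_def)

lift_definition plus_hs :: "'a hs \<Rightarrow> 'a hs \<Rightarrow> 'a hs" is "\<lambda>S T x. S x + T x"
  by (rule hilbert_schmidt_add)

lift_definition uminus_hs :: "'a hs \<Rightarrow> 'a hs" is "\<lambda>T x. - T x"
  using hilbert_schmidt_scaleC[where c = "-1"]
  by (simp add: complex_vector.scale_minus_left scaleC_one)

definition minus_hs :: "'a hs \<Rightarrow> 'a hs \<Rightarrow> 'a hs"
  where "minus_hs S T = S + (- T)"

lift_definition scaleR_hs :: "real \<Rightarrow> 'a hs \<Rightarrow> 'a hs" is "\<lambda>r T x. r *\<^sub>R T x"
  unfolding scaleR_scaleC by (rule hilbert_schmidt_scaleC)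

definition inner_hs :: "'a hs \<Rightarrow> 'a hs \<Rightarrow> real"
  where "inner_hs S T = Re (\<Sum>\<^sub>\<infinity>e\<in>hilbert_basis. cinner (hs_op S e) (hs_op T e))"

definition norm_hs :: "'a hs \<Rightarrow> real"
  where "norm_hs T = sqrt (inner T T)"

definition dist_hs :: "'a hs \<Rightarrow> 'a hs \<Rightarrow> real"
  where "dist_hs S T = norm (S - T)"

definition sgn_hs :: "'a hs \<Rightarrow> 'a hs"
  where "sgn_hs T = scaleR (inverse (norm T)) T"

definition uniformity_hs :: "('a hs \<times> 'a hs) filter"
  where "uniformity_hs = (INF e\<in>{0 <..}. principal {(x, y). dist x y < e})"

definition open_hs :: "'a hs set \<Rightarrow> bool"
  where "open_hs S = (\<forall>x\<in>S. \<forall>\<^sub>F (x', y) in uniformity. x' = x \<longrightarrow> y \<in> S)"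

lemma hs_cinner_ell2:
  "(\<Sum>\<^sub>\<infinity>e\<in>hilbert_basis. cinner (hs_op S e) (hs_op T e)) = cinner (hs_ell2 S) (hs_ell2 T)"
  unfolding cinner_ell2_def
  by (rule infsum_cong_neutral) (auto simp: hs_ell2.rep_eq hs_fam_def)

lemma inner_hs_ell2: "inner S T = inner (hs_ell2 S) (hs_ell2 T)"
  unfolding inner_hs_def hs_cinner_ell2 inner_eq_Re_cinner ..

lemma hs_ell2_add: "hs_ell2 (S + T) = hs_ell2 S + hs_ell2 T"
  by transfer (auto simp: hs_fam_def)

lemma hs_ell2_scaleR: "hs_ell2 (r *\<^sub>R T) = r *\<^sub>R hs_ell2 T"
  by transfer (auto simp: hs_fam_def)

lemma hs_ell2_zero: "hs_ell2 0 = 0"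
  by transfer (auto simp: hs_fam_def)

instance
proof
  fix a b c :: "'a hs" and r s :: real
  show "a + b + c = a + (b + c)" "a + b = b + a" "0 + a = a" "- a + a = 0"
    by (transfer; simp add: algebra_simps fun_eq_iff)+
  show "a - b = a + - b" by (rule minus_hs_def)
  show "r *\<^sub>R (a + b) = r *\<^sub>R a + r *\<^sub>R b" "(r + s) *\<^sub>R a = r *\<^sub>R a + s *\<^sub>R a"
    "r *\<^sub>R s *\<^sub>R a = (r * s) *\<^sub>R a" "1 *\<^sub>R a = a"
    by (transfer; simp add: algebra_simps fun_eq_iff)+
  show "sgn a = inverse (norm a) *\<^sub>R a" by (simp add: sgn_hs_def)
  show "dist a b = norm (a - b)" by (simp add: dist_hs_def)
  show "(uniformity :: ('a hs \<times> 'a hs) filter)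
      = (INF e\<in>{0 <..}. principal {(x, y). dist x y < e})" by (simp add: uniformity_hs_def)
  show "norm a = sqrt (inner a a)" by (simp add: norm_hs_def)
  show "inner a b = inner b a" by (simp add: inner_hs_ell2 inner_commute)
  show "inner (a + b) c = inner a c + inner b c"
    by (simp add: inner_hs_ell2 hs_ell2_add inner_add_left)
  show "inner (r *\<^sub>R a) b = r * inner a b"
    by (simp add: inner_hs_ell2 hs_ell2_scaleR)
  show "0 \<le> inner a a" by (simp add: inner_hs_ell2)
  show "inner a a = 0 \<longleftrightarrow> a = 0"
  proof
    assume "inner a a = 0"
    then have "hs_ell2 a = 0" by (simp add: inner_hs_ell2)
    then have "hs_op a x = 0" for x using norm_hs_op_le[of a x] by simp
    then have "hs_op a = hs_op 0" by (auto simp: zero_hs.rep_eq)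
    then show "a = 0" by (simp add: hs_op_inject)
  qed (simp add: inner_hs_ell2 hs_ell2_zero)
next
  fix S :: "'a hs set"
  show "open S = (\<forall>x\<in>S. \<forall>\<^sub>F (x', y) in uniformity. x' = x \<longrightarrow> y \<in> S)"
    by (simp add: open_hs_def)
qed

end

lemma norm_hs_ell2: "norm T = norm (hs_ell2 T)"
  unfolding norm_eq_sqrt_inner[of T] norm_eq_sqrt_inner[of "hs_ell2 T"] inner_hs_ell2 ..

lemma hs_op_diff: "hs_op (S - T) x = hs_op S x - hs_op T x"
  unfolding minus_hs_def plus_hs.rep_eq uminus_hs.rep_eq by (rule diff_conv_add_uminus[symmetric])

lemma hs_ell2_diff: "hs_ell2 (S - T) = hs_ell2 S - hs_ell2 T"
  using hs_ell2_add[of "S - T" T] by (simp add: eq_diff_eq)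

instance hs :: (chilbert_space) banach
proof
  fix X :: "nat \<Rightarrow> 'a hs"
  assume X: "Cauchy X"
  have "Cauchy (\<lambda>n. hs_op (X n) x)" for x
  proof (rule CauchyI)
    fix e :: real assume "0 < e"
    then obtain N where N: "\<And>m n. m \<ge> N \<Longrightarrow> n \<ge> N \<Longrightarrow> norm (X m - X n) < e / (norm x + 1)"
      using CauchyD[OF X, of "e / (norm x + 1)"]
      by (metis add_nonneg_pos divide_pos_pos norm_ge_zero zero_less_one)
    have "norm (hs_op (X m) x - hs_op (X n) x) < e" if "m \<ge> N" "n \<ge> N" for m n
    proof -
      have "norm (hs_op (X m) x - hs_op (X n) x) \<le> norm (X m - X n) * norm x"
        using norm_hs_op_le[of "X m - X n" x] by (simp add: hs_op_diff norm_hs_ell2)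
      also have "\<dots> \<le> norm (X m - X n) * (norm x + 1)" by (intro mult_left_mono) auto
      also have "\<dots> < e"
        using N[OF that] by (simp add: less_divide_eq add_nonneg_pos)
      finally show ?thesis .
    qed
    then show "\<exists>M. \<forall>m\<ge>M. \<forall>n\<ge>M. norm (hs_op (X m) x - hs_op (X n) x) < e" by blast
  qed
  then have "\<exists>l. (\<lambda>n. hs_op (X n) x) \<longlonglongrightarrow> l" for x
    using Cauchy_convergent convergent_def by blast
  then obtain T where T: "\<And>x. (\<lambda>n. hs_op (X n) x) \<longlonglongrightarrow> T x" by metis
  have bl: "bounded_linear (hs_op (X n))"
    and sc: "hs_op (X n) (scaleC c x) = scaleC c (hs_op (X n) x)" for n c x
    using bounded_clinear_hs_op[of "X n"] by (auto simp: bounded_clinear_def)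
  obtain K where K: "\<And>n. norm (X n) \<le> K"
    using Cauchy_Bseq[OF X] by (auto simp: Bseq_def)
  have "T (x + y) = T x + T y" for x y
  proof (rule LIMSEQ_unique[OF T])
    show "(\<lambda>n. hs_op (X n) (x + y)) \<longlonglongrightarrow> T x + T y"
      using tendsto_add[OF T T, of x y] by (simp add: linear_add[OF bounded_linear.linear[OF bl]])
  qed
  moreover have Tsc: "T (scaleC c x) = scaleC c (T x)" for c x
  proof (rule LIMSEQ_unique[OF T])
    show "(\<lambda>n. hs_op (X n) (scaleC c x)) \<longlonglongrightarrow> scaleC c (T x)"
      unfolding sc by (rule bounded_linear.tendsto[OF bounded_linear_scaleC T])
  qed
  moreover have "norm (T x) \<le> norm x * K" for x
  proof (rule LIMSEQ_le_const2[OF tendsto_norm[OF T]])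
    have "norm (hs_op (X n) x) \<le> norm x * K" for n
      using norm_hs_op_le[of "X n" x] mult_right_mono[OF K[of n], of "norm x"]
      by (simp add: norm_hs_ell2 mult.commute)
    then show "\<exists>N. \<forall>n\<ge>N. norm (hs_op (X n) x) \<le> norm x * K" by blast
  qed
  ultimately have Tb: "bounded_clinear T"
    unfolding bounded_clinear_def
    by (auto intro!: bounded_linear_intro[where K = K] simp: scaleR_scaleC)
  have "Cauchy (\<lambda>n. hs_ell2 (X n))"
    using X by (simp add: Cauchy_def dist_norm norm_hs_ell2 hs_ell2_diff)
  then obtain a where a: "(\<lambda>n. hs_ell2 (X n)) \<longlonglongrightarrow> a" using Cauchy_convergent convergent_def by blast
  have "ell2_coord a e = hs_fam T e" for e
  proof (rule LIMSEQ_unique)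
    show "(\<lambda>n. ell2_coord (hs_ell2 (X n)) e) \<longlonglongrightarrow> ell2_coord a e"
    proof (rule LIM_zero_cancel, rule Lim_null_comparison)
      show "(\<lambda>n. norm (hs_ell2 (X n) - a)) \<longlonglongrightarrow> 0" using a by (simp add: LIM_zero tendsto_norm_zero)
      show "\<forall>\<^sub>F n in sequentially. norm (ell2_coord (hs_ell2 (X n)) e - ell2_coord a e)
          \<le> norm (hs_ell2 (X n) - a)"
        by (simp add: ell2_coord_diff[symmetric] norm_ell2_coord_le)
    qed
    show "(\<lambda>n. ell2_coord (hs_ell2 (X n)) e) \<longlonglongrightarrow> hs_fam T e"
      using T by (simp add: hs_ell2.rep_eq hs_fam_def)
  qed
  then have aT: "ell2_coord a = hs_fam T" by blast
  then have "hilbert_schmidt T"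
    using Tb ell2_sq_summable[of a] by (simp add: hilbert_schmidt_fam)
  then have "hs_ell2 (Abs_hs T) = a"
    by (metis Abs_hs_inverse aT ell2_coord_inject hs_ell2.rep_eq mem_Collect_eq)
  then have "(\<lambda>n. norm (X n - Abs_hs T)) \<longlonglongrightarrow> 0"
    using a by (simp add: norm_hs_ell2 hs_ell2_diff LIM_zero tendsto_norm_zero)
  then have "X \<longlonglongrightarrow> Abs_hs T" by (rule LIM_zero_cancel[OF tendsto_norm_zero_cancel])
  then show "convergent X" by (auto simp: convergent_def)
qed

instantiation hs :: (chilbert_space) chilbert_space
begin

lift_definition scaleC_hs :: "complex \<Rightarrow> 'a hs \<Rightarrow> 'a hs"
  is "\<lambda>c T x. scaleC c (T x)" by (rule hilbert_schmidt_scaleC)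

definition cinner_hs :: "'a hs \<Rightarrow> 'a hs \<Rightarrow> complex"
  where "cinner_hs S T = (\<Sum>\<^sub>\<infinity>e\<in>hilbert_basis. cinner (hs_op S e) (hs_op T e))"

instance
proof
  fix a b e :: "'a hs" and c d :: complex and r :: real
  show "scaleC c (a + b) = scaleC c a + scaleC c b" "scaleC (c + d) a = scaleC c a + scaleC d a"
    "scaleC c (scaleC d a) = scaleC (c * d) a" "scaleC (complex_of_real r) a = r *\<^sub>R a"
    by (transfer; simp add: scaleC_add_left scaleC_add_right scaleC_scaleC scaleC_of_real)+
  have sc: "hs_ell2 (scaleC c a) = scaleC c (hs_ell2 a)" by transfer (auto simp: hs_fam_def)
  show "cinner (a + b) e = cinner a e + cinner b e"
    unfolding cinner_hs_def hs_cinner_ell2 hs_ell2_add by (rule cinner_add_left)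
  show "cinner (scaleC c a) b = c * cinner a b"
    unfolding cinner_hs_def hs_cinner_ell2 sc by (rule cinner_scaleC_left)
  show "cinner a b = cnj (cinner b a)"
    unfolding cinner_hs_def hs_cinner_ell2 by (rule cinner_commute)
  show "inner a b = Re (cinner a b)" by (simp add: inner_hs_def cinner_hs_def)
qed

end

section \<open>Spectral measures and double operator integrals\<close>

definition orthogonal_projection :: "('a::chilbert_space \<Rightarrow> 'a) \<Rightarrow> bool"
  where "orthogonal_projection P \<longleftrightarrow> bounded_clinear P \<and> (\<forall>x. P (P x) = P x)
    \<and> (\<forall>x y. cinner (P x) y = cinner x (P y))"

text \<open>Only the \<sigma>-algebra of \<open>M\<close> is used; countable additivity is in the strong operator topology.\<close>

definition spectral_measure :: "'x measure \<Rightarrow> ('x set \<Rightarrow> 'a::chilbert_space \<Rightarrow> 'a) \<Rightarrow> bool"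
  where "spectral_measure M E \<longleftrightarrow>
    (\<forall>A\<in>sets M. orthogonal_projection (E A)) \<and> E (space M) = id \<and>
    (\<forall>A :: nat \<Rightarrow> 'x set. range A \<subseteq> sets M \<longrightarrow> disjoint_family A \<longrightarrow>
      (\<forall>x. (\<lambda>n. E (A n) x) sums E (\<Union>n. A n) x))"

definition spectral_scalar_measure ::
    "'x measure \<Rightarrow> ('x set \<Rightarrow> 'a::chilbert_space \<Rightarrow> 'a) \<Rightarrow> 'a \<Rightarrow> 'x measure"
  where "spectral_scalar_measure M E x =
    measure_of (space M) (sets M) (\<lambda>A. ennreal (Re (cinner (E A x) x)))"

text \<open>The operator \<open>\<integral>\<Phi> dE\<close>: as the scalars are complex, it is determined, via polarization, by its
  quadratic form.\<close>

definition spectral_integral ::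
    "'x measure \<Rightarrow> ('x set \<Rightarrow> 'a::chilbert_space \<Rightarrow> 'a) \<Rightarrow> ('x \<Rightarrow> complex) \<Rightarrow> 'a \<Rightarrow> 'a"
  where "spectral_integral M E \<Phi> = (THE Q. bounded_clinear Q \<and>
    (\<forall>x. cinner (Q x) x = integral\<^sup>L (spectral_scalar_measure M E x) \<Phi>))"

text \<open>The spectral measure on the Hilbert--Schmidt class. It is unique as a function of Borel sets;
  the choice operator is used since its values on other sets are unconstrained.\<close>

definition product_spectral_measure ::
    "(real set \<Rightarrow> 'a::chilbert_space \<Rightarrow> 'a) \<Rightarrow> (real set \<Rightarrow> 'a \<Rightarrow> 'a) \<Rightarrow>
      (real \<times> real) set \<Rightarrow> 'a hs \<Rightarrow> 'a hs"
  where "product_spectral_measure E1 E2 = (SOME \<E>. spectral_measure borel \<E> \<and>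
    (\<forall>A\<in>sets borel. \<forall>B\<in>sets borel. \<forall>T. hs_op (\<E> (A \<times> B) T) = E1 A \<circ> hs_op T \<circ> E2 B))"

definition double_operator_integral ::
    "(real set \<Rightarrow> 'a::chilbert_space \<Rightarrow> 'a) \<Rightarrow> (real set \<Rightarrow> 'a \<Rightarrow> 'a) \<Rightarrow>
      (real \<times> real \<Rightarrow> complex) \<Rightarrow> 'a hs \<Rightarrow> 'a hs"
  where "double_operator_integral E1 E2 \<Phi> T =
    spectral_integral borel (product_spectral_measure E1 E2) \<Phi> T"

definition divided_difference :: "(real \<Rightarrow> complex) \<Rightarrow> real \<times> real \<Rightarrow> complex"
  where "divided_difference f = (\<lambda>(x, y). if x = y then 0 else (f x - f y) / complex_of_real (x - y))"

definition doi_lipschitz ::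
    "(real set \<Rightarrow> 'a::chilbert_space \<Rightarrow> 'a) \<Rightarrow> (real set \<Rightarrow> 'a \<Rightarrow> 'a) \<Rightarrow>
      (real \<Rightarrow> complex) \<Rightarrow> 'a hs \<Rightarrow> 'a hs"
  where "doi_lipschitz E1 E2 f = double_operator_integral E1 E2 (divided_difference f)"

definition lip_norm :: "(real \<Rightarrow> complex) \<Rightarrow> real"
  where "lip_norm f = (SUP (x, y)\<in>{(x, y). x \<noteq> y}. cmod (f x - f y) / \<bar>x - y\<bar>)"

text \<open>\<open>J\<close> is a linear extension of \<open>T \<mapsto> I(f, T)\<close> to the Matsaev ideal, with compact values.
  Only the restriction of \<open>J\<close> to the Matsaev ideal matters.\<close>

definition matsaev_extension ::
    "(real set \<Rightarrow> 'a::chilbert_space \<Rightarrow> 'a) \<Rightarrow> (real set \<Rightarrow> 'a \<Rightarrow> 'a) \<Rightarrow>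
      (real \<Rightarrow> complex) \<Rightarrow> (('a \<Rightarrow> 'a) \<Rightarrow> ('a \<Rightarrow> 'a)) \<Rightarrow> bool"
  where "matsaev_extension E1 E2 f J \<longleftrightarrow>
    (\<forall>S\<in>matsaev_ideal. \<forall>T\<in>matsaev_ideal. J (\<lambda>x. S x + T x) = (\<lambda>x. J S x + J T x)) \<and>
    (\<forall>c. \<forall>T\<in>matsaev_ideal. J (\<lambda>x. scaleC c (T x)) = (\<lambda>x. scaleC c (J T x))) \<and>
    (\<forall>T\<in>matsaev_ideal. compact_operator (J T)) \<and>
    (\<forall>T. J (hs_op T) = hs_op (doi_lipschitz E1 E2 f T))"

text \<open>An absolute constant may not depend on the Hilbert space, but a type variable cannot be
  quantified inside a formula, and a constant asserted to exist for a fixed but arbitrary Hilbert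
  space type could vary with that type. The constant is therefore a single closed real number: some
  constant that works for the space of square summable complex sequences.\<close>

definition matsaev_constant :: real
  where "matsaev_constant = (SOME C. 0 < C \<and>
    (\<forall>f (E1 :: real set \<Rightarrow> (nat, complex) ell2 \<Rightarrow> (nat, complex) ell2) E2.
      (\<exists>L. L-lipschitz_on UNIV f) \<longrightarrow> spectral_measure borel E1 \<longrightarrow> spectral_measure borel E2 \<longrightarrow>
      (\<exists>J. matsaev_extension E1 E2 f J \<and>
        (\<forall>T\<in>matsaev_ideal. onorm (J T) \<le> C * lip_norm f * matsaev_norm T))))"

end

theory Submission
  imports Defs
begin

text \<open>By duality the estimate is a bound for the sum of
  \<open>divided_difference f (i, j) * cinner (T (x j)) (y i)\<close> over finite orthogonal families \<open>x\<close>,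
  \<open>y\<close>. The rank one transform with this kernel has singular values \<open>O(1 / n)\<close> (Nazarov and Peller):
  cut the line into about \<open>n\<close> intervals of mass at most \<open>1 / n\<close> and, on a product of two of them,
  freeze the variable lying in the shorter one; the error has squared Hilbert--Schmidt norm
  \<open>O(1 / n)\<close>, the frozen kernel has rank \<open>O(n)\<close>. Pairing these approximations for \<open>n = 2 ^ l\<close> with
  approximations of \<open>T\<close> of rank \<open>2 ^ l\<close> and summing over \<open>l\<close> costs
  \<open>\<Sum>\<^sub>l singular_value (2 ^ l) T\<close>, which is comparable to the Matsaev norm.

  The double operator integral is a limit of such finite sums, and finite rank operators are dense
  in the Matsaev ideal. As each finite sum only involves the matrix of \<open>T\<close> in two finite
  orthonormal families, it can be realized on the space of square summable sequences; hence the
  constant chosen there works for every Hilbert space.\<close>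

section \<open>Bounded operators and orthogonal families\<close>

text \<open>The weight \<open>1 / (1 + j)\<close> reflects an exact balance. Pairing an operator of
  rank about \<open>2 ^ l\<close> with a kernel of squared Hilbert--Schmidt norm about
  \<open>2 ^ (- l)\<close> costs a bounded multiple of the operator norm, because the square root of
  the rank cancels the Hilbert--Schmidt norm; so each dyadic level costs one singular value, with no
  decay in \<open>l\<close> left over.

  The error \<open>O(1 / n)\<close> of the kernel is a count: there are \<open>O(n)\<close> groups,
  a contributing pair of groups has mass \<open>O(1 / n ^ 2)\<close>, and for a fixed group the
  squared relative errors against all groups at least as long have a bounded sum, since long
  intervals cannot crowd near it. This is why the shorter side is the one to freeze.

  \<open>matsaev_constant\<close> comes from a choice operator, so nothing is known about it beyond
  its validity for sequences. The explicit value 2400 only shows that a valid constant exists. The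
  estimate on another space must therefore be extracted from the estimate for sequences as it
  stands, and the inequality for finite families is the form in which it can travel between
  types.\<close>

lemma bounded_clinear_linear: "bounded_clinear T \<Longrightarrow> bounded_linear T"
  and bounded_clinear_apply_scaleC: "bounded_clinear T \<Longrightarrow> T (scaleC c x) = scaleC c (T x)"
  by (auto simp: bounded_clinear_def)

lemma bounded_clinear_apply_add: "bounded_clinear T \<Longrightarrow> T (x + y) = T x + T y"
  by (simp add: bounded_clinear_linear linear_add bounded_linear.linear)

lemma bounded_clinear_apply_diff: "bounded_clinear T \<Longrightarrow> T (x - y) = T x - T y"
  by (simp add: bounded_clinear_linear linear_diff bounded_linear.linear)

lemma bounded_clinear_apply_zero: "bounded_clinear T \<Longrightarrow> T 0 = 0"
  by (simp add: bounded_clinear_linear linear_0 bounded_linear.linear)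

lemma bounded_clinear_apply_sum: "bounded_clinear T \<Longrightarrow> T (sum f A) = (\<Sum>a\<in>A. T (f a))"
  by (simp add: bounded_clinear_linear linear_sum bounded_linear.linear)

lemma bounded_clinear_zero [simp]: "bounded_clinear (\<lambda>_. 0)"
  by (simp add: bounded_clinear_def)

lemma bounded_clinear_ident: "bounded_clinear (\<lambda>x. x)"
  by (simp add: bounded_clinear_def)

lemma bounded_clinear_diff:
  assumes "bounded_clinear S" "bounded_clinear T" shows "bounded_clinear (\<lambda>x. S x - T x)"
  using assms by (auto simp: bounded_clinear_def bounded_linear_sub complex_vector.scale_right_diff_distrib)

lemma bounded_clinear_sum:
  "(\<And>a. a \<in> A \<Longrightarrow> bounded_clinear (f a)) \<Longrightarrow> bounded_clinear (\<lambda>x. \<Sum>a\<in>A. f a x)"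
  by (induction A rule: infinite_finite_induct) (auto intro: bounded_clinear_add)

lemma bounded_clinear_compose:
  assumes "bounded_clinear S" "bounded_clinear T" shows "bounded_clinear (\<lambda>x. S (T x))"
  using assms bounded_linear_compose[of S T] by (auto simp: bounded_clinear_def)

lemma bounded_clinearI:
  assumes "\<And>x y. T (x + y) = T x + T y" "\<And>c x. T (scaleC c x) = scaleC c (T x)"
    "\<And>x. norm (T x) \<le> norm x * K"
  shows "bounded_clinear T"
  unfolding bounded_clinear_def
  using assms by (auto intro!: bounded_linear_intro[where K = K] simp: scaleR_scaleC)

lemma norm_le_onorm: "bounded_clinear T \<Longrightarrow> norm (T x) \<le> onorm T * norm x"
  by (simp add: bounded_clinear_linear onorm)

lemma onorm_nonneg: "bounded_clinear T \<Longrightarrow> 0 \<le> onorm T"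
  by (simp add: bounded_clinear_linear onorm_pos_le)

lemma cinner_le_onorm:
  assumes "bounded_clinear T" shows "cmod (cinner (T x) y) \<le> onorm T * norm x * norm y"
  using norm_cinner_le[of "T x" y] mult_right_mono[OF norm_le_onorm[OF assms, of x], of "norm y"]
  by simp

lemma norm_le_cinner:
  assumes "0 \<le> K" "\<And>y. cmod (cinner x y) \<le> K * norm y"
  shows "norm x \<le> K"
proof (cases "x = 0")
  case False
  have "norm x * norm x \<le> K * norm x"
    using assms(2)[of x] by (simp add: cinner_self norm_power power2_eq_square norm_mult)
  then show ?thesis using False by simp
qed (use assms in simp)

lemma bounded_bilinear_cinner: "bounded_bilinear (cinner :: 'a::chilbert_space \<Rightarrow> 'a \<Rightarrow> complex)"
proof
  show "\<exists>K. \<forall>a b::'a. norm (cinner a b) \<le> norm a * norm b * K"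
    using norm_cinner_le by (intro exI[of _ 1]) auto
qed (auto simp: cinner_add_left cinner_add_right scaleR_scaleC cinner_scaleC_left
    cinner_scaleC_right scaleC_complex_def)

lemmas tendsto_cinner = bounded_bilinear.tendsto[OF bounded_bilinear_cinner]
lemmas cinner_diff_right = bounded_bilinear.diff_right[OF bounded_bilinear_cinner]

lemma tendsto_scaleC: "(f \<longlongrightarrow> a) F \<Longrightarrow> ((\<lambda>x. scaleC c (f x)) \<longlongrightarrow> scaleC c a) F"
  by (rule bounded_linear.tendsto[OF bounded_linear_scaleC])

lemma cinner_eq_zero_commute: "cinner x y = 0 \<longleftrightarrow> cinner y x = 0"
  using cinner_commute[of x y] by simp

lemma power2_norm_cinner: "(norm x)\<^sup>2 = Re (cinner x x)"
  by (simp add: cinner_self)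

text \<open>Testing the vanishing quadratic form of the difference on \<open>x + y\<close> and on
  \<open>x + scaleC \<i> y\<close> separates the two cross terms; over the reals a rotation by a
  right angle would be a counterexample. This gives the uniqueness required by the definite
  description in \<open>spectral_integral\<close>.\<close>

lemma polarization:
  fixes P Q :: "'a::chilbert_space \<Rightarrow> 'a"
  assumes P: "bounded_clinear P" and Q: "bounded_clinear Q"
    and eq: "\<And>x. cinner (P x) x = cinner (Q x) x"
  shows "P = Q"
proof
  fix x
  define D where "D x = P x - Q x" for x
  have D: "bounded_clinear D" unfolding D_def by (rule bounded_clinear_diff[OF P Q])
  have D0: "cinner (D z) z = 0" for z by (simp add: D_def cinner_diff_left eq)
  have 1: "cinner (D x) y + cinner (D y) x = 0" for y
    using D0[of "x + y"] D0[of x] D0[of y]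
    by (simp add: bounded_clinear_apply_add[OF D] cinner_add_left cinner_add_right add.commute)
  have "\<i> * cinner (D y) x = \<i> * cinner (D x) y" for y
    using 1[of "scaleC \<i> y"]
    by (simp add: bounded_clinear_apply_scaleC[OF D] cinner_scaleC_left cinner_scaleC_right)
  then have "cinner (D y) x = cinner (D x) y" for y by simp
  then have "cinner (D x) y = 0" for y using 1[of y] by simp
  then have "cinner (D x) (D x) = 0" by blast
  then show "P x = Q x" by (simp add: cinner_self D_def)
qed

text \<open>Members are not normalized and may vanish: the pieces of a vector under the projections
  of a spectral measure form such a family. Dividing by the norms, with
  \<open>inverse 0 = 0\<close>, then gives members of norm at most 1, which is the form used in the
  Bessel inequalities.\<close>

definition ortho_family :: "('i \<Rightarrow> 'a::chilbert_space) \<Rightarrow> 'i set \<Rightarrow> bool"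
  where "ortho_family x A \<longleftrightarrow> (\<forall>i\<in>A. \<forall>j\<in>A. i \<noteq> j \<longrightarrow> cinner (x i) (x j) = 0)"

lemma ortho_familyD: "ortho_family x A \<Longrightarrow> i \<in> A \<Longrightarrow> j \<in> A \<Longrightarrow> i \<noteq> j \<Longrightarrow> cinner (x i) (x j) = 0"
  by (auto simp: ortho_family_def)

lemma ortho_family_scaleC: "ortho_family x A \<Longrightarrow> ortho_family (\<lambda>i. scaleC (c i) (x i)) A"
  by (auto simp: ortho_family_def cinner_scaleC_left cinner_scaleC_right)

lemma orthonormal_ortho_family: "orthonormal G \<Longrightarrow> ortho_family (\<lambda>g. g) G"
  by (auto simp: ortho_family_def orthonormal_def)

section \<open>Pythagoras and Bessel for finite orthogonal families\<close>

lemma norm_sum_ortho: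
  assumes "finite A" "ortho_family x A"
  shows "(norm (\<Sum>i\<in>A. x i))\<^sup>2 = (\<Sum>i\<in>A. (norm (x i))\<^sup>2)"
proof -
  have "cinner (\<Sum>i\<in>A. x i) (\<Sum>i\<in>A. x i) = (\<Sum>i\<in>A. \<Sum>j\<in>A. cinner (x i) (x j))"
    by (subst cinner_sum_left) (simp add: cinner_sum_right)
  also have "\<dots> = (\<Sum>i\<in>A. \<Sum>j\<in>A. if i = j then cinner (x i) (x i) else 0)"
    by (intro sum.cong refl) (auto simp: ortho_familyD[OF assms(2)])
  also have "\<dots> = (\<Sum>i\<in>A. complex_of_real ((norm (x i))\<^sup>2))"
    using assms(1) by (simp add: cinner_self)
  finally have "complex_of_real ((norm (\<Sum>i\<in>A. x i))\<^sup>2) = complex_of_real (\<Sum>i\<in>A. (norm (x i))\<^sup>2)"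
    by (simp only: cinner_self of_real_sum)
  then show ?thesis using of_real_eq_iff by blast
qed

lemma norm_combination_le:
  assumes "finite A" "ortho_family e A" "\<And>i. i \<in> A \<Longrightarrow> norm (e i) \<le> 1"
  shows "(norm (\<Sum>i\<in>A. scaleC (c i) (e i)))\<^sup>2 \<le> (\<Sum>i\<in>A. (cmod (c i))\<^sup>2)"
  unfolding norm_sum_ortho[OF assms(1) ortho_family_scaleC[OF assms(2)]]
proof (rule sum_mono)
  fix i assume "i \<in> A"
  then have "(norm (e i))\<^sup>2 \<le> 1" using assms(3) by (simp add: power_le_one)
  then show "(norm (scaleC (c i) (e i)))\<^sup>2 \<le> (cmod (c i))\<^sup>2"
    by (simp add: norm_scaleC power_mult_distrib mult_left_le)
qed

lemma le_power2_of_le_mult_sqrt: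
  fixes S K :: real
  assumes "0 \<le> S" "S \<le> K * sqrt S" shows "S \<le> K\<^sup>2"
proof (cases "S = 0")
  case False
  then have "0 < sqrt S" using assms by simp
  moreover have "sqrt S * sqrt S \<le> K * sqrt S" using assms by simp
  ultimately have "sqrt S \<le> K" using mult_le_cancel_right_pos by blast
  then have "(sqrt S)\<^sup>2 \<le> K\<^sup>2" using assms by (intro power_mono) auto
  then show ?thesis using assms by simp
qed simp

text \<open>Finite dimensional duality: at \<open>c i = cnj (l i)\<close> the bound on the
  functional reads \<open>S \<le> K * sqrt S\<close>, where \<open>S\<close> is the sum to be
  estimated.\<close>

lemma bessel_bounded_functional:
  assumes l: "\<And>c. cmod (\<Sum>i\<in>A. c i * l i) \<le> K * sqrt (\<Sum>i\<in>A. (cmod (c i))\<^sup>2)"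
  shows "(\<Sum>i\<in>A. (cmod (l i))\<^sup>2) \<le> K\<^sup>2"
proof (rule le_power2_of_le_mult_sqrt)
  show "0 \<le> (\<Sum>i\<in>A. (cmod (l i))\<^sup>2)" by (intro sum_nonneg) simp
  have "(\<Sum>i\<in>A. cnj (l i) * l i) = complex_of_real (\<Sum>i\<in>A. (cmod (l i))\<^sup>2)"
    by (simp only: of_real_sum) (simp add: complex_norm_square mult.commute del: of_real_power)
  then have "cmod (\<Sum>i\<in>A. cnj (l i) * l i) = (\<Sum>i\<in>A. (cmod (l i))\<^sup>2)"
    by (simp only: norm_of_real) (simp add: sum_nonneg)
  then show "(\<Sum>i\<in>A. (cmod (l i))\<^sup>2) \<le> K * sqrt (\<Sum>i\<in>A. (cmod (l i))\<^sup>2)"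
    using l[of "\<lambda>i. cnj (l i)"] by simp
qed

text \<open>Bessel's inequality for the adjoint of \<open>T\<close> applied to \<open>g\<close>,
  phrased without the adjoint.\<close>

lemma bessel_operator:
  assumes A: "finite A" "ortho_family e A" "\<And>i. i \<in> A \<Longrightarrow> norm (e i) \<le> 1"
    and T: "bounded_clinear T" and g: "norm g \<le> 1"
  shows "(\<Sum>i\<in>A. (cmod (cinner (T (e i)) g))\<^sup>2) \<le> (onorm T)\<^sup>2"
proof (rule bessel_bounded_functional)
  fix c
  have "(\<Sum>i\<in>A. c i * cinner (T (e i)) g) = cinner (T (\<Sum>i\<in>A. scaleC (c i) (e i))) g"
    by (simp add: bounded_clinear_apply_sum[OF T] bounded_clinear_apply_scaleC[OF T]
        cinner_sum_left cinner_scaleC_left)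
  also have "cmod \<dots> \<le> onorm T * norm (\<Sum>i\<in>A. scaleC (c i) (e i)) * norm g"
    by (rule cinner_le_onorm[OF T])
  also have "\<dots> \<le> onorm T * norm (\<Sum>i\<in>A. scaleC (c i) (e i))"
    using g onorm_nonneg[OF T] by (simp add: mult_left_le)
  also have "\<dots> \<le> onorm T * sqrt (\<Sum>i\<in>A. (cmod (c i))\<^sup>2)"
    by (intro mult_left_mono onorm_nonneg[OF T] real_le_rsqrt norm_combination_le[OF A])
  finally show "cmod (\<Sum>i\<in>A. c i * cinner (T (e i)) g) \<le> onorm T * sqrt (\<Sum>i\<in>A. (cmod (c i))\<^sup>2)" .
qed

lemma bessel:
  assumes A: "finite A" "ortho_family e A" "\<And>i. i \<in> A \<Longrightarrow> norm (e i) \<le> 1"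
  shows "(\<Sum>i\<in>A. (cmod (cinner h (e i)))\<^sup>2) \<le> (norm h)\<^sup>2"
proof -
  have "(\<Sum>i\<in>A. (cmod (cinner (e i) h))\<^sup>2) \<le> (norm h)\<^sup>2"
  proof (rule bessel_bounded_functional)
    fix c
    have "(\<Sum>i\<in>A. c i * cinner (e i) h) = cinner (\<Sum>i\<in>A. scaleC (c i) (e i)) h"
      by (simp add: cinner_sum_left cinner_scaleC_left)
    also have "cmod \<dots> \<le> norm (\<Sum>i\<in>A. scaleC (c i) (e i)) * norm h" by (rule norm_cinner_le)
    also have "\<dots> \<le> sqrt (\<Sum>i\<in>A. (cmod (c i))\<^sup>2) * norm h"
      by (intro mult_right_mono real_le_rsqrt norm_combination_le[OF A]) auto
    finally show "cmod (\<Sum>i\<in>A. c i * cinner (e i) h) \<le> norm h * sqrt (\<Sum>i\<in>A. (cmod (c i))\<^sup>2)"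
      by (simp add: mult.commute)
  qed
  moreover have "cmod (cinner h (e i)) = cmod (cinner (e i) h)" for i
    by (subst cinner_commute) simp
  ultimately show ?thesis by simp
qed

lemma orthonormal_expansion:
  assumes G: "finite G" "orthonormal G" and z: "z \<in> cspan G"
  shows "z = (\<Sum>g\<in>G. scaleC (cinner z g) g)"
    and "(norm z)\<^sup>2 = (\<Sum>g\<in>G. (cmod (cinner z g))\<^sup>2)"
proof -
  obtain c where c: "z = (\<Sum>g\<in>G. scaleC (c g) g)"
    using z unfolding complex_vector.span_finite[OF G(1)] by auto
  have "cinner z g = c g" if "g \<in> G" for g
  proof -
    have "cinner z g = (\<Sum>h\<in>G. c h * cinner h g)"
      by (simp add: c cinner_sum_left cinner_scaleC_left)
    also have "\<dots> = (\<Sum>h\<in>G. if h = g then c g else 0)"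
      using G(2) that by (intro sum.cong refl) (auto simp: orthonormal_def cinner_self)
    finally show ?thesis using G(1) that by simp
  qed
  then show z: "z = (\<Sum>g\<in>G. scaleC (cinner z g) g)" by (simp add: c)
  show "(norm z)\<^sup>2 = (\<Sum>g\<in>G. (cmod (cinner z g))\<^sup>2)"
    by (subst z) (rule orthonormal_sum_norm[OF G(2,1)], simp)
qed

text \<open>\<open>rank_le\<close> only provides a spanning set; the trace estimates need an
  orthonormal one that is no larger.\<close>

lemma gram_schmidt:
  assumes "finite B"
  shows "\<exists>G. finite G \<and> card G \<le> card B \<and> orthonormal G \<and> cspan B \<subseteq> cspan G"
  using assms
proof induction
  case empty
  show ?case by (rule exI[of _ "{}"]) (simp add: orthonormal_def)
next
  case (insert b B)
  then obtain G where G: "finite G" "card G \<le> card B" "orthonormal G" "cspan B \<subseteq> cspan G" by blast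
  define p where "p = (\<Sum>g\<in>G. scaleC (cinner b g) g)"
  have p: "p \<in> cspan G" unfolding p_def
    by (intro complex_vector.span_sum complex_vector.span_scale complex_vector.span_base)
  have orth: "cinner (b - p) g = 0" if "g \<in> G" for g
  proof -
    have "cinner p g = (\<Sum>h\<in>G. if h = g then cinner b g else 0)"
      unfolding p_def cinner_sum_left cinner_scaleC_left
      using G(3) that by (intro sum.cong refl) (auto simp: orthonormal_def cinner_self)
    then show ?thesis using G(1) that by (simp add: cinner_diff_left)
  qed
  show ?case
  proof (cases "b = p")
    case True
    then have "insert b B \<subseteq> cspan G" using p G(4) complex_vector.span_superset by blast
    then have "cspan (insert b B) \<subseteq> cspan G"
      using complex_vector.span_minimal complex_vector.subspace_span by blast
    then show ?thesis using G insert.hyps by (intro exI[of _ G]) auto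
  next
    case False
    define r where "r = complex_of_real (inverse (norm (b - p)))"
    define e where "e = scaleC r (b - p)"
    have ne: "norm e = 1" using False by (simp add: e_def r_def norm_scaleC norm_inverse)
    have e0: "cinner e g = 0" if "g \<in> G" for g by (simp add: e_def cinner_scaleC_left orth[OF that])
    then have "cinner g e = 0" if "g \<in> G" for g using that cinner_eq_zero_commute by blast
    then have on: "orthonormal (insert e G)" using G(3) ne e0 by (auto simp: orthonormal_def)
    have "b - p = scaleC (complex_of_real (norm (b - p))) e"
      using False by (simp add: e_def r_def scaleC_scaleC scaleC_one)
    then have "b = p + scaleC (complex_of_real (norm (b - p))) e" by (simp add: algebra_simps)
    also have "\<dots> \<in> cspan (insert e G)"
      using p complex_vector.span_mono[OF subset_insertI, of G e]
      by (intro complex_vector.span_add complex_vector.span_scale) (auto intro: complex_vector.span_base)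
    finally have "b \<in> cspan (insert e G)" .
    moreover have "B \<subseteq> cspan (insert e G)"
      using G(4) complex_vector.span_superset[of B] complex_vector.span_mono[OF subset_insertI, of G e]
      by blast
    ultimately have "cspan (insert b B) \<subseteq> cspan (insert e G)"
      by (intro complex_vector.span_minimal complex_vector.subspace_span) auto
    moreover have "card (insert e G) \<le> card (insert b B)"
      using G insert.hyps by (simp add: card_insert_if)
    ultimately show ?thesis using G on by (intro exI[of _ "insert e G"]) auto
  qed
qed

text \<open>The comparison of Hilbert--Schmidt and operator norm in rank \<open>r\<close>. In an
  orthonormal set \<open>G\<close> of at most \<open>r\<close> vectors whose span contains the
  range, each \<open>g\<close> costs one application of \<open>bessel_operator\<close>.\<close>

lemma sum_norm_rank_le:
  assumes A: "finite A" "ortho_family e A" "\<And>i. i \<in> A \<Longrightarrow> norm (e i) \<le> 1"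
    and T: "bounded_clinear T" "rank_le T r"
  shows "(\<Sum>i\<in>A. (norm (T (e i)))\<^sup>2) \<le> real r * (onorm T)\<^sup>2"
proof -
  obtain B where "finite B" "card B \<le> r" "range T \<subseteq> cspan B" using T(2) by (auto simp: rank_le_def)
  then obtain G where G: "finite G" "card G \<le> r" "orthonormal G" "range T \<subseteq> cspan G"
    using gram_schmidt[of B] by force
  have "(\<Sum>i\<in>A. (norm (T (e i)))\<^sup>2) = (\<Sum>i\<in>A. \<Sum>g\<in>G. (cmod (cinner (T (e i)) g))\<^sup>2)"
    by (intro sum.cong refl orthonormal_expansion(2) G) (use G in blast)
  also have "\<dots> = (\<Sum>g\<in>G. \<Sum>i\<in>A. (cmod (cinner (T (e i)) g))\<^sup>2)" by (rule sum.swap)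
  also have "\<dots> \<le> (\<Sum>g\<in>G. (onorm T)\<^sup>2)"
    using G(3) by (intro sum_mono bessel_operator[OF A T(1)]) (auto simp: orthonormal_def)
  also have "\<dots> \<le> real r * (onorm T)\<^sup>2" using G(2) by (simp add: mult_right_mono)
  finally show ?thesis .
qed

section \<open>Trace estimates when one of the two factors has low rank\<close>

lemma sum_mult_le_sqrt:
  fixes a b :: "'i \<Rightarrow> real"
  assumes "\<And>i. i \<in> A \<Longrightarrow> 0 \<le> a i" "\<And>i. i \<in> A \<Longrightarrow> 0 \<le> b i"
  shows "(\<Sum>i\<in>A. a i * b i) \<le> sqrt (\<Sum>i\<in>A. (a i)\<^sup>2) * sqrt (\<Sum>i\<in>A. (b i)\<^sup>2)"
proof -
  have "(\<Sum>i\<in>A. a i * b i) = (\<Sum>i\<in>A. \<bar>a i\<bar> * \<bar>b i\<bar>)" using assms by (intro sum.cong) auto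
  then show ?thesis using L2_set_mult_ineq[of a b A] by (simp add: L2_set_def)
qed

lemma sum_cinner_le_sqrt:
  "cmod (\<Sum>i\<in>A. cinner (x i) (y i)) \<le> sqrt (\<Sum>i\<in>A. (norm (x i))\<^sup>2) * sqrt (\<Sum>i\<in>A. (norm (y i))\<^sup>2)"
  by (rule order_trans[OF norm_sum], rule order_trans[OF sum_mono sum_mult_le_sqrt])
    (auto intro: norm_cinner_le)

text \<open>Cauchy--Schwarz for the Hilbert--Schmidt pairing; the low rank of \<open>T\<close>
  controls its Hilbert--Schmidt norm on \<open>e\<close>.\<close>

lemma trace_le_rank_left:
  assumes A: "finite A" "ortho_family e A" "\<And>i. i \<in> A \<Longrightarrow> norm (e i) \<le> 1"
    and T: "bounded_clinear T" "rank_le T r"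
  shows "cmod (\<Sum>i\<in>A. cinner (T (e i)) (z i)) \<le> sqrt r * onorm T * sqrt (\<Sum>i\<in>A. (norm (z i))\<^sup>2)"
proof -
  have "sqrt (\<Sum>i\<in>A. (norm (T (e i)))\<^sup>2) \<le> sqrt (real r * (onorm T)\<^sup>2)"
    by (intro real_sqrt_le_mono sum_norm_rank_le[OF A T])
  also have "\<dots> = sqrt r * onorm T" by (simp add: real_sqrt_mult onorm_nonneg[OF T(1)])
  finally show ?thesis
    by (intro order_trans[OF sum_cinner_le_sqrt] mult_right_mono) (auto intro: sum_nonneg)
qed

text \<open>The low rank now sits in the second factor. \<open>T\<close> itself may have full rank,
  because only its components along the at most \<open>r\<close> vectors of \<open>G\<close> enter
  the sum.\<close>

lemma trace_le_rank_right:
  assumes A: "finite A" "ortho_family e A" "\<And>i. i \<in> A \<Longrightarrow> norm (e i) \<le> 1"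
    and T: "bounded_clinear T" and B: "finite B" "card B \<le> r" "\<And>i. i \<in> A \<Longrightarrow> z i \<in> cspan B"
  shows "cmod (\<Sum>i\<in>A. cinner (T (e i)) (z i)) \<le> sqrt r * onorm T * sqrt (\<Sum>i\<in>A. (norm (z i))\<^sup>2)"
proof -
  obtain G where G: "finite G" "card G \<le> r" "orthonormal G" "cspan B \<subseteq> cspan G"
    using gram_schmidt[OF B(1)] B(2) by force
  have zG: "z i \<in> cspan G" if "i \<in> A" for i using B(3)[OF that] G(4) by blast
  have 1: "(\<Sum>i\<in>A. (norm (z i))\<^sup>2) = (\<Sum>(i, g)\<in>A \<times> G. (cmod (cinner (z i) g))\<^sup>2)"
    unfolding sum.cartesian_product[symmetric]
    by (intro sum.cong refl orthonormal_expansion(2) G zG)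
  have "(\<Sum>(i, g)\<in>A \<times> G. (cmod (cinner (T (e i)) g))\<^sup>2) = (\<Sum>g\<in>G. \<Sum>i\<in>A. (cmod (cinner (T (e i)) g))\<^sup>2)"
    unfolding sum.cartesian_product[symmetric] by (rule sum.swap)
  also have "\<dots> \<le> (\<Sum>g\<in>G. (onorm T)\<^sup>2)"
    using G(3) by (intro sum_mono bessel_operator[OF A T]) (auto simp: orthonormal_def)
  also have "\<dots> \<le> real r * (onorm T)\<^sup>2" using G(2) by (simp add: mult_right_mono)
  finally have "sqrt (\<Sum>(i, g)\<in>A \<times> G. (cmod (cinner (T (e i)) g))\<^sup>2) \<le> sqrt (real r * (onorm T)\<^sup>2)"
    by (rule real_sqrt_le_mono)
  also have "\<dots> = sqrt r * onorm T" by (simp add: real_sqrt_mult onorm_nonneg[OF T])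
  finally have 2: "sqrt (\<Sum>(i, g)\<in>A \<times> G. (cmod (cinner (T (e i)) g))\<^sup>2) \<le> sqrt r * onorm T" .
  have "cinner (T (e i)) (z i) = (\<Sum>g\<in>G. cnj (cinner (z i) g) * cinner (T (e i)) g)" if "i \<in> A" for i
    by (subst orthonormal_expansion(1)[OF G(1,3) zG[OF that]])
      (simp add: cinner_sum_right cinner_scaleC_right)
  then have "(\<Sum>i\<in>A. cinner (T (e i)) (z i))
      = (\<Sum>(i, g)\<in>A \<times> G. cnj (cinner (z i) g) * cinner (T (e i)) g)"
    by (simp add: sum.cartesian_product[symmetric])
  also have "cmod \<dots> \<le> (\<Sum>(i, g)\<in>A \<times> G. cmod (cinner (T (e i)) g) * cmod (cinner (z i) g))"
    by (rule order_trans[OF norm_sum]) (auto intro!: sum_mono simp: norm_mult)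
  also have "\<dots> \<le> sqrt (\<Sum>p\<in>A \<times> G. (case p of (i, g) \<Rightarrow> cmod (cinner (T (e i)) g))\<^sup>2)
      * sqrt (\<Sum>p\<in>A \<times> G. (case p of (i, g) \<Rightarrow> cmod (cinner (z i) g))\<^sup>2)"
    using sum_mult_le_sqrt[of "A \<times> G" "\<lambda>(i, g). cmod (cinner (T (e i)) g)"
        "\<lambda>(i, g). cmod (cinner (z i) g)"] by (simp add: case_prod_unfold)
  also have "\<dots> \<le> sqrt r * onorm T * sqrt (\<Sum>i\<in>A. (norm (z i))\<^sup>2)"
    unfolding 1 using 2 by (intro mult_mono) (auto simp: case_prod_unfold intro!: mult_nonneg_nonneg sum_nonneg onorm_nonneg[OF T])
  finally show ?thesis .
qed

section \<open>Singular values and the Matsaev ideal\<close>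

lemma rank_le_mono: "rank_le R j \<Longrightarrow> j \<le> k \<Longrightarrow> rank_le R k"
  by (auto simp: rank_le_def intro: order_trans)

lemma rank_le_zero [simp]: "rank_le (\<lambda>_. 0) j"
  by (auto simp: rank_le_def intro!: exI[of _ "{}"])

lemma rank_le_diff:
  assumes "rank_le R j" "rank_le S k" shows "rank_le (\<lambda>x. R x - S x) (j + k)"
proof -
  obtain B C where B: "finite B" "card B \<le> j" "range R \<subseteq> cspan B"
    and C: "finite C" "card C \<le> k" "range S \<subseteq> cspan C" using assms by (auto simp: rank_le_def)
  have "card (B \<union> C) \<le> j + k" using card_Un_le[of B C] B(2) C(2) by linarith
  moreover have "R x - S x \<in> cspan (B \<union> C)" for x
  proof (rule complex_vector.span_diff)
    show "R x \<in> cspan (B \<union> C)" using B(3) complex_vector.span_mono[of B "B \<union> C"] by blast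
    show "S x \<in> cspan (B \<union> C)" using C(3) complex_vector.span_mono[of C "B \<union> C"] by blast
  qed
  ultimately show ?thesis unfolding rank_le_def using B(1) C(1) by (intro exI[of _ "B \<union> C"]) auto
qed

lemma cspan_image:
  assumes "bounded_clinear W" "x \<in> cspan B" shows "W x \<in> cspan (W ` B)"
  using assms(2)
proof (induction rule: complex_vector.span_induct_alt)
  case base
  show ?case by (simp add: bounded_clinear_apply_zero[OF assms(1)] complex_vector.span_zero)
next
  case (step c x y)
  then show ?case
    unfolding bounded_clinear_apply_add[OF assms(1)] bounded_clinear_apply_scaleC[OF assms(1)]
    by (intro complex_vector.span_add[OF complex_vector.span_scale[OF complex_vector.span_base]]) auto
qed

lemma rank_le_compose:
  assumes "rank_le R j" "bounded_clinear W" shows "rank_le (\<lambda>x. W (R (V x))) j"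
proof -
  obtain B where B: "finite B" "card B \<le> j" "range R \<subseteq> cspan B" using assms(1) by (auto simp: rank_le_def)
  have "card (W ` B) \<le> j" using card_image_le[OF B(1), of W] B(2) by linarith
  then show ?thesis unfolding rank_le_def using B cspan_image[OF assms(2)]
    by (intro exI[of _ "W ` B"]) auto
qed

lemma singular_value_le:
  assumes "bounded_clinear T" "bounded_clinear R" "rank_le R j"
  shows "singular_value j T \<le> onorm (\<lambda>x. T x - R x)"
  unfolding singular_value_def
proof (rule cInf_lower)
  show "bdd_below {onorm (\<lambda>x. T x - R x) |R. bounded_clinear R \<and> rank_le R j}"
    by (intro bdd_belowI[of _ 0]) (auto intro: onorm_nonneg bounded_clinear_diff[OF assms(1)])
qed (use assms in auto)

lemma singular_value_greatest:
  assumes "\<And>R. bounded_clinear R \<Longrightarrow> rank_le R j \<Longrightarrow> K \<le> onorm (\<lambda>x. T x - R x)"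
  shows "K \<le> singular_value j T"
  unfolding singular_value_def
  by (rule cInf_greatest) (use assms bounded_clinear_zero rank_le_zero in \<open>blast+\<close>)

lemma singular_value_nonneg: "bounded_clinear T \<Longrightarrow> 0 \<le> singular_value j T"
  by (rule singular_value_greatest) (intro onorm_nonneg bounded_clinear_diff)

lemma singular_value_approx:
  assumes "0 < e"
  shows "\<exists>R. bounded_clinear R \<and> rank_le R j \<and> onorm (\<lambda>x. T x - R x) < singular_value j T + e"
proof (rule ccontr)
  assume "\<not> ?thesis"
  then have "singular_value j T + e \<le> singular_value j T"
    by (intro singular_value_greatest) force
  then show False using assms by simp
qed

lemma singular_value_antimono:
  "bounded_clinear T \<Longrightarrow> j \<le> k \<Longrightarrow> singular_value k T \<le> singular_value j T"
  by (rule singular_value_greatest) (erule (1) singular_value_le, erule (1) rank_le_mono)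

lemma singular_value_le_onorm: "bounded_clinear T \<Longrightarrow> singular_value j T \<le> onorm T"
  using singular_value_le[of T "\<lambda>_. 0" j] by simp

lemma rank_le_0_iff: "rank_le R 0 \<longleftrightarrow> R = (\<lambda>_. 0)"
  by (auto simp: rank_le_def image_subset_iff)

lemma onorm_le_singular_value: "onorm T \<le> singular_value 0 T"
  by (rule singular_value_greatest) (simp add: rank_le_0_iff)

lemma singular_value_rank_le:
  assumes "bounded_clinear T" "rank_le T j" shows "singular_value j T = 0"
  using singular_value_le[OF assms(1) assms] singular_value_nonneg[OF assms(1), of j]
  by (simp add: onorm_zero)

text \<open>An approximant \<open>S\<close> of \<open>T\<close> yields the approximant
  \<open>S - R\<close> of \<open>T - R\<close>, with the same error and with rank enlarged by at
  most \<open>k\<close>.\<close>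

lemma singular_value_shift:
  assumes T: "bounded_clinear T" and R: "bounded_clinear R" "rank_le R k"
  shows "singular_value (j + k) (\<lambda>x. T x - R x) \<le> singular_value j T"
proof (rule singular_value_greatest)
  fix S :: "'a \<Rightarrow> 'b" assume S: "bounded_clinear S" "rank_le S j"
  have "singular_value (j + k) (\<lambda>x. T x - R x) \<le> onorm (\<lambda>x. (T x - R x) - (S x - R x))"
    by (intro singular_value_le bounded_clinear_diff T R S rank_le_diff)
  then show "singular_value (j + k) (\<lambda>x. T x - R x) \<le> onorm (\<lambda>x. T x - S x)" by simp
qed

lemma singular_value_compose_le:
  assumes T: "bounded_clinear T" and W: "bounded_clinear W" "\<And>x. norm (W x) \<le> norm x"
    and V: "bounded_clinear V" "\<And>x. norm (V x) \<le> norm x"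
  shows "singular_value j (\<lambda>x. W (T (V x))) \<le> singular_value j T"
proof (rule singular_value_greatest)
  have WV: "bounded_clinear (\<lambda>x. W (S (V x)))" if "bounded_clinear S" for S
    by (rule bounded_clinear_compose[OF W(1) bounded_clinear_compose[OF that V(1)]])
  fix S :: "'a \<Rightarrow> 'b" assume S: "bounded_clinear S" "rank_le S j"
  have "singular_value j (\<lambda>x. W (T (V x))) \<le> onorm (\<lambda>x. W (T (V x)) - W (S (V x)))"
    by (rule singular_value_le[OF WV[OF T] WV[OF S(1)] rank_le_compose[OF S(2) W(1)]])
  also have "\<dots> \<le> onorm (\<lambda>x. T x - S x)"
  proof (rule onorm_bound[OF onorm_nonneg[OF bounded_clinear_diff[OF T S(1)]]])
    fix x
    have "norm (W (T (V x)) - W (S (V x))) \<le> norm (T (V x) - S (V x))"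
      using W(2)[of "T (V x) - S (V x)"] by (simp add: bounded_clinear_apply_diff[OF W(1)])
    also have "\<dots> \<le> onorm (\<lambda>x. T x - S x) * norm (V x)"
      by (rule norm_le_onorm[OF bounded_clinear_diff[OF T S(1)]])
    also have "\<dots> \<le> onorm (\<lambda>x. T x - S x) * norm x"
      by (intro mult_left_mono V onorm_nonneg bounded_clinear_diff T S)
    finally show "norm (W (T (V x)) - W (S (V x))) \<le> onorm (\<lambda>x. T x - S x) * norm x" .
  qed
  finally show "singular_value j (\<lambda>x. W (T (V x))) \<le> onorm (\<lambda>x. T x - S x)" .
qed

section \<open>The Matsaev norm: comparison, dyadic form, density of finite rank\<close>

lemma matsaev_idealD:
  assumes "T \<in> matsaev_ideal"
  shows "bounded_clinear T" "summable (\<lambda>j. singular_value j T / (1 + real j))"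
  using assms by (auto simp: matsaev_ideal_def)

lemma matsaev_mono:
  assumes "bounded_clinear S" "T \<in> matsaev_ideal" "\<And>j. singular_value j S \<le> singular_value j T"
  shows "S \<in> matsaev_ideal" "matsaev_norm S \<le> matsaev_norm T"
proof -
  have le: "singular_value j S / (1 + real j) \<le> singular_value j T / (1 + real j)" for j
    using assms(3) by (simp add: divide_right_mono)
  have sm: "summable (\<lambda>j. singular_value j S / (1 + real j))"
    by (rule summable_comparison_test'[OF matsaev_idealD(2)[OF assms(2)], of 0])
      (use le singular_value_nonneg[OF assms(1)] in simp)
  then show "S \<in> matsaev_ideal" using assms(1) by (simp add: matsaev_ideal_def)
  show "matsaev_norm S \<le> matsaev_norm T" unfolding matsaev_norm_def
    by (rule suminf_le[OF le sm matsaev_idealD(2)[OF assms(2)]])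
qed

lemma matsaev_finite_rank:
  assumes "bounded_clinear T" "rank_le T r" shows "T \<in> matsaev_ideal"
proof -
  have "summable (\<lambda>j. singular_value j T / (1 + real j))"
  proof (rule summable_finite[of "{..<r}"])
    fix j assume "j \<notin> {..<r}"
    then have "rank_le T j" using assms(2) by (auto intro: rank_le_mono)
    then show "singular_value j T / (1 + real j) = 0" using singular_value_rank_le[OF assms(1)] by simp
  qed simp
  then show ?thesis using assms by (simp add: matsaev_ideal_def)
qed

lemma matsaev_partial_sum_le:
  assumes "T \<in> matsaev_ideal"
  shows "(\<Sum>j<n. singular_value j T / (1 + real j)) \<le> matsaev_norm T"
  unfolding matsaev_norm_def
  by (rule sum_le_suminf[OF matsaev_idealD(2)[OF assms]])
    (auto simp: singular_value_nonneg[OF matsaev_idealD(1)[OF assms]])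

lemma onorm_le_matsaev_norm: "T \<in> matsaev_ideal \<Longrightarrow> onorm T \<le> matsaev_norm T"
  using matsaev_partial_sum_le[of T 1] onorm_le_singular_value[of T] by simp

lemma matsaev_norm_nonneg: "T \<in> matsaev_ideal \<Longrightarrow> 0 \<le> matsaev_norm T"
  using onorm_le_matsaev_norm onorm_nonneg matsaev_idealD(1) order_trans by blast

text \<open>Cauchy condensation: the weights on the block from \<open>2 ^ n\<close> to
  \<open>2 ^ Suc n\<close> add up to at least \<open>1 / 2\<close>, and every singular value of the
  block is at least the one at its right end.\<close>

lemma dyadic_singular_values_le:
  assumes "bounded_clinear T"
  shows "(\<Sum>l\<le>n. singular_value (2 ^ l) T) \<le> 2 * (\<Sum>j<2 ^ n. singular_value j T / (1 + real j))"
proof (induction n)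
  case 0
  show ?case using singular_value_antimono[OF assms, of 0 1] singular_value_nonneg[OF assms, of 1] by simp
next
  case (Suc n)
  let ?s = "\<lambda>j. singular_value j T"
  have "?s (2 ^ Suc n) / 2 = (\<Sum>j\<in>{2 ^ n..<2 ^ Suc n :: nat}. ?s (2 ^ Suc n) / 2 ^ Suc n)" by simp
  also have "\<dots> \<le> (\<Sum>j\<in>{2 ^ n..<2 ^ Suc n}. ?s j / (1 + real j))"
  proof (intro sum_mono frac_le)
    fix j :: nat assume "j \<in> {2 ^ n..<2 ^ Suc n}"
    then have j: "j < 2 ^ Suc n" by simp
    then show "?s (2 ^ Suc n) \<le> ?s j" by (intro singular_value_antimono assms) simp
    have "real (Suc j) \<le> real (2 ^ Suc n)" using j by (intro of_nat_mono) simp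
    then show "1 + real j \<le> 2 ^ Suc n" by simp
  qed (auto intro: singular_value_nonneg[OF assms])
  finally have "?s (2 ^ Suc n) \<le> 2 * (\<Sum>j\<in>{2 ^ n..<2 ^ Suc n}. ?s j / (1 + real j))" by simp
  moreover have "(\<Sum>j<2 ^ Suc n. ?s j / (1 + real j))
      = (\<Sum>j<2 ^ n. ?s j / (1 + real j)) + (\<Sum>j\<in>{2 ^ n..<2 ^ Suc n}. ?s j / (1 + real j))"
    using sum.atLeastLessThan_concat[of 0 "2 ^ n" "2 ^ Suc n" "\<lambda>j. ?s j / (1 + real j)"]
    by (simp add: atLeast0LessThan)
  ultimately show ?case using Suc.IH by (simp add: algebra_simps)
qed

lemma dyadic_le_matsaev_norm:
  "T \<in> matsaev_ideal \<Longrightarrow> (\<Sum>l\<le>n. singular_value (2 ^ l) T) \<le> 2 * matsaev_norm T"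
  by (rule order_trans[OF dyadic_singular_values_le])
    (auto intro: matsaev_idealD matsaev_partial_sum_le)

text \<open>For \<open>2 ^ n \<le> j\<close> each of the \<open>n + 1\<close> dyadic singular values
  up to \<open>2 ^ n\<close> is at least the one at \<open>j\<close>, while their sum stays below
  \<open>2 * matsaev_norm T\<close>. This logarithmic rate suffices.\<close>

lemma singular_value_tendsto_0:
  assumes T: "T \<in> matsaev_ideal" shows "(\<lambda>j. singular_value j T) \<longlonglongrightarrow> 0"
proof -
  let ?s = "\<lambda>j. singular_value j T"
  note bc = matsaev_idealD(1)[OF T]
  have n0: "0 \<le> ?s j" for j by (rule singular_value_nonneg[OF bc])
  have "?s j \<le> 2 * matsaev_norm T / real (Suc n)" if "2 ^ n \<le> j" for n j
  proof -
    have "real (Suc n) * ?s j = (\<Sum>l\<le>n. ?s j)" by simp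
    also have "\<dots> \<le> (\<Sum>l\<le>n. ?s (2 ^ l))"
    proof (intro sum_mono singular_value_antimono bc)
      fix l assume "l \<in> {..n}"
      then have "(2::nat) ^ l \<le> 2 ^ n" by (intro power_increasing) auto
      then show "2 ^ l \<le> j" using that order_trans by blast
    qed
    also have "\<dots> \<le> 2 * matsaev_norm T" by (rule dyadic_le_matsaev_norm[OF T])
    finally show ?thesis by (simp add: field_simps)
  qed
  note bd = this
  show ?thesis
  proof (rule LIMSEQ_I)
    fix r :: real assume "0 < r"
    moreover have "(\<lambda>n. 2 * matsaev_norm T / real (Suc n)) \<longlonglongrightarrow> 0"
      by (rule LIMSEQ_Suc[OF lim_const_over_n])
    ultimately obtain n where "2 * matsaev_norm T / real (Suc n) < r"
      using order_tendstoD(2) eventually_sequentially by (metis (no_types, lifting) order_refl)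
    then show "\<exists>n0. \<forall>j\<ge>n0. norm (?s j - 0) < r" using bd[of n] n0
      by (intro exI[of _ "2 ^ n"]) (auto intro: order_le_less_trans)
  qed
qed

text \<open>The indices \<open>2 * m\<close> and \<open>Suc (2 * m)\<close> both carry the value
  \<open>a m\<close>, with weights at most \<open>1 / (1 + real m)\<close>, so stretching the
  indices at most doubles the sum.\<close>

lemma summable_div_2:
  fixes a :: "nat \<Rightarrow> real"
  assumes "\<And>j. 0 \<le> a j" "summable (\<lambda>j. a j / (1 + real j))"
  shows "summable (\<lambda>j. a (j div 2) / (1 + real j))"
proof (rule bounded_imp_summable)
  fix n
  let ?b = "\<lambda>j. a (j div 2) / (1 + real j)"
  have b0: "0 \<le> ?b j" for j using assms(1) by simp
  have "(\<Sum>j\<le>n. ?b j) \<le> (\<Sum>j<2 * Suc n. ?b j)"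
    by (rule sum_mono2) (use b0 in auto)
  also have "(\<Sum>j<2 * m. ?b j) \<le> 2 * (\<Sum>j<m. a j / (1 + real j))" for m
  proof (induction m)
    case (Suc m)
    have "?b (2 * m) \<le> a m / (1 + real m)" "?b (Suc (2 * m)) \<le> a m / (1 + real m)"
      using assms(1)[of m] by (auto intro!: divide_left_mono)
    moreover have "(\<Sum>j<2 * Suc m. ?b j) = (\<Sum>j<2 * m. ?b j) + ?b (2 * m) + ?b (Suc (2 * m))" by simp
    moreover have "(\<Sum>j<Suc m. a j / (1 + real j)) = (\<Sum>j<m. a j / (1 + real j)) + a m / (1 + real m)"
      by simp
    ultimately show ?case using Suc.IH by linarith
  qed simp
  also have "(\<Sum>j<Suc n. a j / (1 + real j)) \<le> (\<Sum>j. a j / (1 + real j))"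
    by (rule sum_le_suminf[OF assms(2)]) (auto simp: assms(1))
  finally show "(\<Sum>j\<le>n. ?b j) \<le> 2 * (\<Sum>j. a j / (1 + real j))" by simp
qed (use assms in simp)

text \<open>Dominated convergence for series. For each fixed index the singular values of the
  remainders tend to 0 because their operator norms do. A majorant independent of \<open>k\<close>
  comes from the operator norm if \<open>j div 2 \<le> k\<close>, and from
  \<open>singular_value_shift\<close> otherwise.\<close>

lemma matsaev_finite_rank_dense:
  assumes T: "T \<in> matsaev_ideal"
  obtains R where "\<And>k. bounded_clinear (R k)" "\<And>k. rank_le (R k) k"
    "\<And>k. (\<lambda>x. T x - R k x) \<in> matsaev_ideal"
    "(\<lambda>k. matsaev_norm (\<lambda>x. T x - R k x)) \<longlonglongrightarrow> 0"
proof -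
  let ?s = "\<lambda>j. singular_value j T"
  note bc = matsaev_idealD(1)[OF T]
  \<comment> \<open>The infimum need not be attained, hence the slack; being geometric it is
    summable and can stay in the majorant.\<close>
  have "\<exists>R. bounded_clinear R \<and> rank_le R k \<and> onorm (\<lambda>x. T x - R x) < ?s k + (1 / 2) ^ k" for k
    by (rule singular_value_approx) simp
  then obtain R where R: "\<And>k. bounded_clinear (R k)" "\<And>k. rank_le (R k) k"
    "\<And>k. onorm (\<lambda>x. T x - R k x) < ?s k + (1 / 2) ^ k" by metis
  define D where "D k = (\<lambda>x. T x - R k x)" for k
  have bD: "bounded_clinear (D k)" for k unfolding D_def by (rule bounded_clinear_diff[OF bc R(1)])
  have d0: "0 \<le> singular_value j (D k)" for j k by (rule singular_value_nonneg[OF bD])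
  have u: "singular_value j (D k) \<le> ?s k + (1 / 2) ^ k" for j k
    using singular_value_le_onorm[OF bD, of j k] R(3)[of k] by (simp add: D_def)
  have dom: "singular_value j (D k) \<le> ?s (j div 2) + (1 / 2) ^ (j div 2)" for j k
  proof (cases "j div 2 \<le> k")
    case True
    have "(1 / 2 :: real) ^ k \<le> (1 / 2) ^ (j div 2)" using True by (intro power_decreasing) auto
    then show ?thesis using u[of j k] singular_value_antimono[OF bc True] by linarith
  next
    case False
    have "singular_value (j - k + k) (D k) \<le> ?s (j - k)"
      unfolding D_def by (rule singular_value_shift[OF bc R(1,2)])
    \<comment> \<open>From \<open>k < j div 2\<close> at least \<open>j div 2\<close> indices remain
      after the shift by \<open>k\<close>.\<close>
    also have "\<dots> \<le> ?s (j div 2)" using False by (intro singular_value_antimono bc) linarith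
    finally have "singular_value j (D k) \<le> ?s (j div 2)" using False by simp
    moreover have "0 \<le> (1 / 2 :: real) ^ (j div 2)" by simp
    ultimately show ?thesis by linarith
  qed
  have "summable (\<lambda>j. (1 / 2 :: real) ^ j / (1 + real j))"
    by (rule summable_comparison_test'[OF summable_geometric[of "1 / 2"], of 0])
      (auto simp: divide_le_eq mult_le_cancel_left1)
  then have "summable (\<lambda>j. (?s (j div 2) + (1 / 2) ^ (j div 2)) / (1 + real j))"
    using singular_value_nonneg[OF bc] matsaev_idealD(2)[OF T]
    by (intro summable_div_2[where a = "\<lambda>j. ?s j + (1 / 2) ^ j"])
      (auto simp: add_divide_distrib intro: summable_add)
  note sm = this
  have le: "norm (singular_value j (D k) / (1 + real j))
      \<le> (?s (j div 2) + (1 / 2) ^ (j div 2)) / (1 + real j)" for j k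
    using dom[of j k] d0[of j k] by (auto intro!: divide_right_mono)
  have ideal: "D k \<in> matsaev_ideal" for k
    using summable_comparison_test'[OF sm le] bD by (auto simp: matsaev_ideal_def)
  have "(\<lambda>k. \<Sum>j. singular_value j (D k) / (1 + real j)) \<longlonglongrightarrow> (\<Sum>j::nat. 0)"
  proof (rule tannerys_theorem[THEN conjunct2, THEN conjunct2])
    fix j
    have "(\<lambda>k. ?s k + (1 / 2) ^ k) \<longlonglongrightarrow> 0 + 0"
      by (intro tendsto_add singular_value_tendsto_0[OF T] LIMSEQ_power_zero) simp
    then have lim: "(\<lambda>k. ?s k + (1 / 2) ^ k) \<longlonglongrightarrow> 0" by simp
    have "(\<lambda>k. singular_value j (D k)) \<longlonglongrightarrow> 0"
    proof (rule Lim_null_comparison[OF always_eventually lim], rule allI)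
      show "norm (singular_value j (D k)) \<le> ?s k + (1 / 2) ^ k" for k
        using u[of j k] d0[of j k] by simp
    qed
    then show "(\<lambda>k. singular_value j (D k) / (1 + real j)) \<longlonglongrightarrow> 0"
      by (rule tendsto_divide_zero)
    show "\<forall>\<^sub>F (j, k) in sequentially \<times>\<^sub>F sequentially. norm (singular_value j (D k) / (1 + real j))
      \<le> (?s (j div 2) + (1 / 2) ^ (j div 2)) / (1 + real j)"
      by (rule always_eventually) (use le in \<open>simp add: case_prod_unfold\<close>)
  qed (use sm in auto)
  then have "(\<lambda>k. matsaev_norm (D k)) \<longlonglongrightarrow> 0" by (simp add: matsaev_norm_def)
  then show ?thesis using that[of R] R(1,2) ideal unfolding D_def by blast
qed

section \<open>Low rank approximation of the divided difference\<close>

lemma divided_difference_commute: "divided_difference f (x, y) = divided_difference f (y, x)"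
proof (cases "x = y")
  case False
  then have "(f x - f y) / complex_of_real (x - y) = (f y - f x) / complex_of_real (y - x)"
    by (simp add: divide_simps) (simp add: algebra_simps)
  then show ?thesis using False by (simp add: divided_difference_def)
qed simp

lemma norm_divided_difference_le:
  assumes "\<And>x y. cmod (f x - f y) \<le> L * \<bar>x - y\<bar>"
  shows "cmod (divided_difference f (x, y)) \<le> L"
proof (cases "x = y")
  case True
  have "0 \<le> L" using order_trans[OF norm_ge_zero assms[of 1 0]] by simp
  then show ?thesis using True by (simp add: divided_difference_def)
next
  case False
  then show ?thesis using assms[of x y]
    by (simp add: divided_difference_def norm_divide divide_le_eq
        del: of_real_diff)
qed

text \<open>With \<open>D\<close> the divided difference, clearing denominators gives \<open>(D (x,
  y) - D (c, y)) * (x - y) = (f x - f c) - D (c, y) * (x - c)\<close>, and both terms on the right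
  are at most \<open>L\<close> times the distance of \<open>x\<close> and \<open>c\<close>.\<close>

lemma divided_difference_error:
  assumes L: "\<And>x y. cmod (f x - f y) \<le> L * \<bar>x - y\<bar>" and ne: "x \<noteq> y" "c \<noteq> y"
  shows "cmod (divided_difference f (x, y) - divided_difference f (c, y)) \<le> 2 * L * (\<bar>x - c\<bar> / \<bar>x - y\<bar>)"
proof -
  let ?D = "divided_difference f"
  let ?z = "complex_of_real (x - y)"
  have z: "?z \<noteq> 0" using ne by simp
  have "?D (x, y) * ?z = f x - f y" using ne z by (simp add: divided_difference_def del: of_real_diff)
  moreover have "?D (c, y) * complex_of_real (c - y) = f c - f y"
    using ne by (simp add: divided_difference_def del: of_real_diff)
  moreover have "?D (c, y) * ?z = ?D (c, y) * complex_of_real (c - y) + ?D (c, y) * complex_of_real (x - c)"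
    by (simp add: algebra_simps)
  ultimately have "(?D (x, y) - ?D (c, y)) * ?z = (f x - f c) - ?D (c, y) * complex_of_real (x - c)"
    by (simp only: left_diff_distrib) simp
  then have "cmod (?D (x, y) - ?D (c, y)) * \<bar>x - y\<bar> = cmod ((f x - f c) - ?D (c, y) * complex_of_real (x - c))"
    by (metis norm_mult norm_of_real)
  also have "\<dots> \<le> cmod (f x - f c) + cmod (?D (c, y)) * \<bar>x - c\<bar>"
    by (rule order_trans[OF norm_triangle_ineq4]) (simp add: norm_mult del: of_real_diff)
  also have "\<dots> \<le> L * \<bar>x - c\<bar> + L * \<bar>x - c\<bar>"
    by (intro add_mono L mult_right_mono norm_divided_difference_le[of f, OF L]) simp
  finally show ?thesis using ne by (simp add: field_simps)
qed

text \<open>Telescoping against \<open>\<psi> t = d / (d + t)\<close>.\<close>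

lemma sum_separated_intervals_le:
  fixes l r :: "int \<Rightarrow> real"
  assumes "finite K" "0 < d" "\<And>k. k \<in> K \<Longrightarrow> 0 \<le> l k" "\<And>k. k \<in> K \<Longrightarrow> d \<le> r k - l k"
    "\<And>k k'. k \<in> K \<Longrightarrow> k' \<in> K \<Longrightarrow> k < k' \<Longrightarrow> r k \<le> l k'"
  shows "(\<Sum>k\<in>K. (d / (d + l k))\<^sup>2) \<le> 2"
proof -
  define \<psi> where "\<psi> t = d / (d + t)" for t
  have mono: "\<psi> t \<le> \<psi> s" if "0 \<le> s" "s \<le> t" for s t
    using that assms(2) by (simp add: \<psi>_def frac_le)
  have step: "(d / (d + s))\<^sup>2 \<le> 2 * (\<psi> s - \<psi> t)" if "0 \<le> s" "d \<le> t - s" for s t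
  proof -

    have "(d / (d + s))\<^sup>2 / 2 = d\<^sup>2 / ((d + s) * (2 * (d + s)))"
      by (simp add: power2_eq_square)
    also have "\<dots> \<le> d\<^sup>2 / ((d + s) * (2 * d + s))"
      using that assms(2) by (intro divide_left_mono mult_left_mono mult_pos_pos) auto
    also have "\<dots> = \<psi> s - \<psi> (s + d)"
      using that assms(2) by (simp add: \<psi>_def field_simps power2_eq_square)
    also have "\<dots> \<le> \<psi> s - \<psi> t" using that assms(2) by (simp add: mono)
    finally show ?thesis by simp
  qed
  have "(\<Sum>k\<in>K. (d / (d + l k))\<^sup>2) \<le> 2 * (1 - \<psi> b)" if "0 \<le> b" "\<And>k. k \<in> K \<Longrightarrow> r k \<le> b" for b
    using assms(1,3,4,5) that
  \<comment> \<open>The last interval is split off: those before it end no later than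
    \<open>l m\<close>, which becomes the new \<open>b\<close>.\<close>
  proof (induction K arbitrary: b rule: finite_linorder_max_induct)
    case empty
    then show ?case using mono[of 0 b] assms(2) by (simp add: \<psi>_def divide_le_eq)
  next
    case (insert m A)
    have "(\<Sum>k\<in>A. (d / (d + l k))\<^sup>2) \<le> 2 * (1 - \<psi> (l m))"
      using insert.prems insert.hyps by (intro insert.IH) auto
    moreover have "(d / (d + l m))\<^sup>2 \<le> 2 * (\<psi> (l m) - \<psi> (r m))"
      using insert.prems by (intro step) auto
    moreover have "\<psi> b \<le> \<psi> (r m)"
      using insert.prems(1)[of m] insert.prems(2)[of m] insert.prems(5)[of m] assms(2) by (intro mono) auto
    moreover have "m \<notin> A" using insert.hyps(2) by auto
    ultimately show ?case using insert.hyps(1) by simp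
  qed
  note * = this
  define b where "b = Max (insert 0 (r ` K))"
  have "0 \<le> b" "\<And>k. k \<in> K \<Longrightarrow> r k \<le> b" using assms(1) by (auto simp: b_def)
  from *[OF this] show ?thesis
    using \<open>0 \<le> b\<close> assms(2) by (simp add: \<psi>_def) (smt (verit) divide_nonneg_nonneg)
qed

text \<open>A group with at least two points has mass less than \<open>1 / N\<close>, because the integer parts of
  \<open>N\<close> times the cumulative masses coincide on it; a single point may have an arbitrary mass.\<close>

lemma monotone_grouping:
  fixes w :: "real \<Rightarrow> real"
  assumes \<Lambda>: "finite \<Lambda>" and w: "\<And>x. x \<in> \<Lambda> \<Longrightarrow> 0 \<le> w x" and W: "(\<Sum>x\<in>\<Lambda>. w x) \<le> W" and N: "0 < N"
  obtains g :: "real \<Rightarrow> int" where "\<And>x y. x \<le> y \<Longrightarrow> g x \<le> g y"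
    "real (card (g ` \<Lambda>)) \<le> 2 * real N * W + 1"
    "\<And>x y. x \<in> \<Lambda> \<Longrightarrow> y \<in> \<Lambda> \<Longrightarrow> x < y \<Longrightarrow> g x = g y \<Longrightarrow> (\<Sum>z\<in>{z\<in>\<Lambda>. g z = g x}. w z) \<le> 1 / N"
proof -
  define S where "S x = (\<Sum>z\<in>{z\<in>\<Lambda>. z \<le> x}. w z)" for x
  define S' where "S' x = (\<Sum>z\<in>{z\<in>\<Lambda>. z < x}. w z)" for x
  \<comment> \<open>Two cumulative sums are used because \<open>S\<close> already jumps at a heavy
    point and \<open>S'\<close> only after it. Equality of \<open>g\<close> at \<open>a < b\<close>
    forces the floors at \<open>S' a \<le> S a \<le> S' b \<le> S b\<close> to coincide, so a point
    of mass at least \<open>1 / N\<close> is alone in its group.\<close>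
  define g where "g x = \<lfloor>N * S' x\<rfloor> + \<lfloor>N * S x\<rfloor>" for x
  have sub: "sum w A \<le> sum w B" if "A \<subseteq> B" "B \<subseteq> \<Lambda>" for A B
    using that \<Lambda> w by (intro sum_mono2) (auto intro: finite_subset)
  have fl: "\<lfloor>N * a\<rfloor> \<le> \<lfloor>N * b\<rfloor>" if "a \<le> b" for a b :: real
    using that by (intro floor_mono mult_left_mono) auto
  have S_mono: "S x \<le> S y" "S' x \<le> S' y" if "x \<le> y" for x y
    using that unfolding S_def S'_def by (auto intro!: sub)
  have S'S: "S' x \<le> S x" for x unfolding S_def S'_def by (rule sub) auto
  have SS': "S x \<le> S' y" if "x < y" for x y using that unfolding S_def S'_def by (intro sub) auto
  have bounds: "0 \<le> S' x" "S x \<le> W" for x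
    using sum_nonneg[of "{z\<in>\<Lambda>. z < x}" w] sub[of "{z\<in>\<Lambda>. z \<le> x}" \<Lambda>] W w
    by (auto simp: S_def S'_def)
  have 1: "g x \<le> g y" if "x \<le> y" for x y
    unfolding g_def by (intro add_mono fl S_mono that)
  have "g ` \<Lambda> \<subseteq> {0..\<lfloor>2 * real N * W\<rfloor>}"
  proof (rule image_subsetI)
    fix x
    have nn: "0 \<le> \<lfloor>N * S' x\<rfloor>" using bounds(1) by simp
    have "real_of_int (g x) \<le> N * S' x + N * S x" by (simp add: g_def) linarith
    also have "\<dots> \<le> N * W + N * W" using bounds(2)[of x] S'S[of x]
      by (intro add_mono mult_left_mono) auto
    finally have "real_of_int (g x) \<le> 2 * real N * W" by linarith
    then have "g x \<le> \<lfloor>2 * real N * W\<rfloor>" by (simp only: le_floor_iff)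
    moreover have "0 \<le> g x" using nn fl[OF S'S[of x]] unfolding g_def by linarith
    ultimately show "g x \<in> {0..\<lfloor>2 * real N * W\<rfloor>}" by simp
  qed
  then have "card (g ` \<Lambda>) \<le> card {0..\<lfloor>2 * real N * W\<rfloor>}" by (intro card_mono) auto
  then have "real (card (g ` \<Lambda>)) \<le> real (nat (\<lfloor>2 * real N * W\<rfloor> + 1))" by simp
  also have "\<dots> \<le> 2 * real N * W + 1"
  proof -
    have "0 \<le> W" using order_trans[OF bounds(1) order_trans[OF S'S bounds(2)]] .
    then have "0 \<le> 2 * real N * W" by simp
    then show ?thesis by linarith
  qed
  finally have 2: "real (card (g ` \<Lambda>)) \<le> 2 * real N * W + 1" .
  have 3: "(\<Sum>z\<in>{z\<in>\<Lambda>. g z = g x}. w z) \<le> 1 / N"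
    if xy: "x \<in> \<Lambda>" "y \<in> \<Lambda>" "x < y" "g x = g y" for x y
  proof -
    define G where "G = {z\<in>\<Lambda>. g z = g x}"
    have G: "finite G" "x \<in> G" "y \<in> G" using \<Lambda> xy by (auto simp: G_def)
    define a b where "a = Min G" and "b = Max G"
    have ab: "a \<in> G" "b \<in> G" "\<And>z. z \<in> G \<Longrightarrow> a \<le> z \<and> z \<le> b"
    proof -
      have "G \<noteq> {}" using G by blast
      then show "a \<in> G" "b \<in> G" using G(1) by (simp_all add: a_def b_def)
    qed (use G(1) in \<open>auto simp: a_def b_def\<close>)
    have "a < b" using ab(3)[OF G(2)] ab(3)[OF G(3)] xy(3) by linarith
    have "g a = g b" using ab(1,2) by (auto simp: G_def)
    then have eq: "\<lfloor>N * S b\<rfloor> = \<lfloor>N * S' a\<rfloor>"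
      using fl[OF S'S[of a]] fl[OF SS'[OF \<open>a < b\<close>]] fl[OF S'S[of b]]
      unfolding g_def by linarith
    have "S b - S' a = sum w ({z\<in>\<Lambda>. z \<le> b} - {z\<in>\<Lambda>. z < a})"
      using \<open>a < b\<close> \<Lambda> by (subst sum_diff) (auto simp: S_def S'_def)
    moreover have "G \<subseteq> {z\<in>\<Lambda>. z \<le> b} - {z\<in>\<Lambda>. z < a}"
      using ab(3) by (force simp: G_def)
    then have "sum w G \<le> sum w ({z\<in>\<Lambda>. z \<le> b} - {z\<in>\<Lambda>. z < a})" by (rule sub) auto
    ultimately have "sum w G \<le> S b - S' a" by simp
    moreover have "N * S b - N * S' a < 1" using eq by linarith
    then have "(S b - S' a) * N < 1" by (simp add: algebra_simps)
    then have "S b - S' a < 1 / N" using N by (simp add: field_simps)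
    ultimately show ?thesis by (simp add: G_def)
  qed
  show thesis by (rule that[OF 1 2 3])
qed


text \<open>The summands majorize squared relative errors against all groups at least as long as
  group \<open>m\<close>. To the right of \<open>m\<close>, and after reflecting the indices also to
  its left, these are separated intervals of length at least \<open>d\<close>, so each side
  contributes at most \<open>4 * 2\<close>; \<open>m\<close> itself contributes 1.\<close>

lemma sum_gains_le:
  fixes l r :: "int \<Rightarrow> real"
  assumes K: "finite K" and lr: "\<And>k. k \<in> K \<Longrightarrow> l k \<le> r k"
    and sep: "\<And>k k'. k \<in> K \<Longrightarrow> k' \<in> K \<Longrightarrow> k < k' \<Longrightarrow> r k \<le> l k'"
    and m: "m \<in> K" and d: "d = r m - l m" "0 < d"
  shows "(\<Sum>k\<in>{k\<in>K. d \<le> r k - l k}.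
    if k = m then 1 else 4 * (d / (d + (if m < k then l k - r m else l m - r k)))\<^sup>2) \<le> 17"
proof -
  define q where "q k = (if k = m then 1 else 4 * (d / (d + (if m < k then l k - r m else l m - r k)))\<^sup>2)" for k
  define A B where "A = {k\<in>K. d \<le> r k - l k \<and> m < k}" and "B = {k\<in>K. d \<le> r k - l k \<and> k < m}"
  have fin: "finite A" "finite B" using K by (auto simp: A_def B_def)
  have "(\<Sum>k\<in>A. (d / (d + (l k - r m)))\<^sup>2) \<le> 2"
    by (rule sum_separated_intervals_le[of A d "\<lambda>k. l k - r m" "\<lambda>k. r k - r m"])
      (use fin d sep m in \<open>auto simp: A_def\<close>)
  then have "sum q A \<le> 8" by (simp add: q_def A_def sum_distrib_left[symmetric])
  have "(\<Sum>k\<in>uminus ` B. (d / (d + (l m - r (- k))))\<^sup>2) \<le> 2"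
    by (rule sum_separated_intervals_le[of _ d "\<lambda>k. l m - r (- k)" "\<lambda>k. l m - l (- k)"])
      (use fin d sep m in \<open>auto simp: B_def\<close>)
  then have "(\<Sum>k\<in>B. (d / (d + (l m - r k)))\<^sup>2) \<le> 2" by (simp add: sum.reindex)
  then have "sum q B \<le> 8" by (simp add: q_def B_def sum_distrib_left[symmetric])
  have "{k\<in>K. d \<le> r k - l k} = insert m (A \<union> B)" using m d(1) by (auto simp: A_def B_def)
  moreover have "sum q (insert m (A \<union> B)) = 1 + (sum q A + sum q B)"
    using fin by (subst sum.insert, simp, simp add: A_def B_def)
      (subst sum.union_disjoint, auto simp: A_def B_def q_def)
  ultimately show ?thesis using \<open>sum q A \<le> 8\<close> \<open>sum q B \<le> 8\<close> by (simp add: q_def)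
qed


text \<open>Group the points so that all groups of positive length \<open>h\<close> have small mass, and freeze the
  variable lying in the shorter of the two groups at the left end of its group.\<close>

lemma divided_difference_approx:
  fixes f :: "real \<Rightarrow> complex" and v w :: "real \<Rightarrow> real" and Y :: "real \<Rightarrow> 'a::chilbert_space"
  assumes L: "\<And>x y. cmod (f x - f y) \<le> L * \<bar>x - y\<bar>" and \<Lambda>: "finite \<Lambda>"
    and v: "\<And>x. x \<in> \<Lambda> \<Longrightarrow> 0 \<le> v x" "sum v \<Lambda> \<le> 1" and w: "\<And>x. x \<in> \<Lambda> \<Longrightarrow> 0 \<le> w x" "sum w \<Lambda> \<le> 1"
    and N: "0 < N"
  obtains F B where
    "(\<Sum>x\<in>\<Lambda>. \<Sum>y\<in>\<Lambda>. (cmod (divided_difference f (x, y) - F x y))\<^sup>2 * v x * w y) \<le> 680 * L\<^sup>2 / N"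
    "finite B" "card B \<le> 10 * N" "\<And>y. y \<in> \<Lambda> \<Longrightarrow> (\<Sum>x\<in>\<Lambda>. scaleC (cnj (F x y)) (Y x)) \<in> cspan B"
proof -
  let ?D = "divided_difference f"
  have vw: "0 \<le> v x + w x" if "x \<in> \<Lambda>" for x using v(1) w(1) that by simp
  have tot: "(\<Sum>x\<in>\<Lambda>. v x + w x) \<le> 2" using v(2) w(2) by (simp add: sum.distrib)
  obtain g :: "real \<Rightarrow> int" where g: "\<And>x y. x \<le> y \<Longrightarrow> g x \<le> g y"
    "real (card (g ` \<Lambda>)) \<le> 2 * real N * 2 + 1"
    "\<And>x y. x \<in> \<Lambda> \<Longrightarrow> y \<in> \<Lambda> \<Longrightarrow> x < y \<Longrightarrow> g x = g y \<Longrightarrow> (\<Sum>z\<in>{z\<in>\<Lambda>. g z = g x}. v z + w z) \<le> 1 / N"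
    by (rule monotone_grouping[OF \<Lambda> vw tot N]) (simp, erule that, assumption, blast)
  define K where "K = g ` \<Lambda>"
  have K: "finite K" using \<Lambda> by (simp add: K_def)
  \<comment> \<open>The two weights together have mass at most 2, which allows at most
    \<open>4 * N + 1\<close> groups.\<close>
  have cK: "card K \<le> 5 * N"
    using g(2) N unfolding K_def by linarith
  define G where "G k = {z\<in>\<Lambda>. g z = k}" for k
  define l r where "l k = Min (G k)" and "r k = Max (G k)" for k
  define h where "h k = r k - l k" for k
  have G: "finite (G k)" for k using \<Lambda> by (simp add: G_def)
  have lG: "l k \<in> G k" and rG: "r k \<in> G k" if "k \<in> K" for k
  proof -
    have "G k \<noteq> {}" using that by (auto simp: K_def G_def)
    then show "l k \<in> G k" "r k \<in> G k" using G[of k] by (simp_all add: l_def r_def)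
  qed
  have between: "l (g x) \<le> x" "x \<le> r (g x)" if "x \<in> \<Lambda>" for x
    using that G[of "g x"] by (auto simp: l_def r_def G_def)
  have gK: "g x \<in> K" if "x \<in> \<Lambda>" for x using that by (simp add: K_def)
  have lr: "l k \<le> r k" if "k \<in> K" for k
    using lG[OF that] rG[OF that] between(1)[of "r k"] by (simp add: G_def)
  have sep: "r k < l k'" if "k \<in> K" "k' \<in> K" "k < k'" for k k'
    using rG[OF that(1)] lG[OF that(2)] that(3) g(1)[of "l k'" "r k"] by (force simp: G_def)
  define F where "F x y = (if h (g x) \<le> h (g y) then ?D (l (g x), y) else ?D (x, l (g y)))" for x y
  \<comment> \<open>In units of \<open>4 * L\<^sup>2\<close>, \<open>q k m\<close> majorizes the
    squared error of freezing the variable in group \<open>m\<close> while the other one lies in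
    group \<open>k\<close>. The quotient of \<open>h m\<close> by \<open>h m\<close> plus the gap
    serves both regimes: near groups, where only the trivial bound \<open>2 * L\<close> is
    available, and remote ones, where the error is of the order of length over gap.\<close>
  define q where "q k m = (if k = m then 1 else 4 * (h m / (h m + (if m < k then l k - r m else l m - r k)))\<^sup>2)" for k m
  \<comment> \<open>A group of length 0 is a single point and freezing does not move it, so it
    produces no error. This disposes of the heavy points.\<close>
  define Q where "Q k m = (if h m \<le> h k \<and> 0 < h m then q k m else 0)" for k m
  have q0: "0 \<le> q k m" for k m by (simp add: q_def)
  have L0: "0 \<le> L" using order_trans[OF norm_ge_zero L[of 1 0]] by simp
  have D_le: "cmod (?D p) \<le> L" for p
    using norm_divided_difference_le[of f, OF L] by (cases p) auto
  have err: "(cmod (?D (x, y) - ?D (l (g x), y)))\<^sup>2 \<le> 4 * L\<^sup>2 * Q (g y) (g x)"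
    if xy: "x \<in> \<Lambda>" "y \<in> \<Lambda>" "h (g x) \<le> h (g y)" for x y
  proof (cases "0 < h (g x)")
    case False
    then have "h (g x) = 0" using lr[OF gK[OF xy(1)]] by (simp add: h_def)
    then have "l (g x) = x" using between[OF xy(1)] by (simp add: h_def)
    then show ?thesis using L0 by (simp add: Q_def q0)
  next
    case pos: True
    let ?c = "l (g x)"
    have triv: "cmod (?D (x, y) - ?D (?c, y)) \<le> 2 * L"
      using order_trans[OF norm_triangle_ineq4 add_mono[OF D_le D_le]] by simp
    show ?thesis
    proof (cases "g x = g y")
      case True
      have "(cmod (?D (x, y) - ?D (?c, y)))\<^sup>2 \<le> (2 * L)\<^sup>2" using triv by (intro power_mono) auto
      then show ?thesis using True pos by (simp add: Q_def q_def power_mult_distrib)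
    next
      case False
      define d where "d = (if g x < g y then l (g y) - r (g x) else l (g x) - r (g y))"
      have d: "0 < d" "d \<le> \<bar>x - y\<bar>"
        using sep[OF gK gK] xy(1,2) False between[OF xy(1)] between[OF xy(2)]
        by (fastforce simp: d_def abs_if)+
      have c: "?c \<in> \<Lambda>" "g ?c = g x" using lG[OF gK[OF xy(1)]] by (auto simp: G_def)
      have ne: "x \<noteq> y" "?c \<noteq> y" using False c(2) by auto
      have xc: "\<bar>x - ?c\<bar> \<le> h (g x)" using between[OF xy(1)] by (simp add: h_def)
      have "cmod (?D (x, y) - ?D (?c, y)) \<le> 2 * L * (2 * h (g x) / (h (g x) + d))"
      proof (cases "d \<le> h (g x)")
        case True
        then have "1 \<le> 2 * h (g x) / (h (g x) + d)" using pos d(1) by (simp add: field_simps)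
        then have "2 * L * 1 \<le> 2 * L * (2 * h (g x) / (h (g x) + d))"
          using L0 by (intro mult_left_mono) auto
        then show ?thesis using triv by linarith
      next
        case False
        have "\<bar>x - ?c\<bar> / \<bar>x - y\<bar> \<le> h (g x) / d" using xc d by (intro frac_le) auto
        also have "\<dots> \<le> 2 * h (g x) / (h (g x) + d)"
          using False pos d(1) by (simp add: field_simps)
        finally have "2 * L * (\<bar>x - ?c\<bar> / \<bar>x - y\<bar>) \<le> 2 * L * (2 * h (g x) / (h (g x) + d))"
          using L0 by (intro mult_left_mono) auto
        then show ?thesis using divided_difference_error[of f, OF L ne] by linarith
      qed
      then have "(cmod (?D (x, y) - ?D (?c, y)))\<^sup>2 \<le> (2 * L * (2 * h (g x) / (h (g x) + d)))\<^sup>2"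
        by (intro power_mono) auto
      also have "\<dots> = 4 * L\<^sup>2 * q (g y) (g x)"
        using False by (simp add: q_def d_def power_mult_distrib power_divide)
      finally show ?thesis using pos xy(3) by (simp add: Q_def)
    qed
  qed
  have F_err: "(cmod (?D (x, y) - F x y))\<^sup>2 \<le> 4 * L\<^sup>2 * (Q (g y) (g x) + Q (g x) (g y))"
    if xy: "x \<in> \<Lambda>" "y \<in> \<Lambda>" for x y
  proof -
    have Q0: "0 \<le> Q k m" for k m by (simp add: Q_def q0)
    show ?thesis
    proof (cases "h (g x) \<le> h (g y)")
      case True
      have "(cmod (?D (x, y) - F x y))\<^sup>2 \<le> 4 * L\<^sup>2 * Q (g y) (g x)"
        using err[OF xy True] True by (simp add: F_def)
      also have "\<dots> \<le> 4 * L\<^sup>2 * (Q (g y) (g x) + Q (g x) (g y))"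
        using Q0 by (intro mult_left_mono) auto
      finally show ?thesis .
    next
      case False
      have "(cmod (?D (x, y) - F x y))\<^sup>2 = (cmod (?D (y, x) - ?D (l (g y), x)))\<^sup>2"
        using False by (simp add: F_def divided_difference_commute[of f x])
      also have "\<dots> \<le> 4 * L\<^sup>2 * Q (g x) (g y)"
        using False by (intro err xy) auto
      also have "\<dots> \<le> 4 * L\<^sup>2 * (Q (g y) (g x) + Q (g x) (g y))"
        using Q0 by (intro mult_left_mono) auto
      finally show ?thesis .
    qed
  qed
  have mass: "sum v (G k) \<le> 1 / N \<and> sum w (G k) \<le> 1 / N" if k: "k \<in> K" "0 < h k" for k
  proof -
    have "sum (\<lambda>z. v z + w z) (G k) \<le> 1 / N"
      using g(3)[of "l k" "r k"] lG[OF k(1)] rG[OF k(1)] k(2) by (simp add: G_def h_def)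
    moreover have "0 \<le> sum v (G k)" "0 \<le> sum w (G k)"
      using v(1) w(1) by (auto simp: G_def intro!: sum_nonneg)
    ultimately show ?thesis by (simp add: sum.distrib)
  qed
  have Q_sum: "(\<Sum>m\<in>K. \<Sum>k\<in>K. Q k m) \<le> real (card K) * 17"
  proof (rule sum_bounded_above)
    fix m assume m: "m \<in> K"
    show "(\<Sum>k\<in>K. Q k m) \<le> 17"
    proof (cases "0 < h m")
      case True
      have "(\<Sum>k\<in>K. Q k m) = (\<Sum>k\<in>{k\<in>K. h m \<le> r k - l k}. q k m)"
        using K True by (intro sum.mono_neutral_cong_right) (auto simp: Q_def h_def)
      also have "\<dots> \<le> 17"
        unfolding q_def using K lr sep m True
        by (intro sum_gains_le) (auto simp: h_def less_imp_le)
      finally show ?thesis .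
    qed (simp add: Q_def)
  qed
  \<comment> \<open>Two arbitrary weights are allowed because the part in which the second variable
    is frozen is the same sum with \<open>v\<close> and \<open>w\<close> exchanged.\<close>
  have group: "(\<Sum>x\<in>\<Lambda>. \<Sum>y\<in>\<Lambda>. Q (g y) (g x) * a x * b y) \<le> (1 / N)\<^sup>2 * (\<Sum>m\<in>K. \<Sum>k\<in>K. Q k m)"
    if a: "\<And>x. x \<in> \<Lambda> \<Longrightarrow> 0 \<le> a x" "\<And>k. k \<in> K \<Longrightarrow> 0 < h k \<Longrightarrow> sum a (G k) \<le> 1 / N"
      and b: "\<And>x. x \<in> \<Lambda> \<Longrightarrow> 0 \<le> b x" "\<And>k. k \<in> K \<Longrightarrow> 0 < h k \<Longrightarrow> sum b (G k) \<le> 1 / N"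
    for a b :: "real \<Rightarrow> real"
  proof -
    have gsum: "(\<Sum>x\<in>\<Lambda>. c x) = (\<Sum>k\<in>K. \<Sum>x\<in>G k. c x)" for c :: "real \<Rightarrow> real"
      unfolding K_def G_def using sum.image_gen[OF \<Lambda>, of c g] .
    have "(\<Sum>x\<in>\<Lambda>. \<Sum>y\<in>\<Lambda>. Q (g y) (g x) * a x * b y)
        = (\<Sum>m\<in>K. \<Sum>x\<in>G m. \<Sum>k\<in>K. \<Sum>y\<in>G k. Q k m * a x * b y)"
      unfolding gsum by (intro sum.cong refl) (auto simp: G_def)
    also have "\<dots> = (\<Sum>m\<in>K. \<Sum>k\<in>K. \<Sum>x\<in>G m. \<Sum>y\<in>G k. Q k m * a x * b y)"
      by (intro sum.cong refl sum.swap)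
    also have "\<dots> = (\<Sum>m\<in>K. \<Sum>k\<in>K. Q k m * (sum a (G m) * sum b (G k)))"
      by (simp only: sum_product, simp only: sum_distrib_left mult.assoc)
    also have "\<dots> \<le> (\<Sum>m\<in>K. \<Sum>k\<in>K. Q k m * (1 / N)\<^sup>2)"
    proof (intro sum_mono)
      fix m k assume mk: "m \<in> K" "k \<in> K"
      show "Q k m * (sum a (G m) * sum b (G k)) \<le> Q k m * (1 / N)\<^sup>2"
      proof (cases "h m \<le> h k \<and> 0 < h m")
        case True
        have "sum a (G m) * sum b (G k) \<le> (1 / N) * (1 / N)"
          using a b mk True by (intro mult_mono) (auto simp: G_def intro!: sum_nonneg)
        then show ?thesis by (intro mult_left_mono) (auto simp: Q_def q0 power2_eq_square)
      qed (auto simp: Q_def)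
    qed
    finally show ?thesis by (simp add: sum_distrib_left sum_distrib_right mult.commute)
  qed
  have "(\<Sum>x\<in>\<Lambda>. \<Sum>y\<in>\<Lambda>. (cmod (?D (x, y) - F x y))\<^sup>2 * v x * w y)
      \<le> (\<Sum>x\<in>\<Lambda>. \<Sum>y\<in>\<Lambda>. 4 * L\<^sup>2 * (Q (g y) (g x) + Q (g x) (g y)) * v x * w y)"
    by (intro sum_mono mult_right_mono F_err v w)
  also have "\<dots> = 4 * L\<^sup>2 * ((\<Sum>x\<in>\<Lambda>. \<Sum>y\<in>\<Lambda>. Q (g y) (g x) * v x * w y)
      + (\<Sum>x\<in>\<Lambda>. \<Sum>y\<in>\<Lambda>. Q (g x) (g y) * v x * w y))"
    by (simp add: sum_distrib_left sum.distrib[symmetric] algebra_simps)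
  also have "(\<Sum>x\<in>\<Lambda>. \<Sum>y\<in>\<Lambda>. Q (g x) (g y) * v x * w y) = (\<Sum>x\<in>\<Lambda>. \<Sum>y\<in>\<Lambda>. Q (g y) (g x) * w x * v y)"
    by (subst sum.swap) (simp add: mult.commute mult.left_commute)
  also have "4 * L\<^sup>2 * ((\<Sum>x\<in>\<Lambda>. \<Sum>y\<in>\<Lambda>. Q (g y) (g x) * v x * w y)
      + (\<Sum>x\<in>\<Lambda>. \<Sum>y\<in>\<Lambda>. Q (g y) (g x) * w x * v y))
      \<le> 4 * L\<^sup>2 * ((1 / N)\<^sup>2 * (real (card K) * 17) + (1 / N)\<^sup>2 * (real (card K) * 17))"
    using v(1) w(1) mass
    by (intro mult_left_mono add_mono order_trans[OF group] Q_sum) auto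
  also have "\<dots> \<le> 4 * L\<^sup>2 * ((1 / N)\<^sup>2 * (5 * N * 17) + (1 / N)\<^sup>2 * (5 * N * 17))"
  proof -
    have "real (card K) \<le> real (5 * N)" using cK by (rule of_nat_mono)
    then show ?thesis by (intro mult_left_mono add_mono mult_right_mono) auto
  qed
  also have "\<dots> = 680 * L\<^sup>2 / N" using N by (simp add: field_simps power2_eq_square)
  finally have 1: "(\<Sum>x\<in>\<Lambda>. \<Sum>y\<in>\<Lambda>. (cmod (?D (x, y) - F x y))\<^sup>2 * v x * w y) \<le> 680 * L\<^sup>2 / N" .
  \<comment> \<open>Where \<open>x\<close> is frozen, its coefficient depends on \<open>x\<close>
    through the group only, so the group sums \<open>b1\<close> suffice. Where \<open>y\<close> is
    frozen, the whole vector depends on \<open>y\<close> through the group only, and it is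
    \<open>b2\<close>. Each group thus adds at most two dimensions.\<close>
  define b1 b2 where "b1 k = (\<Sum>x\<in>G k. Y x)"
    and "b2 k = (\<Sum>x\<in>{x\<in>\<Lambda>. h k < h (g x)}. scaleC (cnj (?D (x, l k))) (Y x))" for k
  have 2: "finite (b1 ` K \<union> b2 ` K)" using K by simp
  have "card (b1 ` K \<union> b2 ` K) \<le> card K + card K"
    by (rule order_trans[OF card_Un_le add_mono]) (intro card_image_le K)+
  then have 3: "card (b1 ` K \<union> b2 ` K) \<le> 10 * N" using cK by linarith
  have 4: "(\<Sum>x\<in>\<Lambda>. scaleC (cnj (F x y)) (Y x)) \<in> cspan (b1 ` K \<union> b2 ` K)" if y: "y \<in> \<Lambda>" for y
  proof -
    have "(\<Sum>x\<in>\<Lambda>. scaleC (cnj (F x y)) (Y x))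
        = (\<Sum>x\<in>{x\<in>\<Lambda>. h (g x) \<le> h (g y)}. scaleC (cnj (F x y)) (Y x))
          + (\<Sum>x\<in>{x\<in>\<Lambda>. h (g y) < h (g x)}. scaleC (cnj (F x y)) (Y x))"
      using \<Lambda> by (subst sum.union_disjoint[symmetric]) (auto intro!: sum.cong)
    also have "(\<Sum>x\<in>{x\<in>\<Lambda>. h (g y) < h (g x)}. scaleC (cnj (F x y)) (Y x)) = b2 (g y)"
      unfolding b2_def by (intro sum.cong refl) (auto simp: F_def)
    also have "(\<Sum>x\<in>{x\<in>\<Lambda>. h (g x) \<le> h (g y)}. scaleC (cnj (F x y)) (Y x))
        = (\<Sum>x\<in>\<Lambda>. if h (g x) \<le> h (g y) then scaleC (cnj (F x y)) (Y x) else 0)"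
      using \<Lambda> by (simp add: sum.inter_filter)
    also have "\<dots> = (\<Sum>k\<in>K. \<Sum>x\<in>G k. if h (g x) \<le> h (g y) then scaleC (cnj (F x y)) (Y x) else 0)"
      unfolding K_def G_def by (rule sum.image_gen[OF \<Lambda>])
    also have "\<dots> = (\<Sum>k\<in>K. scaleC (if h k \<le> h (g y) then cnj (?D (l k, y)) else 0) (b1 k))"
      unfolding b1_def complex_vector.scale_sum_right
      by (intro sum.cong refl) (auto simp: G_def F_def)
    finally have eq: "(\<Sum>x\<in>\<Lambda>. scaleC (cnj (F x y)) (Y x))
      = (\<Sum>k\<in>K. scaleC (if h k \<le> h (g y) then cnj (?D (l k, y)) else 0) (b1 k)) + b2 (g y)" .
    show ?thesis unfolding eq
    proof (rule complex_vector.span_add[OF complex_vector.span_sum complex_vector.span_base])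
      show "scaleC c (b1 k) \<in> cspan (b1 ` K \<union> b2 ` K)" if "k \<in> K" for c k
        by (rule complex_vector.span_scale[OF complex_vector.span_base]) (use that in simp)
    qed (use gK[OF y] in simp)
  qed
  show thesis by (rule that[OF 1 2 3 4])
qed

section \<open>The main inequality for discrete spectral measures\<close>

lemma lip_norm_bound:
  assumes "\<exists>L. L-lipschitz_on UNIV f"
  shows "cmod (f x - f y) \<le> lip_norm f * \<bar>x - y\<bar>"
proof (cases "x = y")
  case False
  obtain L where L: "L-lipschitz_on UNIV f" using assms by blast
  have le: "cmod (f x - f y) \<le> L * \<bar>x - y\<bar>" for x y
    using lipschitz_onD[OF L, of x y] by (simp add: dist_norm)
  have bdd: "bdd_above ((\<lambda>(x, y). cmod (f x - f y) / \<bar>x - y\<bar>) ` {(x, y). x \<noteq> y})"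
    by (rule bdd_aboveI[of _ L]) (use le in \<open>auto simp: divide_le_eq\<close>)
  have "(case (x, y) of (x, y) \<Rightarrow> cmod (f x - f y) / \<bar>x - y\<bar>) \<le> lip_norm f"
    unfolding lip_norm_def by (rule cSUP_upper[OF _ bdd]) (use False in simp)
  then show ?thesis using False by (simp add: divide_le_eq)
qed simp

lemma lip_norm_nonneg: "\<exists>L. L-lipschitz_on UNIV f \<Longrightarrow> 0 \<le> lip_norm f"
  using order_trans[OF norm_ge_zero lip_norm_bound[of f 1 0]] by simp

text \<open>The inequality for finitely supported spectral measures, as a sesquilinear form:
  \<open>x\<close> and \<open>y\<close> are the pieces of two vectors indexed by the points of the
  spectrum. The \<open>itself\<close> argument names the Hilbert space, so that one constant can be
  compared across types.\<close>

definition discrete_doi_bound :: "'h::chilbert_space itself \<Rightarrow> real \<Rightarrow> bool"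
  where "discrete_doi_bound _ C \<longleftrightarrow> (\<forall>f \<Lambda> (x :: real \<Rightarrow> 'h) y T.
    (\<exists>L. L-lipschitz_on UNIV f) \<longrightarrow> finite \<Lambda> \<longrightarrow> ortho_family x \<Lambda> \<longrightarrow> ortho_family y \<Lambda> \<longrightarrow>
    T \<in> matsaev_ideal \<longrightarrow>
    cmod (\<Sum>i\<in>\<Lambda>. \<Sum>j\<in>\<Lambda>. divided_difference f (i, j) * cinner (T (x j)) (y i))
      \<le> C * lip_norm f * matsaev_norm T
        * (sqrt (\<Sum>i\<in>\<Lambda>. (norm (x i))\<^sup>2) * sqrt (\<Sum>i\<in>\<Lambda>. (norm (y i))\<^sup>2)))"

lemma norm_telescope_le:
  fixes b :: "nat \<Rightarrow> 'a::real_normed_vector"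
  shows "norm (b 0) \<le> norm (b n) + (\<Sum>l<n. norm (b l - b (Suc l)))"
proof (induction n)
  case (Suc n)
  have "norm (b n) \<le> norm (b (Suc n)) + norm (b n - b (Suc n))"
    using norm_triangle_ineq[of "b (Suc n)" "b n - b (Suc n)"] by simp
  then show ?case using Suc.IH by simp
qed simp

text \<open>The ranks of the approximants of \<open>T\<close> and of the kernel grow at the same geometric rate, which
  makes each difference of consecutive remainders \<open>b l\<close> comparable to a single singular value
  \<open>s\<^sub>j(T)\<close> with \<open>j = 2 ^ l\<close>.\<close>

lemma discrete_doi_bound_normalized:
  fixes x y :: "real \<Rightarrow> 'h::chilbert_space"
  assumes L: "\<And>s t. cmod (f s - f t) \<le> L * \<bar>s - t\<bar>" and \<Lambda>: "finite \<Lambda>"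
    and x: "ortho_family x \<Lambda>" "(\<Sum>i\<in>\<Lambda>. (norm (x i))\<^sup>2) \<le> 1"
    and y: "ortho_family y \<Lambda>" "(\<Sum>i\<in>\<Lambda>. (norm (y i))\<^sup>2) \<le> 1"
    and T: "T \<in> matsaev_ideal"
  shows "cmod (\<Sum>i\<in>\<Lambda>. \<Sum>j\<in>\<Lambda>. divided_difference f (i, j) * cinner (T (x j)) (y i))
    \<le> 2400 * L * matsaev_norm T"
proof -
  let ?D = "divided_difference f"
  define M where "M = matsaev_norm T"
  note bc = matsaev_idealD(1)[OF T]
  have L0: "0 \<le> L" using order_trans[OF norm_ge_zero L[of 1 0]] by simp
  define \<xi> where "\<xi> j = scaleC (complex_of_real (inverse (norm (x j)))) (x j)" for j
  have \<xi>: "ortho_family \<xi> \<Lambda>" unfolding \<xi>_def by (rule ortho_family_scaleC[OF x(1)])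
  have \<xi>1: "norm (\<xi> j) \<le> 1" for j
    by (cases "x j = 0") (simp_all add: \<xi>_def norm_scaleC norm_inverse)
  have x\<xi>: "x j = scaleC (complex_of_real (norm (x j))) (\<xi> j)" for j
    by (cases "x j = 0") (simp_all add: \<xi>_def scaleC_scaleC scaleC_one)
  define B where "B A z = (\<Sum>j\<in>\<Lambda>. cinner (A (\<xi> j)) (z j))" for A :: "'h \<Rightarrow> 'h" and z :: "real \<Rightarrow> 'h"
  \<comment> \<open>The kernel is moved into the second factor. With \<open>k\<close> the divided
    difference, \<open>B T (Z k)\<close> is the sum to be estimated, and \<open>Z_norm\<close>
    identifies the length of \<open>Z k\<close> with a weighted Hilbert--Schmidt norm of the
    kernel.\<close>
  define Z where "Z k j = scaleC (complex_of_real (norm (x j))) (\<Sum>i\<in>\<Lambda>. scaleC (cnj (k i j)) (y i))" for k j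
  have Z_diff: "Z (\<lambda>i j. k i j - k' i j) j = Z k j - Z k' j" for k k' j
    by (simp add: Z_def complex_vector.scale_left_diff_distrib sum_subtractf
        complex_vector.scale_right_diff_distrib)
  have Z_norm: "(\<Sum>j\<in>\<Lambda>. (norm (Z k j))\<^sup>2)
      = (\<Sum>i\<in>\<Lambda>. \<Sum>j\<in>\<Lambda>. (cmod (k i j))\<^sup>2 * (norm (y i))\<^sup>2 * (norm (x j))\<^sup>2)" for k
  proof -
    have "(norm (Z k j))\<^sup>2 = (\<Sum>i\<in>\<Lambda>. (cmod (k i j))\<^sup>2 * (norm (y i))\<^sup>2 * (norm (x j))\<^sup>2)" for j
      unfolding Z_def norm_scaleC power_mult_distrib norm_sum_ortho[OF \<Lambda> ortho_family_scaleC[OF y(1)]]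
      by (simp add: sum_distrib_left mult.commute)
    then show ?thesis by (subst sum.swap) simp
  qed
  let ?k = "\<lambda>i j. ?D (i, j)"
  \<comment> \<open>At level 0 the approximant has to vanish, so that the telescoping starts from
    the full kernel; the trivial bound \<open>L\<close> on the divided difference replaces the
    approximation there.\<close>
  define P where "P l F Bs \<longleftrightarrow> (\<Sum>j\<in>\<Lambda>. (norm (Z (\<lambda>i j. ?k i j - F i j) j))\<^sup>2) \<le> 680 * L\<^sup>2 / 2 ^ l
      \<and> finite Bs \<and> card Bs \<le> 10 * 2 ^ l \<and> (\<forall>j\<in>\<Lambda>. Z F j \<in> cspan Bs)
      \<and> (l = 0 \<longrightarrow> F = (\<lambda>_ _. 0))" for l :: nat and F and Bs :: "'h set"
  have "\<exists>F Bs. P l F Bs" for l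
  proof (cases "l = 0")
    case True
    have "(\<Sum>j\<in>\<Lambda>. (norm (Z ?k j))\<^sup>2) \<le> (\<Sum>i\<in>\<Lambda>. \<Sum>j\<in>\<Lambda>. L\<^sup>2 * (norm (y i))\<^sup>2 * (norm (x j))\<^sup>2)"
      unfolding Z_norm
      by (intro sum_mono mult_right_mono power_mono norm_divided_difference_le[of f, OF L]) auto
    also have "\<dots> = L\<^sup>2 * ((\<Sum>i\<in>\<Lambda>. (norm (y i))\<^sup>2) * (\<Sum>i\<in>\<Lambda>. (norm (x i))\<^sup>2))"
      by (simp only: sum_product, simp only: sum_distrib_left mult.assoc)
    also have "\<dots> \<le> L\<^sup>2 * (1 * 1)"
      using x(2) y(2) by (intro mult_left_mono mult_mono) (auto intro: sum_nonneg)
    also have "\<dots> \<le> 680 * L\<^sup>2 / 2 ^ l" using True by simp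
    finally show ?thesis unfolding P_def using True
      by (intro exI[of _ "\<lambda>_ _. 0"] exI[of _ "{}"]) (simp add: Z_def complex_vector.scale_zero_left)
  next
    case False
    obtain F Bs where F: "(\<Sum>i\<in>\<Lambda>. \<Sum>j\<in>\<Lambda>. (cmod (?k i j - F i j))\<^sup>2 * (norm (y i))\<^sup>2 * (norm (x j))\<^sup>2)
        \<le> 680 * L\<^sup>2 / (2 ^ l :: nat)"
      "finite Bs" "card Bs \<le> 10 * 2 ^ l"
      "\<And>j. j \<in> \<Lambda> \<Longrightarrow> (\<Sum>i\<in>\<Lambda>. scaleC (cnj (F i j)) (y i)) \<in> cspan Bs"
      by (rule divided_difference_approx[of f, OF L \<Lambda> _ y(2) _ x(2), where N = "2 ^ l" and Y = y]) auto
    have "Z F j \<in> cspan Bs" if "j \<in> \<Lambda>" for j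
      unfolding Z_def by (rule complex_vector.span_scale[OF F(4)[OF that]])
    then show ?thesis unfolding P_def
      using F(1-3) False by (intro exI[of _ F] exI[of _ Bs]) (simp add: Z_norm)
  qed
  then obtain F Bs where "\<And>l. P l (F l) (Bs l)" by metis
  then have F: "\<And>l. (\<Sum>j\<in>\<Lambda>. (norm (Z (\<lambda>i j. ?k i j - F l i j) j))\<^sup>2) \<le> 680 * L\<^sup>2 / 2 ^ l"
    "\<And>l. finite (Bs l)" "\<And>l. card (Bs l) \<le> 10 * 2 ^ l" "\<And>l j. j \<in> \<Lambda> \<Longrightarrow> Z (F l) j \<in> cspan (Bs l)"
    "F 0 = (\<lambda>_ _. 0)"
    unfolding P_def by blast+
  define zG where "zG l = Z (\<lambda>i j. ?k i j - F l i j)" for l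
  have zG: "sqrt (\<Sum>j\<in>\<Lambda>. (norm (zG l j))\<^sup>2) \<le> sqrt (680 * L\<^sup>2 / 2 ^ l)" for l
    unfolding zG_def by (intro real_sqrt_le_mono F)
  have zG_diff: "zG l j - zG (Suc l) j = Z (F (Suc l)) j - Z (F l) j" for l j
    by (simp add: zG_def Z_diff)
  have zG_diff_norm: "sqrt (\<Sum>j\<in>\<Lambda>. (norm (zG l j - zG (Suc l) j))\<^sup>2) \<le> sqrt (2720 * L\<^sup>2 / 2 ^ l)" for l
  proof (rule real_sqrt_le_mono)
    have "(norm (zG l j - zG (Suc l) j))\<^sup>2 \<le> 2 * (norm (zG l j))\<^sup>2 + 2 * (norm (zG (Suc l) j))\<^sup>2" for j
    proof -
      have "(norm (zG l j - zG (Suc l) j))\<^sup>2 \<le> (norm (zG l j) + norm (zG (Suc l) j))\<^sup>2"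
        by (intro power_mono norm_triangle_ineq4) auto
      then show ?thesis using sum_squares_bound[of "norm (zG l j)" "norm (zG (Suc l) j)"]
        by (simp add: power2_sum)
    qed
    then have "(\<Sum>j\<in>\<Lambda>. (norm (zG l j - zG (Suc l) j))\<^sup>2)
        \<le> (\<Sum>j\<in>\<Lambda>. 2 * (norm (zG l j))\<^sup>2 + 2 * (norm (zG (Suc l) j))\<^sup>2)"
      by (intro sum_mono)
    also have "\<dots> = 2 * (\<Sum>j\<in>\<Lambda>. (norm (zG l j))\<^sup>2) + 2 * (\<Sum>j\<in>\<Lambda>. (norm (zG (Suc l) j))\<^sup>2)"
      by (simp add: sum.distrib sum_distrib_left)
    also have "\<dots> \<le> 2 * (680 * L\<^sup>2 / 2 ^ l) + 2 * (680 * L\<^sup>2 / 2 ^ Suc l)"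
      unfolding zG_def by (intro add_mono mult_left_mono F) auto
    also have "\<dots> \<le> 2720 * L\<^sup>2 / 2 ^ l" by (simp add: field_simps)
    finally show "(\<Sum>j\<in>\<Lambda>. (norm (zG l j - zG (Suc l) j))\<^sup>2) \<le> 2720 * L\<^sup>2 / 2 ^ l" .
  qed
  have eps: "cmod (B T (Z ?k)) \<le> 800 * L * (3 * M + 2 * e)" if e: "0 < e" for e
  proof -
    let ?s = "\<lambda>l. singular_value (2 ^ l) T + e / 2 ^ l"
    have "\<exists>R. bounded_clinear R \<and> rank_le R (2 ^ l) \<and> onorm (\<lambda>h. T h - R h) < ?s l" for l
      using e by (intro singular_value_approx) simp
    then obtain R0 where R0: "\<And>l. bounded_clinear (R0 l)" "\<And>l. rank_le (R0 l) (2 ^ l)"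
      "\<And>l. onorm (\<lambda>h. T h - R0 l h) < ?s l" by metis
    \<comment> \<open>Again no approximant at level 0: then \<open>b 0\<close> is the sum itself and
      \<open>\<delta> 0\<close> is the operator norm of \<open>T\<close>.\<close>
    define R where "R l = (if l = 0 then (\<lambda>_. 0) else R0 l)" for l
    have R: "bounded_clinear (R l)" "rank_le (R l) (2 ^ l)" for l using R0 by (auto simp: R_def)
    define \<Delta> where "\<Delta> l = (\<lambda>h. T h - R l h)" for l
    define \<delta> where "\<delta> l = onorm (\<Delta> l)" for l
    have \<Delta>: "bounded_clinear (\<Delta> l)" for l unfolding \<Delta>_def by (rule bounded_clinear_diff[OF bc R(1)])
    have \<delta>0: "0 \<le> \<delta> l" for l unfolding \<delta>_def by (rule onorm_nonneg[OF \<Delta>])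
    have \<delta>_Suc: "\<delta> (Suc l) \<le> ?s (Suc l)" for l
      using R0(3)[of "Suc l"] by (simp add: \<delta>_def \<Delta>_def R_def)
    have "\<delta> 0 \<le> M" using onorm_le_matsaev_norm[OF T] by (simp add: \<delta>_def \<Delta>_def R_def M_def)
    \<comment> \<open>\<open>M\<close> pays for \<open>\<delta> 0\<close>, \<open>2 * M\<close> for
      the dyadic singular values and \<open>2 * e\<close> for the slack.\<close>
    have \<delta>_sum: "(\<Sum>l\<le>n. \<delta> l) \<le> 3 * M + 2 * e" for n
    proof -
      have s0: "0 \<le> singular_value j T" for j by (rule singular_value_nonneg[OF bc])
      have "(\<Sum>l\<le>n. \<delta> l) \<le> M + (\<Sum>l\<le>n. ?s l)"
      proof (induction n)
        case 0
        then show ?case using \<open>\<delta> 0 \<le> M\<close> s0 e by (simp add: add_nonneg_nonneg add_increasing2)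
      next
        case (Suc n)
        then show ?case using \<delta>_Suc[of n] by simp
      qed
      also have "(\<Sum>l\<le>n. ?s l) = (\<Sum>l\<le>n. singular_value (2 ^ l) T) + e * (\<Sum>l\<le>n. (1 / 2) ^ l)"
        by (simp add: sum.distrib sum_distrib_left power_one_over)
      also have "\<dots> \<le> 2 * M + e * 2"
      proof (intro add_mono mult_left_mono)
        show "(\<Sum>l\<le>n. singular_value (2 ^ l) T) \<le> 2 * M"
          unfolding M_def by (rule dyadic_le_matsaev_norm[OF T])
        have "(\<Sum>l\<le>n. (1 / 2 :: real) ^ l) = 2 - (1 / 2) ^ n" by (induction n) auto
        then show "(\<Sum>l\<le>n. (1 / 2 :: real) ^ l) \<le> 2" by simp
      qed (use e in simp)
      finally show ?thesis by simp
    qed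
    define b where "b l = B (\<Delta> l) (zG l)" for l
    have step: "cmod (b l - b (Suc l)) \<le> 400 * L * (\<delta> l + \<delta> (Suc l))" for l
    proof -
      define A where "A = (\<lambda>h. R (Suc l) h - R l h)"
      have A: "bounded_clinear A" unfolding A_def by (rule bounded_clinear_diff[OF R(1) R(1)])
      have rA: "rank_le A (3 * 2 ^ l)" unfolding A_def
        by (rule rank_le_mono[OF rank_le_diff[OF R(2) R(2)]]) simp
      have A_eq: "A h = \<Delta> l h - \<Delta> (Suc l) h" for h by (simp add: A_def \<Delta>_def)
      have nA: "onorm A \<le> \<delta> l + \<delta> (Suc l)"
      proof (rule onorm_bound)
        show "norm (A h) \<le> (\<delta> l + \<delta> (Suc l)) * norm h" for h
          unfolding A_eq \<delta>_def
          using norm_triangle_ineq4[of "\<Delta> l h" "\<Delta> (Suc l) h"]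
            norm_le_onorm[OF \<Delta>, of l h] norm_le_onorm[OF \<Delta>, of "Suc l" h]
          by (simp add: distrib_right)
      qed (use \<delta>0 in simp)
      \<comment> \<open>A discrete product rule: in each summand one factor is a difference of
        consecutive approximants, hence of low rank, and the other is a remainder. The powers of 2
        cancel, leaving \<open>sqrt (3 * 680) \<le> 46\<close> and
        \<open>sqrt (30 * 2720) \<le> 286\<close>.\<close>
      have "b l - b (Suc l) = B A (zG l) + B (\<Delta> (Suc l)) (\<lambda>j. zG l j - zG (Suc l) j)"
        by (simp add: b_def B_def A_eq cinner_diff_left cinner_diff_right sum_subtractf)
      moreover have "cmod (B A (zG l)) \<le> 46 * L * (\<delta> l + \<delta> (Suc l))"
      proof -
        have "cmod (B A (zG l)) \<le> sqrt (3 * 2 ^ l :: nat) * onorm A * sqrt (\<Sum>j\<in>\<Lambda>. (norm (zG l j))\<^sup>2)"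
          unfolding B_def by (rule trace_le_rank_left[OF \<Lambda> \<xi> \<xi>1 A rA])
        also have "\<dots> \<le> sqrt (3 * 2 ^ l :: nat) * (\<delta> l + \<delta> (Suc l)) * sqrt (680 * L\<^sup>2 / 2 ^ l)"
          using nA zG \<delta>0 by (intro mult_mono mult_nonneg_nonneg add_nonneg_nonneg) (auto intro: onorm_nonneg[OF A] sum_nonneg)
        also have "\<dots> = sqrt (real (3 * 2 ^ l) * (680 * L\<^sup>2 / 2 ^ l)) * (\<delta> l + \<delta> (Suc l))"
          unfolding real_sqrt_mult by simp
        also have "\<dots> \<le> 46 * L * (\<delta> l + \<delta> (Suc l))"
          using L0 \<delta>0 by (intro mult_right_mono real_le_lsqrt add_nonneg_nonneg) (auto simp: power_mult_distrib)
        finally show ?thesis .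
      qed
      moreover have "cmod (B (\<Delta> (Suc l)) (\<lambda>j. zG l j - zG (Suc l) j)) \<le> 286 * L * \<delta> (Suc l)"
      proof -
        have card: "card (Bs l \<union> Bs (Suc l)) \<le> 30 * 2 ^ l"
          using card_Un_le[of "Bs l" "Bs (Suc l)"] F(3)[of l] F(3)[of "Suc l"] by simp
        have span: "zG l j - zG (Suc l) j \<in> cspan (Bs l \<union> Bs (Suc l))" if "j \<in> \<Lambda>" for j
          unfolding zG_diff
          using F(4)[OF that, of l] F(4)[OF that, of "Suc l"]
            complex_vector.span_mono[of "Bs l" "Bs l \<union> Bs (Suc l)"]
            complex_vector.span_mono[of "Bs (Suc l)" "Bs l \<union> Bs (Suc l)"]
          by (intro complex_vector.span_diff) auto
        have "cmod (B (\<Delta> (Suc l)) (\<lambda>j. zG l j - zG (Suc l) j))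
            \<le> sqrt (30 * 2 ^ l :: nat) * \<delta> (Suc l) * sqrt (\<Sum>j\<in>\<Lambda>. (norm (zG l j - zG (Suc l) j))\<^sup>2)"
          unfolding B_def \<delta>_def
          by (rule trace_le_rank_right[OF \<Lambda> \<xi> \<xi>1 \<Delta> _ card span]) (use F(2) in auto)
        also have "\<dots> \<le> sqrt (30 * 2 ^ l :: nat) * \<delta> (Suc l) * sqrt (2720 * L\<^sup>2 / 2 ^ l)"
          using zG_diff_norm \<delta>0 by (intro mult_left_mono mult_nonneg_nonneg) auto
        also have "\<dots> = sqrt (real (30 * 2 ^ l) * (2720 * L\<^sup>2 / 2 ^ l)) * \<delta> (Suc l)"
          unfolding real_sqrt_mult by simp
        also have "\<dots> \<le> 286 * L * \<delta> (Suc l)"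
          using L0 \<delta>0 by (intro mult_right_mono real_le_lsqrt) (auto simp: power_mult_distrib)
        finally show ?thesis .
      qed
      ultimately have "cmod (b l - b (Suc l)) \<le> 46 * L * (\<delta> l + \<delta> (Suc l)) + 286 * L * \<delta> (Suc l)"
        using norm_triangle_ineq[of "B A (zG l)" "B (\<Delta> (Suc l)) (\<lambda>j. zG l j - zG (Suc l) j)"] by simp
      also have "\<dots> \<le> 400 * L * (\<delta> l + \<delta> (Suc l))"
        using mult_nonneg_nonneg[OF L0 \<delta>0[of l]] mult_nonneg_nonneg[OF L0 \<delta>0[of "Suc l"]]
        by (simp add: algebra_simps)
      finally show ?thesis .
    qed
    \<comment> \<open>For the last remainder a crude bound involving the number of points is enough,
      because \<open>\<delta> n\<close> tends to 0 while the set of points stays fixed.\<close>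
    have b_le: "cmod (b n) \<le> sqrt (card \<Lambda> * 680 * L\<^sup>2) * \<delta> n" for n
    proof -
      have "(\<Sum>j\<in>\<Lambda>. (norm (\<Delta> n (\<xi> j)))\<^sup>2) \<le> (\<Sum>j\<in>\<Lambda>. (\<delta> n)\<^sup>2)"
        using order_trans[OF norm_le_onorm[OF \<Delta>] mult_left_le[OF \<xi>1 onorm_nonneg[OF \<Delta>]]]
        by (intro sum_mono power_mono) (auto simp: \<delta>_def)
      then have "sqrt (\<Sum>j\<in>\<Lambda>. (norm (\<Delta> n (\<xi> j)))\<^sup>2) \<le> sqrt (card \<Lambda>) * \<delta> n"
        using \<delta>0 by (intro real_le_lsqrt) (auto simp: power_mult_distrib)
      moreover have "sqrt (\<Sum>j\<in>\<Lambda>. (norm (zG n j))\<^sup>2) \<le> sqrt (680 * L\<^sup>2)"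
      proof (rule order_trans[OF zG real_sqrt_le_mono])
        show "680 * L\<^sup>2 / 2 ^ n \<le> 680 * L\<^sup>2" by (simp add: divide_le_eq mult_le_cancel_left1)
      qed
      ultimately have "sqrt (\<Sum>j\<in>\<Lambda>. (norm (\<Delta> n (\<xi> j)))\<^sup>2) * sqrt (\<Sum>j\<in>\<Lambda>. (norm (zG n j))\<^sup>2)
          \<le> (sqrt (card \<Lambda>) * \<delta> n) * sqrt (680 * L\<^sup>2)"
        using \<delta>0 by (intro mult_mono) (auto intro: sum_nonneg)
      then have "cmod (b n) \<le> (sqrt (card \<Lambda>) * \<delta> n) * sqrt (680 * L\<^sup>2)"
        unfolding b_def B_def by (rule order_trans[OF sum_cinner_le_sqrt])
      then show ?thesis by (simp add: real_sqrt_mult mult_ac)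
    qed
    have "\<delta> \<longlonglongrightarrow> 0"
    proof (rule LIMSEQ_imp_Suc, rule Lim_null_comparison)
      show "\<forall>\<^sub>F l in sequentially. norm (\<delta> (Suc l)) \<le> ?s (Suc l)" using \<delta>_Suc \<delta>0 by simp
      have "(\<lambda>l. singular_value (2 ^ l) T) \<longlonglongrightarrow> 0"
        by (rule filterlim_compose[OF singular_value_tendsto_0[OF T]])
          (rule filterlim_subseq, simp add: strict_mono_def)
      moreover have "(\<lambda>l. e / 2 ^ l) \<longlonglongrightarrow> 0"
        by (rule LIMSEQ_divide_realpow_zero) simp
      ultimately have "?s \<longlonglongrightarrow> 0 + 0" by (rule tendsto_add)
      then have "?s \<longlonglongrightarrow> 0" by simp
      then show "(\<lambda>l. ?s (Suc l)) \<longlonglongrightarrow> 0" by (rule LIMSEQ_Suc)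
    qed
    then have "(\<lambda>n. sqrt (card \<Lambda> * 680 * L\<^sup>2) * \<delta> n + 800 * L * (3 * M + 2 * e))
        \<longlonglongrightarrow> sqrt (card \<Lambda> * 680 * L\<^sup>2) * 0 + 800 * L * (3 * M + 2 * e)"
      by (intro tendsto_intros)
    moreover have "cmod (b 0) \<le> sqrt (card \<Lambda> * 680 * L\<^sup>2) * \<delta> n + 800 * L * (3 * M + 2 * e)" for n
    proof -
      have "cmod (b 0) \<le> cmod (b n) + (\<Sum>l<n. cmod (b l - b (Suc l)))" by (rule norm_telescope_le)
      also have "(\<Sum>l<n. cmod (b l - b (Suc l))) \<le> (\<Sum>l<n. 400 * L * (\<delta> l + \<delta> (Suc l)))"
        by (intro sum_mono step)
      also have "\<dots> = 400 * L * ((\<Sum>l<n. \<delta> l) + (\<Sum>l<n. \<delta> (Suc l)))"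
        by (simp add: sum_distrib_left[symmetric] sum.distrib)
      also have "\<dots> \<le> 400 * L * ((3 * M + 2 * e) + (3 * M + 2 * e))"
      proof (intro mult_left_mono add_mono)
        show "(\<Sum>l<n. \<delta> l) \<le> 3 * M + 2 * e"
          using \<delta>_sum[of n] \<delta>0[of n] by (simp add: lessThan_Suc_atMost[symmetric])
        have "(\<Sum>l\<le>n. \<delta> l) = \<delta> 0 + (\<Sum>l<n. \<delta> (Suc l))"
          by (simp add: lessThan_Suc_atMost[symmetric] sum.lessThan_Suc_shift del: sum.lessThan_Suc)
        then show "(\<Sum>l<n. \<delta> (Suc l)) \<le> 3 * M + 2 * e" using \<delta>_sum[of n] \<delta>0[of 0] by linarith
      qed (use L0 in simp)
      finally show ?thesis using b_le[of n] by (simp add: algebra_simps)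
    qed
    ultimately have "cmod (b 0) \<le> sqrt (card \<Lambda> * 680 * L\<^sup>2) * 0 + 800 * L * (3 * M + 2 * e)"
      by (intro LIMSEQ_le_const) auto
    moreover have "b 0 = B T (Z ?k)" by (simp add: b_def \<Delta>_def R_def zG_def F(5))
    ultimately show ?thesis by simp
  qed
  have "cmod (B T (Z ?k)) \<le> 2400 * L * M"
  proof (rule field_le_epsilon)
    fix e :: real assume e: "0 < e"
    have "1600 * L * (e / (1600 * L + 1)) \<le> e"
      using e L0 by (simp add: divide_le_eq algebra_simps)
    then show "cmod (B T (Z ?k)) \<le> 2400 * L * M + e"
      using eps[of "e / (1600 * L + 1)"] e L0 by (simp add: algebra_simps)
  qed
  moreover have "(\<Sum>i\<in>\<Lambda>. \<Sum>j\<in>\<Lambda>. ?D (i, j) * cinner (T (x j)) (y i)) = B T (Z ?k)"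
  proof -
    have "cinner (T (\<xi> j)) (Z ?k j) = (\<Sum>i\<in>\<Lambda>. ?D (i, j) * cinner (T (x j)) (y i))" for j
    proof -
      have Tx: "T (x j) = scaleC (complex_of_real (norm (x j))) (T (\<xi> j))"
        by (metis x\<xi> bounded_clinear_apply_scaleC[OF bc])
      show ?thesis unfolding Tx
        by (simp add: Z_def cinner_sum_right cinner_scaleC_right cinner_scaleC_left sum_distrib_left mult_ac)
    qed
    then show ?thesis unfolding B_def by (subst sum.swap) simp
  qed
  ultimately show ?thesis by (simp add: M_def)
qed


text \<open>Both sides scale in the same way with the two families, so these may be divided by their
  lengths; a family of length 0 makes the sum vanish.\<close>

lemma discrete_doi_bound_2400: "discrete_doi_bound TYPE('h::chilbert_space) 2400"
  unfolding discrete_doi_bound_def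
proof (intro allI impI)
  fix f :: "real \<Rightarrow> complex" and \<Lambda> and x y :: "real \<Rightarrow> 'h" and T :: "'h \<Rightarrow> 'h"
  assume f: "\<exists>L. L-lipschitz_on UNIV f" and \<Lambda>: "finite \<Lambda>" and x: "ortho_family x \<Lambda>"
    and y: "ortho_family y \<Lambda>" and T: "T \<in> matsaev_ideal"
  define a b where "a = sqrt (\<Sum>i\<in>\<Lambda>. (norm (x i))\<^sup>2)" and "b = sqrt (\<Sum>i\<in>\<Lambda>. (norm (y i))\<^sup>2)"
  note bc = matsaev_idealD(1)[OF T]
  let ?S = "\<lambda>x y. \<Sum>i\<in>\<Lambda>. \<Sum>j\<in>\<Lambda>. divided_difference f (i, j) * cinner (T (x j)) (y i)"
  have zero: "z i = 0" if "(\<Sum>i\<in>\<Lambda>. (norm (z i))\<^sup>2) = 0" "i \<in> \<Lambda>" for z :: "real \<Rightarrow> 'h" and i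
    using that \<Lambda> by (simp add: sum_nonneg_eq_0_iff)
  have "cmod (?S x y) \<le> 2400 * lip_norm f * matsaev_norm T * (a * b)"
  proof (cases "a = 0 \<or> b = 0")
    case True
    then have "(\<forall>i\<in>\<Lambda>. x i = 0) \<or> (\<forall>i\<in>\<Lambda>. y i = 0)" using zero by (auto simp: a_def b_def)
    then have "?S x y = 0"
    proof
      assume "\<forall>i\<in>\<Lambda>. x i = 0"
      then show ?thesis by (intro sum.neutral ballI) (simp add: bounded_clinear_apply_zero[OF bc])
    qed simp
    then show ?thesis using True by auto
  next
    case False
    have "0 \<le> a" "0 \<le> b" by (auto simp: a_def b_def intro: sum_nonneg)
    then have ab: "0 < a" "0 < b" using False by auto
    define x' y' where "x' i = scaleC (complex_of_real (1 / a)) (x i)"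
      and "y' i = scaleC (complex_of_real (1 / b)) (y i)" for i
    have "(\<Sum>i\<in>\<Lambda>. (norm (x i))\<^sup>2) = a\<^sup>2" "(\<Sum>i\<in>\<Lambda>. (norm (y i))\<^sup>2) = b\<^sup>2"
      by (simp_all add: a_def b_def sum_nonneg)
    then have n1: "(\<Sum>i\<in>\<Lambda>. (norm (x' i))\<^sup>2) \<le> 1" "(\<Sum>i\<in>\<Lambda>. (norm (y' i))\<^sup>2) \<le> 1"
      using ab by (simp_all add: x'_def y'_def norm_scaleC norm_divide power_divide sum_divide_distrib[symmetric])
    have "cmod (?S x' y') \<le> 2400 * lip_norm f * matsaev_norm T"
      using n1 ortho_family_scaleC[OF x] ortho_family_scaleC[OF y] unfolding x'_def y'_def
      by (intro discrete_doi_bound_normalized[of f, OF lip_norm_bound[OF f] \<Lambda> _ _ _ _ T])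
    moreover have "?S x y = complex_of_real (a * b) * ?S x' y'"
      using ab by (simp add: x'_def y'_def bounded_clinear_apply_scaleC[OF bc] cinner_scaleC_left
          cinner_scaleC_right sum_distrib_left)
    then have "cmod (?S x y) = a * b * cmod (?S x' y')" using ab by (simp only: norm_mult norm_of_real) simp
    ultimately show ?thesis using ab by (simp add: mult.commute mult_left_mono)
  qed
  then show "cmod (?S x y) \<le> 2400 * lip_norm f * matsaev_norm T
      * (sqrt (\<Sum>i\<in>\<Lambda>. (norm (x i))\<^sup>2) * sqrt (\<Sum>i\<in>\<Lambda>. (norm (y i))\<^sup>2))" by (simp add: a_def b_def)
qed

section \<open>Orthogonal projections and spectral measures\<close>

lemma orthogonal_projectionD:
  assumes "orthogonal_projection P"
  shows "bounded_clinear P" "P (P x) = P x" "cinner (P x) y = cinner x (P y)"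
  using assms by (auto simp: orthogonal_projection_def)

lemma projection_cinner:
  assumes "orthogonal_projection P"
  shows "cinner (P x) x = complex_of_real ((norm (P x))\<^sup>2)"
proof -
  have "cinner (P x) x = cinner (P (P x)) x" by (simp only: orthogonal_projectionD(2)[OF assms])
  also have "\<dots> = cinner (P x) (P x)" by (rule orthogonal_projectionD(3)[OF assms])
  finally show ?thesis by (simp only: cinner_self)
qed

lemma projection_norm_le:
  assumes "orthogonal_projection P" shows "norm (P x) \<le> norm x"
proof (cases "P x = 0")
  case False
  have "norm (P x) * norm (P x) \<le> norm x * norm (P x)"
    using norm_cinner_le[of "P x" x] projection_cinner[OF assms, of x]
    by (simp add: power2_eq_square norm_mult mult.commute)
  then show ?thesis using False by simp
qed simp

text \<open>For \<open>a\<close> in the range and \<open>b\<close> in the kernel, contractivity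
  gives \<open>norm a \<le> norm (a - scaleC t b)\<close>, and the minimizing \<open>t\<close>
  forces \<open>cinner a b = 0\<close>. On the Hilbert--Schmidt class self-adjointness thus follows
  from norm estimates alone.\<close>

lemma orthogonal_projectionI_contraction:
  assumes P: "bounded_clinear P" "\<And>x. P (P x) = P x" "\<And>x. norm (P x) \<le> norm x"
  shows "orthogonal_projection P"
proof -
  have orth: "cinner (P x) (y - P y) = 0" for x y
  proof (cases "y = P y")
    case False
    define a b t where "a = P x" and "b = y - P y" and "t = cinner a b / (norm b)\<^sup>2"
    have b: "0 < (norm b)\<^sup>2" using False by (simp add: b_def)
    have "P b = 0" by (simp add: b_def bounded_clinear_apply_diff[OF P(1)] P(2))
    then have "P (a - scaleC t b) = a"
      by (simp add: bounded_clinear_apply_diff[OF P(1)] bounded_clinear_apply_scaleC[OF P(1)])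
        (simp add: a_def P(2))
    then have "norm a \<le> norm (a - scaleC t b)" using P(3)[of "a - scaleC t b"] by simp
    then have "(norm a)\<^sup>2 \<le> (norm (a - scaleC t b))\<^sup>2" by (intro power_mono) auto
    also have "\<dots> = (norm a)\<^sup>2 - 2 * inner a (scaleC t b) + (norm (scaleC t b))\<^sup>2"
      by (simp add: power2_norm_eq_inner inner_diff_left inner_diff_right inner_commute)
    also have "inner a (scaleC t b) = (cmod (cinner a b))\<^sup>2 / (norm b)\<^sup>2"
    proof -
      have "cnj t * cinner a b = complex_of_real ((cmod (cinner a b))\<^sup>2 / (norm b)\<^sup>2)"
        using complex_norm_square[of "cinner a b"] by (simp add: t_def mult.commute)
      then show ?thesis by (simp only: inner_eq_Re_cinner cinner_scaleC_right Re_complex_of_real)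
    qed
    also have "(norm (scaleC t b))\<^sup>2 = (cmod (cinner a b))\<^sup>2 / (norm b)\<^sup>2"
    proof -
      have "norm (scaleC t b) = cmod (cinner a b) / norm b"
        using b by (simp add: norm_scaleC t_def norm_divide norm_power norm_mult power2_eq_square)
      then show ?thesis by (simp add: power_divide)
    qed
    finally have "(cmod (cinner a b))\<^sup>2 / (norm b)\<^sup>2 \<le> 0" by linarith
    then show ?thesis using b by (simp add: divide_le_0_iff a_def b_def)
  qed simp
  have "cinner (P x) y = cinner (P x) (P y)" for x y
    using orth[of x y] by (simp add: cinner_diff_right)
  moreover have "cinner x (P y) = cinner (P x) (P y)" for x y
    using orth[of y x] cinner_eq_zero_commute[of "P y"] by (simp add: cinner_diff_left)
  ultimately show ?thesis using P by (simp add: orthogonal_projection_def)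
qed

lemma projection_eqI:
  assumes "orthogonal_projection P" "orthogonal_projection Q" "\<And>x. norm (P x) = norm (Q x)"
  shows "P = Q"
  using assms by (intro polarization orthogonal_projectionD(1)) (simp_all add: projection_cinner)

text \<open>At a vector in the range of \<open>Q\<close> the inequality leaves no room for
  \<open>P\<close>.\<close>

lemma projection_prod_zero:
  assumes "orthogonal_projection P" "orthogonal_projection Q"
    "\<And>x. (norm (P x))\<^sup>2 + (norm (Q x))\<^sup>2 \<le> (norm x)\<^sup>2"
  shows "P (Q x) = 0"
  using assms(3)[of "Q x"] by (simp add: orthogonal_projectionD(2)[OF assms(2)])

text \<open>The inner product of the sum of the pieces with \<open>x\<close> equals the squared norm
  of that sum; Cauchy--Schwarz then bounds it by the norm of \<open>x\<close>.\<close>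

lemma sum_norm_projections_le:
  assumes A: "finite A" and P: "\<And>i. i \<in> A \<Longrightarrow> orthogonal_projection (P i)"
    and o: "ortho_family (\<lambda>i. P i x) A"
  shows "(\<Sum>i\<in>A. (norm (P i x))\<^sup>2) \<le> (norm x)\<^sup>2"
proof -
  let ?S = "\<Sum>i\<in>A. P i x"
  have "cinner ?S x = complex_of_real (\<Sum>i\<in>A. (norm (P i x))\<^sup>2)"
    by (simp add: cinner_sum_left projection_cinner[OF P])
  also have "(\<Sum>i\<in>A. (norm (P i x))\<^sup>2) = (norm ?S)\<^sup>2" by (rule norm_sum_ortho[OF A o, symmetric])
  finally have "norm ?S * norm ?S \<le> norm x * norm ?S"
    using norm_cinner_le[of ?S x] by (simp add: power2_eq_square norm_mult mult.commute)
  then have "norm ?S \<le> norm x" by (cases "?S = 0") simp_all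
  then have "(norm ?S)\<^sup>2 \<le> (norm x)\<^sup>2" by (intro power_mono) auto
  then show ?thesis by (simp add: norm_sum_ortho[OF A o])
qed

text \<open>By Pythagoras, square summability of the pieces makes the series converge in norm;
  idempotence of the sum follows from \<open>P m (Q x) = P m x\<close>. Countable additivity of the
  product and of the diagonal spectral measures rests on this lemma.\<close>

lemma sum_projections:
  fixes P :: "nat \<Rightarrow> 'a::chilbert_space \<Rightarrow> 'a"
  assumes P: "\<And>n. orthogonal_projection (P n)" and PP: "\<And>m n x. m \<noteq> n \<Longrightarrow> P m (P n x) = 0"
  obtains Q where "orthogonal_projection Q" "\<And>x. (\<lambda>n. P n x) sums Q x"
    "\<And>x. (\<lambda>n. (norm (P n x))\<^sup>2) sums (norm (Q x))\<^sup>2"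
proof -
  have pyth: "(norm (\<Sum>i\<in>A. P i x))\<^sup>2 = (\<Sum>i\<in>A. (norm (P i x))\<^sup>2)" if "finite A" for A x
    by (rule norm_sum_ortho[OF that])
      (simp add: ortho_family_def orthogonal_projectionD(3)[OF P] PP)
  have le_sq: "(\<Sum>i\<in>A. (norm (P i x))\<^sup>2) \<le> (norm x)\<^sup>2" if "finite A" for A x
    by (rule sum_norm_projections_le[OF that P])
      (simp add: ortho_family_def orthogonal_projectionD(3)[OF P] PP)
  have le: "norm (\<Sum>i\<in>A. P i x) \<le> norm x" if "finite A" for A x
    using le_sq[OF that, of x] pyth[OF that, of x] power2_le_imp_le[OF _ norm_ge_zero] by metis
  have sq: "summable (\<lambda>n. (norm (P n x))\<^sup>2)" for x
  proof (rule bounded_imp_summable)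
    show "(\<Sum>i\<le>n. (norm (P i x))\<^sup>2) \<le> (norm x)\<^sup>2" for n
      by (rule le_sq) simp
  qed simp
  have sm: "summable (\<lambda>n. P n x)" for x
    unfolding summable_Cauchy
  proof (intro allI impI)
    fix e :: real assume e: "0 < e"
    then obtain N where N: "\<And>m n. m \<ge> N \<Longrightarrow> norm (\<Sum>i\<in>{m..<n}. (norm (P i x))\<^sup>2) < e\<^sup>2"
      using sq[of x] unfolding summable_Cauchy by (meson zero_less_power)
    have "norm (\<Sum>i\<in>{m..<n}. P i x) < e" if "m \<ge> N" for m n
    proof -
      have "(norm (\<Sum>i\<in>{m..<n}. P i x))\<^sup>2 < e\<^sup>2"
        using N[OF that, of n] by (simp add: pyth abs_of_nonneg sum_nonneg)
      then show ?thesis using e by (simp add: power2_less_imp_less)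
    qed
    then show "\<exists>N. \<forall>m\<ge>N. \<forall>n. norm (\<Sum>i\<in>{m..<n}. P i x) < e" by blast
  qed
  define Q where "Q x = (\<Sum>n. P n x)" for x
  have Q: "(\<lambda>n. P n x) sums Q x" for x using sm by (simp add: Q_def summable_sums)
  have bcP: "bounded_clinear (P n)" for n by (rule orthogonal_projectionD(1)[OF P])
  have add: "Q (x + y) = Q x + Q y" for x y
    using sums_unique2[OF Q[of "x + y"]] sums_add[OF Q[of x] Q[of y]]
    by (simp add: bounded_clinear_apply_add[OF bcP])
  have scale: "Q (scaleC c x) = scaleC c (Q x)" for c x
    using sums_unique2[OF Q[of "scaleC c x"]] bounded_linear.sums[OF bounded_linear_scaleC Q[of x], of c]
    by (simp add: bounded_clinear_apply_scaleC[OF bcP])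
  have nQ: "norm (Q x) \<le> norm x" for x
    using Q[of x] unfolding sums_def
    by (rule LIMSEQ_le_const2[OF tendsto_norm]) (use le in auto)
  have bcQ: "bounded_clinear Q" by (rule bounded_clinearI[where K = 1]) (use add scale nQ in auto)
  have PQ: "P m (Q x) = P m x" for m x
  proof (rule sums_unique2)
    show "(\<lambda>n. P m (P n x)) sums P m (Q x)"
      by (rule bounded_linear.sums[OF bounded_clinear_linear[OF bcP] Q])
    have "(\<lambda>n. P m (P n x)) = (\<lambda>n. if n = m then P m x else 0)"
      using PP by (auto simp: orthogonal_projectionD(2)[OF P])
    then show "(\<lambda>n. P m (P n x)) sums P m x" using sums_single[of m "\<lambda>_. P m x"] by simp
  qed
  have "Q (Q x) = Q x" for x
  proof (rule sums_unique2[OF _ Q])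
    show "(\<lambda>n. P n x) sums Q (Q x)" using Q[of "Q x"] by (simp add: PQ)
  qed
  then have "orthogonal_projection Q" by (rule orthogonal_projectionI_contraction[OF bcQ _ nQ])
  moreover have "(\<lambda>n. (norm (P n x))\<^sup>2) sums (norm (Q x))\<^sup>2" for x
  proof -
    have "(\<lambda>n. (norm (\<Sum>i<n. P i x))\<^sup>2) \<longlonglongrightarrow> (norm (Q x))\<^sup>2"
      using Q[of x] unfolding sums_def by (intro tendsto_intros)
    then show ?thesis by (simp add: sums_def pyth)
  qed
  ultimately show ?thesis using that Q by blast
qed

section \<open>Multiplicativity of spectral measures and their scalar measures\<close>

lemma spectral_measureD:
  assumes "spectral_measure M E"
  shows "A \<in> sets M \<Longrightarrow> orthogonal_projection (E A)" "E (space M) = id"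
    "range F \<subseteq> sets M \<Longrightarrow> disjoint_family F \<Longrightarrow> (\<lambda>n. E (F n) x) sums E (\<Union>n. F n) x"
  using assms by (auto simp: spectral_measure_def)

lemma spectral_measure_empty:
  assumes E: "spectral_measure M E" shows "E {} x = 0"
proof -
  have "(\<lambda>n::nat. E {} x) sums E (\<Union>n::nat. {}) x"
    by (rule spectral_measureD(3)[OF E]) (auto simp: disjoint_family_on_def)
  then have "(\<lambda>n::nat. E {} x) \<longlonglongrightarrow> 0" by (intro summable_LIMSEQ_zero) (rule sums_summable)
  then show ?thesis by (simp add: LIMSEQ_const_iff)
qed

lemma spectral_measure_Un:
  assumes E: "spectral_measure M E" and AB: "A \<in> sets M" "B \<in> sets M" "A \<inter> B = {}"
  shows "E (A \<union> B) x = E A x + E B x"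
proof -
  have "(\<lambda>n. E (binaryset A B n) x) sums E (\<Union>n. binaryset A B n) x"
    using AB by (intro spectral_measureD(3)[OF E])
      (auto simp: disjoint_family_on_def binaryset_def)
  moreover have "(\<lambda>n. E (binaryset A B n) x) sums (E A x + E B x)"
    by (rule binaryset_sums[where f = "\<lambda>A. E A x"]) (rule spectral_measure_empty[OF E])
  ultimately show ?thesis using sums_unique2 by (metis UN_binaryset_eq)
qed

text \<open>Orthogonality is a consequence of additivity: the quadratic form of the projection
  \<open>E (A \<union> B)\<close> is the sum of the two forms, and a projection is a contraction, so
  \<open>projection_prod_zero\<close> applies.\<close>

lemma spectral_measure_disjoint:
  assumes E: "spectral_measure M E" and AB: "A \<in> sets M" "B \<in> sets M" "A \<inter> B = {}"
  shows "E A (E B x) = 0"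
proof (rule projection_prod_zero[OF spectral_measureD(1)[OF E AB(1)] spectral_measureD(1)[OF E AB(2)]])
  fix x
  have "cinner (E (A \<union> B) x) x = cinner (E A x) x + cinner (E B x) x"
    by (simp add: spectral_measure_Un[OF assms] cinner_add_left)
  then have "complex_of_real ((norm (E (A \<union> B) x))\<^sup>2)
      = complex_of_real ((norm (E A x))\<^sup>2 + (norm (E B x))\<^sup>2)"
    using AB by (simp add: projection_cinner[OF spectral_measureD(1)[OF E]] del: of_real_power)
  then have "(norm (E A x))\<^sup>2 + (norm (E B x))\<^sup>2 = (norm (E (A \<union> B) x))\<^sup>2"
    by (metis of_real_eq_iff)
  also have "\<dots> \<le> (norm x)\<^sup>2"
    using AB by (intro power_mono projection_norm_le spectral_measureD(1)[OF E]) auto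
  finally show "(norm (E A x))\<^sup>2 + (norm (E B x))\<^sup>2 \<le> (norm x)\<^sup>2" .
qed

lemma spectral_measure_Int:
  assumes E: "spectral_measure M E" and AB: "A \<in> sets M" "B \<in> sets M"
  shows "E A (E B x) = E (A \<inter> B) x"
proof -
  have s: "A \<inter> B \<in> sets M" "A - B \<in> sets M" "B - A \<in> sets M" using AB by auto
  note bc = orthogonal_projectionD(1)[OF spectral_measureD(1)[OF E]]
  have eqs: "A \<inter> B \<union> (B - A) = B" "A \<inter> B \<union> (A - B) = A" by auto
  have B: "E B x = E (A \<inter> B) x + E (B - A) x"
    using spectral_measure_Un[OF E s(1,3), of x] unfolding eqs by fastforce
  have A: "E A y = E (A \<inter> B) y + E (A - B) y" for y
    using spectral_measure_Un[OF E s(1,2), of y] unfolding eqs by fastforce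
  have d: "A \<inter> (B - A) = {}" "(A - B) \<inter> (A \<inter> B) = {}" by auto
  have "E A (E B x) = E A (E (A \<inter> B) x) + E A (E (B - A) x)"
    by (simp add: B bounded_clinear_apply_add[OF bc[OF AB(1)]])
  also have "E A (E (B - A) x) = 0" by (rule spectral_measure_disjoint[OF E AB(1) s(3) d(1)])
  also have "E A (E (A \<inter> B) x) = E (A \<inter> B) x"
    by (simp add: A spectral_measure_disjoint[OF E s(2,1) d(2)]
        orthogonal_projectionD(2)[OF spectral_measureD(1)[OF E s(1)]])
  finally show ?thesis by simp
qed

lemma spectral_measure_cinner:
  assumes E: "spectral_measure M E" and AB: "A \<in> sets M" "B \<in> sets M"
  shows "cinner (E A x) (E B y) = cinner (E (A \<inter> B) x) y"
  using orthogonal_projectionD(3)[OF spectral_measureD(1)[OF E AB(2)], of "E A x" y]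
    spectral_measure_Int[OF E AB(2,1), of x] by (simp add: Int_commute)

lemma spectral_scalar_measure_simps [simp]:
  "sets (spectral_scalar_measure M E x) = sets M" "space (spectral_scalar_measure M E x) = space M"
  by (auto simp: spectral_scalar_measure_def sets.sets_measure_of_eq sets.space_measure_of_eq)

lemma emeasure_spectral_scalar_measure:
  assumes E: "spectral_measure M E" and A: "A \<in> sets M"
  shows "emeasure (spectral_scalar_measure M E x) A = ennreal ((norm (E A x))\<^sup>2)"
proof -
  let ?\<mu> = "\<lambda>A. ennreal (Re (cinner (E A x) x))"
  have "emeasure (spectral_scalar_measure M E x) A = ?\<mu> A"
  proof (rule emeasure_measure_of[OF spectral_scalar_measure_def])
    show "countably_additive (sets (spectral_scalar_measure M E x)) ?\<mu>"
    proof (rule countably_additiveI)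
      fix F :: "nat \<Rightarrow> _"
      assume F: "range F \<subseteq> sets (spectral_scalar_measure M E x)" "disjoint_family F"
      have "(\<lambda>n. E (F n) x) sums E (\<Union>n. F n) x"
        using F by (intro spectral_measureD(3)[OF E]) auto
      then have "(\<lambda>n. cinner (E (F n) x) x) sums cinner (E (\<Union>n. F n) x) x"
        by (rule bounded_linear.sums[OF bounded_bilinear.bounded_linear_left[OF bounded_bilinear_cinner]])
      then have "(\<lambda>n. Re (cinner (E (F n) x) x)) sums Re (cinner (E (\<Union>n. F n) x) x)"
        by (rule bounded_linear.sums[OF bounded_linear_Re])
      moreover have "0 \<le> Re (cinner (E (F n) x) x)" for n
        using F(1) projection_cinner[OF spectral_measureD(1)[OF E], of "F n" x] by auto
      ultimately show "(\<Sum>n. ?\<mu> (F n)) = ?\<mu> (\<Union>n. F n)" by (intro suminf_ennreal_eq)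
    qed
  qed (use A sets.sets_into_space in \<open>auto simp: positive_def spectral_measure_empty[OF E]\<close>)
  then show ?thesis using projection_cinner[OF spectral_measureD(1)[OF E A], of x] by simp
qed

lemma measure_spectral_scalar_measure:
  assumes "spectral_measure M E" "A \<in> sets M"
  shows "measure (spectral_scalar_measure M E x) A = (norm (E A x))\<^sup>2"
  using emeasure_spectral_scalar_measure[OF assms] by (simp add: measure_def)

lemma finite_spectral_scalar_measure:
  assumes "spectral_measure M E" shows "finite_measure (spectral_scalar_measure M E x)"
  by (rule finite_measureI) (simp add: emeasure_spectral_scalar_measure[OF assms])

section \<open>Two-sided multiplication on the Hilbert--Schmidt class\<close>

lemma orthonormal_hilbert_basis: "orthonormal hilbert_basis"
  and closure_cspan_hilbert_basis: "closure (cspan hilbert_basis) = UNIV"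
  using orthonormal_basis_hilbert_basis by (auto simp: orthonormal_basis_def)

lemma orthonormal_subset: "orthonormal B \<Longrightarrow> F \<subseteq> B \<Longrightarrow> orthonormal F"
  by (auto simp: orthonormal_def subset_iff)

section \<open>Parseval's identity in the fixed orthonormal basis\<close>

lemma hilbert_basis_approx:
  assumes "0 < e"
  obtains F p where "finite F" "F \<subseteq> hilbert_basis" "p \<in> cspan F" "norm (v - p) < e"
proof -
  have "v \<in> closure (cspan hilbert_basis)" by (simp add: closure_cspan_hilbert_basis)
  then obtain p where p: "p \<in> cspan hilbert_basis" "dist p v < e"
    using assms by (auto simp: closure_approachable)
  then obtain F c where F: "finite F" "F \<subseteq> hilbert_basis" "p = (\<Sum>a\<in>F. scaleC (c a) a)"
    unfolding complex_vector.span_explicit by auto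
  moreover have "p \<in> cspan F" unfolding F(3)
    by (intro complex_vector.span_sum complex_vector.span_scale complex_vector.span_base)
  ultimately show ?thesis using that[of F p] p(2) by (simp add: dist_norm norm_minus_commute)
qed

lemma bessel_hilbert_basis:
  "finite F \<Longrightarrow> F \<subseteq> hilbert_basis \<Longrightarrow> (\<Sum>e\<in>F. (cmod (cinner v e))\<^sup>2) \<le> (norm v)\<^sup>2"
  using orthonormal_subset[OF orthonormal_hilbert_basis]
  by (intro bessel orthonormal_ortho_family) (auto simp: orthonormal_def)

text \<open>Bessel is one half. For the other, \<open>v\<close> is close to some \<open>p\<close> in
  the span of finitely many basis vectors, where the norm is exactly the length of the coefficients,
  and the coefficients of \<open>p\<close> and \<open>v\<close> differ in length by at most
  \<open>norm (v - p)\<close>.\<close>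

lemma parseval: "((\<lambda>e. (cmod (cinner v e))\<^sup>2) has_sum (norm v)\<^sup>2) hilbert_basis"
proof -
  let ?f = "\<lambda>e. (cmod (cinner v e))\<^sup>2"
  have sm: "?f summable_on hilbert_basis"
    by (rule nonneg_bdd_above_summable_on) (auto intro!: bdd_aboveI[of _ "(norm v)\<^sup>2"] bessel_hilbert_basis)
  define S where "S = infsum ?f hilbert_basis"
  have S: "sum ?f F \<le> S" if "finite F" "F \<subseteq> hilbert_basis" for F
    unfolding S_def by (rule finite_sum_le_infsum[OF sm that]) auto
  have S0: "0 \<le> S" using S[of "{}"] by simp
  have "norm v \<le> sqrt S"
  proof (rule field_le_epsilon)
    fix e :: real assume "0 < e"
    then obtain F p where F: "finite F" "F \<subseteq> hilbert_basis" "p \<in> cspan F" "norm (v - p) < e / 2"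
      using hilbert_basis_approx[of "e / 2" v] by (metis half_gt_zero)
    have "norm p = L2_set (\<lambda>e. cmod (cinner p e)) F"
      using orthonormal_expansion(2)[OF F(1) orthonormal_subset[OF orthonormal_hilbert_basis F(2)] F(3)]
      by (simp add: L2_set_def flip: real_sqrt_unique)
    also have "\<dots> \<le> L2_set (\<lambda>e. cmod (cinner v e) + cmod (cinner (v - p) e)) F"
    proof (rule L2_set_mono)
      fix e
      show "cmod (cinner p e) \<le> cmod (cinner v e) + cmod (cinner (v - p) e)"
        using norm_triangle_ineq4[of "cinner v e" "cinner (v - p) e"] by (simp add: cinner_diff_left)
    qed simp
    also have "\<dots> \<le> L2_set (\<lambda>e. cmod (cinner v e)) F + L2_set (\<lambda>e. cmod (cinner (v - p) e)) F"
      by (rule L2_set_triangle_ineq)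
    also have "\<dots> \<le> sqrt S + norm (v - p)"
      unfolding L2_set_def
      using S[OF F(1,2)] bessel_hilbert_basis[OF F(1,2), of "v - p"]
      by (intro add_mono real_sqrt_le_mono real_le_lsqrt) auto
    finally show "norm v \<le> sqrt S + e"
      using F(4) norm_triangle_sub[of v p] by linarith
  qed
  then have "(norm v)\<^sup>2 \<le> (sqrt S)\<^sup>2" by (intro power_mono) auto
  then have "(norm v)\<^sup>2 \<le> S" using S0 by simp
  moreover have "S \<le> (norm v)\<^sup>2"
    unfolding S_def by (rule infsum_le_finite_sums[OF sm]) (rule bessel_hilbert_basis)
  ultimately have "S = (norm v)\<^sup>2" by simp
  then show ?thesis using has_sum_infsum[OF sm] by (simp add: S_def)
qed

lemma has_sum_finite_sum:
  fixes f :: "'i \<Rightarrow> 'b \<Rightarrow> real"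
  assumes "finite A" "\<And>i. i \<in> A \<Longrightarrow> (f i has_sum s i) B"
  shows "((\<lambda>b. \<Sum>i\<in>A. f i b) has_sum (\<Sum>i\<in>A. s i)) B"
  using assms by (induction A) (auto intro: has_sum_add)

text \<open>\<open>K\<close> bounds the coefficients of the adjoint of \<open>T\<close> at
  \<open>f\<close>; the resulting bound on the functional passes from the span of the basis to the
  whole space by density.\<close>

lemma functional_bound_on_basis:
  assumes T: "bounded_clinear T" and K: "0 \<le> K"
    and le: "\<And>F. finite F \<Longrightarrow> F \<subseteq> hilbert_basis \<Longrightarrow> (\<Sum>e\<in>F. (cmod (cinner (T e) f))\<^sup>2) \<le> K\<^sup>2"
  shows "cmod (cinner (T h) f) \<le> K * norm h"
proof -
  have span: "cmod (cinner (T h) f) \<le> K * norm h" if mem: "h \<in> cspan hilbert_basis" for h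
  proof -
    obtain F c where F: "finite F" "F \<subseteq> hilbert_basis" and h: "h = (\<Sum>e\<in>F. scaleC (c e) e)"
      using mem unfolding complex_vector.span_explicit by auto
    have "cmod (cinner (T h) f) = cmod (\<Sum>e\<in>F. c e * cinner (T e) f)"
      by (simp add: h bounded_clinear_apply_sum[OF T] bounded_clinear_apply_scaleC[OF T]
          cinner_sum_left cinner_scaleC_left)
    also have "\<dots> \<le> (\<Sum>e\<in>F. cmod (c e) * cmod (cinner (T e) f))"
      by (rule order_trans[OF norm_sum]) (simp add: norm_mult)
    also have "\<dots> \<le> sqrt (\<Sum>e\<in>F. (cmod (c e))\<^sup>2) * sqrt (\<Sum>e\<in>F. (cmod (cinner (T e) f))\<^sup>2)"
      by (rule sum_mult_le_sqrt) auto
    also have "sqrt (\<Sum>e\<in>F. (cmod (c e))\<^sup>2) = norm h"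
      unfolding h orthonormal_sum_norm[OF orthonormal_hilbert_basis F, of c, symmetric] by simp
    also have "norm h * sqrt (\<Sum>e\<in>F. (cmod (cinner (T e) f))\<^sup>2) \<le> norm h * K"
      by (intro mult_left_mono real_le_lsqrt le F K) auto
    finally show ?thesis by (simp add: mult.commute)
  qed
  obtain g where g: "\<And>n::nat. g n \<in> cspan hilbert_basis" "g \<longlonglongrightarrow> h"
    using closure_cspan_hilbert_basis closure_sequential[of h "cspan hilbert_basis"] by auto
  show ?thesis
  proof (rule LIMSEQ_le)
    show "(\<lambda>n. cmod (cinner (T (g n)) f)) \<longlonglongrightarrow> cmod (cinner (T h) f)"
      by (intro tendsto_norm tendsto_cinner bounded_linear.tendsto[OF bounded_clinear_linear[OF T]]
          g tendsto_const)
    show "(\<lambda>n. K * norm (g n)) \<longlonglongrightarrow> K * norm h" by (intro tendsto_intros g)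
  qed (use span g in auto)
qed

section \<open>Norm estimates and rank one operators in the Hilbert--Schmidt class\<close>

lemma hs_norm_has_sum: "((\<lambda>e. (norm (hs_op T e))\<^sup>2) has_sum (norm T)\<^sup>2) hilbert_basis"
proof -
  have "((\<lambda>e. (norm (ell2_coord (hs_ell2 T) e))\<^sup>2) has_sum (norm T)\<^sup>2) UNIV"
    unfolding norm_hs_ell2 norm_ell2_sq by (rule has_sum_infsum[OF ell2_sq_summable])
  then show ?thesis
    by (rule has_sum_cong_neutral[THEN iffD1, rotated -1]) (auto simp: hs_ell2.rep_eq hs_fam_def)
qed

lemma hs_sum_le: "finite F \<Longrightarrow> F \<subseteq> hilbert_basis \<Longrightarrow> (\<Sum>e\<in>F. (norm (hs_op T e))\<^sup>2) \<le> (norm T)\<^sup>2"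
  using finite_sum_le_has_sum[OF hs_norm_has_sum[of T]] by auto

lemma hs_norm_le:
  assumes "0 \<le> K" "\<And>F. finite F \<Longrightarrow> F \<subseteq> hilbert_basis \<Longrightarrow> (\<Sum>e\<in>F. (norm (hs_op T e))\<^sup>2) \<le> K\<^sup>2"
  shows "norm T \<le> K"
proof -
  have "(norm T)\<^sup>2 \<le> K\<^sup>2" by (rule has_sum_le_finite_sums[OF hs_norm_has_sum assms(2)])
  then show ?thesis using assms(1) by (simp add: power2_le_iff_abs_le)
qed

lemma hs_op_norm_le: "norm (hs_op T x) \<le> norm T * norm x"
  using norm_hs_op_le[of T x] by (simp add: norm_hs_ell2)

lemma hilbert_schmidtI:
  assumes "bounded_clinear T"
    "\<And>F. finite F \<Longrightarrow> F \<subseteq> hilbert_basis \<Longrightarrow> (\<Sum>e\<in>F. (norm (T e))\<^sup>2) \<le> K"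
  shows "hilbert_schmidt T"
  unfolding hilbert_schmidt_def using assms
  by (auto intro!: nonneg_bdd_above_summable_on bdd_aboveI[of _ K])

text \<open>Composition on the right does not act on the columns of the matrix separately, so the
  sum is rearranged into rows. For fixed \<open>f\<close> the functional sending \<open>h\<close> to
  \<open>cinner (hs_op T h) f\<close> does not grow when composed with a contraction, and summing
  the rows over the basis restores the norm of \<open>T\<close>.\<close>

lemma hs_right_compose_le:
  fixes T :: "'a::chilbert_space hs"
  assumes Q: "bounded_clinear Q" "\<And>x. norm (Q x) \<le> norm x"
    and F: "finite F" "F \<subseteq> hilbert_basis"
  shows "(\<Sum>e\<in>F. (norm (hs_op T (Q e)))\<^sup>2) \<le> (norm T)\<^sup>2"
proof (rule has_sum_le_finite_sums)
  note T = bounded_clinear_hs_op[of T]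
  show "((\<lambda>f. \<Sum>e\<in>F. (cmod (cinner (hs_op T (Q e)) f))\<^sup>2) has_sum (\<Sum>e\<in>F. (norm (hs_op T (Q e)))\<^sup>2)) hilbert_basis"
    by (intro has_sum_finite_sum F parseval)
  fix F' :: "'a set" assume F': "finite F'" "F' \<subseteq> hilbert_basis"
  let ?k = "\<lambda>f e :: 'a. (cmod (cinner (hs_op T e) f))\<^sup>2"
  have le: "?k f e \<le> (norm (hs_op T e))\<^sup>2" if "f \<in> F'" for f e
    using bessel_hilbert_basis[of "{f}" "hs_op T e"] that F'(2) by auto
  have sm: "?k f summable_on hilbert_basis" if "f \<in> F'" for f
    by (rule summable_on_comparison_test[OF has_sum_imp_summable[OF hs_norm_has_sum[of T]]])
      (use le[OF that] in auto)
  have "(\<Sum>e\<in>F. (cmod (cinner (hs_op T (Q e)) f))\<^sup>2) \<le> infsum (?k f) hilbert_basis" if f: "f \<in> F'" for f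
  proof -
    let ?K = "sqrt (infsum (?k f) hilbert_basis)"
    have K0: "0 \<le> infsum (?k f) hilbert_basis" by (intro infsum_nonneg) simp
    have "(\<Sum>e\<in>F. (cmod (cinner (hs_op T (Q e)) f))\<^sup>2) \<le> ?K\<^sup>2"
    proof (rule bessel_bounded_functional)
      fix c
      have "(\<Sum>e\<in>F. c e * cinner (hs_op T (Q e)) f) = cinner (hs_op T (Q (\<Sum>e\<in>F. scaleC (c e) e))) f"
        by (simp add: bounded_clinear_apply_sum[OF T] bounded_clinear_apply_sum[OF Q(1)]
            bounded_clinear_apply_scaleC[OF T] bounded_clinear_apply_scaleC[OF Q(1)]
            cinner_sum_left cinner_scaleC_left)
      also have "cmod \<dots> \<le> ?K * norm (Q (\<Sum>e\<in>F. scaleC (c e) e))"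
      proof (rule functional_bound_on_basis[OF T])
        fix G :: "'a set" assume "finite G" "G \<subseteq> hilbert_basis"
        then show "sum (?k f) G \<le> ?K\<^sup>2"
          using K0 finite_sum_le_infsum[OF sm[OF f]] by simp
      qed (use K0 in simp)
      also have "\<dots> \<le> ?K * norm (\<Sum>e\<in>F. scaleC (c e) e)"
        by (intro mult_left_mono Q(2)) (use K0 in simp)
      also have "norm (\<Sum>e\<in>F. scaleC (c e) e) = sqrt (\<Sum>e\<in>F. (cmod (c e))\<^sup>2)"
        unfolding orthonormal_sum_norm[OF orthonormal_hilbert_basis F, of c, symmetric] by simp
      finally show "cmod (\<Sum>e\<in>F. c e * cinner (hs_op T (Q e)) f) \<le> ?K * sqrt (\<Sum>e\<in>F. (cmod (c e))\<^sup>2)" .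
    qed
    then show ?thesis using K0 by simp
  qed
  then have "(\<Sum>f\<in>F'. \<Sum>e\<in>F. (cmod (cinner (hs_op T (Q e)) f))\<^sup>2)
      \<le> (\<Sum>f\<in>F'. infsum (?k f) hilbert_basis)" by (rule sum_mono)
  also have "\<dots> \<le> (norm T)\<^sup>2"
  proof (rule has_sum_mono)
    show "((\<lambda>e. \<Sum>f\<in>F'. ?k f e) has_sum (\<Sum>f\<in>F'. infsum (?k f) hilbert_basis)) hilbert_basis"
      by (intro has_sum_finite_sum F' has_sum_infsum sm)
    show "(\<Sum>f\<in>F'. ?k f e) \<le> (norm (hs_op T e))\<^sup>2" for e by (rule bessel_hilbert_basis[OF F'])
  qed (rule hs_norm_has_sum)
  finally show "(\<Sum>f\<in>F'. \<Sum>e\<in>F. (cmod (cinner (hs_op T (Q e)) f))\<^sup>2) \<le> (norm T)\<^sup>2" .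
qed

definition hs_sandwich :: "('a::chilbert_space \<Rightarrow> 'a) \<Rightarrow> ('a \<Rightarrow> 'a) \<Rightarrow> 'a hs \<Rightarrow> 'a hs"
  where "hs_sandwich P Q T = Abs_hs (\<lambda>x. P (hs_op T (Q x)))"

definition rank_one :: "'a::chilbert_space \<Rightarrow> 'a \<Rightarrow> 'a hs"
  where "rank_one u v = Abs_hs (\<lambda>x. scaleC (cinner x v) u)"

lemma
  assumes P: "bounded_clinear P" "\<And>x. norm (P x) \<le> norm x"
    and Q: "bounded_clinear Q" "\<And>x. norm (Q x) \<le> norm x"
  shows hs_op_sandwich: "hs_op (hs_sandwich P Q T) x = P (hs_op T (Q x))"
    and norm_sandwich_le: "norm (hs_sandwich P Q T) \<le> norm T"
    and bounded_clinear_sandwich: "bounded_clinear (hs_sandwich P Q)"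
proof -
  have le: "(\<Sum>e\<in>F. (norm (P (hs_op T (Q e))))\<^sup>2) \<le> (norm T)\<^sup>2"
    if "finite F" "F \<subseteq> hilbert_basis" for F T
    by (rule order_trans[OF sum_mono hs_right_compose_le[OF Q that]]) (auto intro: power_mono P(2))
  have "hilbert_schmidt (\<lambda>x. P (hs_op T (Q x)))" for T
    by (rule hilbert_schmidtI[OF bounded_clinear_compose[OF P(1)
          bounded_clinear_compose[OF bounded_clinear_hs_op Q(1)]] le])
  then have op: "hs_op (hs_sandwich P Q T) = (\<lambda>x. P (hs_op T (Q x)))" for T
    by (simp add: hs_sandwich_def Abs_hs_inverse)
  then show "hs_op (hs_sandwich P Q T) x = P (hs_op T (Q x))" by simp
  show n: "norm (hs_sandwich P Q T) \<le> norm T" for T by (rule hs_norm_le) (simp_all add: op le)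
  show "bounded_clinear (hs_sandwich P Q)"
    by (rule bounded_clinearI[where K = 1])
      (auto simp: hs_op_inject[symmetric] op plus_hs.rep_eq scaleC_hs.rep_eq fun_eq_iff n
        bounded_clinear_apply_add[OF P(1)] bounded_clinear_apply_scaleC[OF P(1)])
qed

lemma hs_eqI: "(\<And>x. hs_op S x = hs_op T x) \<Longrightarrow> S = T"
  by (metis ext hs_op_inject)

lemma hs_op_sum: "hs_op (sum f A) x = (\<Sum>a\<in>A. hs_op (f a) x)"
  by (induction A rule: infinite_finite_induct) (auto simp: zero_hs.rep_eq plus_hs.rep_eq)

lemma
  shows hs_op_rank_one: "hs_op (rank_one u v) x = scaleC (cinner x v) u"
    and norm_rank_one: "norm (rank_one u v) = norm u * norm v"
proof -
  have bc: "bounded_clinear (\<lambda>x. scaleC (cinner x v) u)"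
    by (rule bounded_clinearI[where K = "norm v * norm u"])
      (auto simp: cinner_add_left cinner_scaleC_left scaleC_add_left scaleC_scaleC norm_scaleC
        mult.assoc[symmetric] intro!: mult_right_mono norm_cinner_le)
  have le: "(\<Sum>e\<in>F. (norm (scaleC (cinner e v) u))\<^sup>2) \<le> (norm v)\<^sup>2 * (norm u)\<^sup>2"
    if "finite F" "F \<subseteq> hilbert_basis" for F
  proof -
    have "cmod (cinner e v) = cmod (cinner v e)" for e by (subst cinner_commute) simp
    then show ?thesis using bessel_hilbert_basis[OF that, of v]
      by (simp add: norm_scaleC power_mult_distrib sum_distrib_right[symmetric] mult_right_mono)
  qed
  have op: "hs_op (rank_one u v) = (\<lambda>x. scaleC (cinner x v) u)"
    using hilbert_schmidtI[OF bc le] by (simp add: rank_one_def Abs_hs_inverse)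
  then show "hs_op (rank_one u v) x = scaleC (cinner x v) u" by simp
  have "((\<lambda>e. (norm u)\<^sup>2 * (cmod (cinner v e))\<^sup>2) has_sum ((norm u)\<^sup>2 * (norm v)\<^sup>2)) hilbert_basis"
    by (intro has_sum_cmult_right parseval)
  moreover have "(norm u)\<^sup>2 * (cmod (cinner v e))\<^sup>2 = (norm (hs_op (rank_one u v) e))\<^sup>2" for e
    by (subst cinner_commute) (simp add: op norm_scaleC power_mult_distrib mult.commute)
  ultimately have "((\<lambda>e. (norm (hs_op (rank_one u v) e))\<^sup>2) has_sum ((norm u)\<^sup>2 * (norm v)\<^sup>2)) hilbert_basis"
    by simp
  then have "(norm (rank_one u v))\<^sup>2 = (norm u)\<^sup>2 * (norm v)\<^sup>2"
    using has_sum_unique hs_norm_has_sum by blast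
  then have "(norm (rank_one u v))\<^sup>2 = (norm u * norm v)\<^sup>2" by (simp add: power_mult_distrib)
  then show "norm (rank_one u v) = norm u * norm v" by (simp add: power2_eq_iff_nonneg)
qed

text \<open>Truncation to finitely many basis vectors; the squared error is a tail of the series for
  the squared norm.\<close>

lemma hs_rank_one_approx:
  fixes T :: "'a::chilbert_space hs"
  assumes e: "0 < e"
  obtains F where "finite F" "norm (T - (\<Sum>e\<in>F. rank_one (hs_op T e) e)) \<le> e"
proof -
  have "\<forall>\<^sub>F F in finite_subsets_at_top hilbert_basis. dist (\<Sum>e\<in>F. (norm (hs_op T e))\<^sup>2) ((norm T)\<^sup>2) < e\<^sup>2"
    by (rule tendstoD[OF hs_norm_has_sum[unfolded has_sum_def]]) (use e in simp)
  then obtain F where F: "finite F" "F \<subseteq> hilbert_basis"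
    "dist (\<Sum>e\<in>F. (norm (hs_op T e))\<^sup>2) ((norm T)\<^sup>2) < e\<^sup>2"
    unfolding eventually_finite_subsets_at_top by blast
  define S where "S = (\<Sum>e\<in>F. rank_one (hs_op T e) e)"
  have basis: "hs_op (T - S) e = (if e \<in> F then 0 else hs_op T e)" if e: "e \<in> hilbert_basis" for e
  proof -
    have "hs_op S e = (\<Sum>e'\<in>F. if e' = e then hs_op T e else 0)"
      unfolding S_def hs_op_sum hs_op_rank_one
      using F(2) e orthonormal_hilbert_basis
      by (intro sum.cong refl) (auto simp: orthonormal_def cinner_self scaleC_one complex_vector.scale_zero_left)
    then show ?thesis using F(1) by (simp add: hs_op_diff)
  qed
  have "norm (T - S) \<le> e"
  proof (rule hs_norm_le)
    fix G :: "'a set" assume G: "finite G" "G \<subseteq> hilbert_basis"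
    have "(\<Sum>e\<in>G. (norm (hs_op (T - S) e))\<^sup>2) = (\<Sum>e\<in>G - F. (norm (hs_op T e))\<^sup>2)"
      using G by (intro sum.mono_neutral_cong_right) (auto simp: basis)
    also have "\<dots> = (\<Sum>e\<in>G \<union> F. (norm (hs_op T e))\<^sup>2) - (\<Sum>e\<in>F. (norm (hs_op T e))\<^sup>2)"
      using G F(1) by (subst sum_diff[symmetric]) (auto intro: sum.cong)
    also have "\<dots> \<le> (norm T)\<^sup>2 - (\<Sum>e\<in>F. (norm (hs_op T e))\<^sup>2)"
      using G F by (intro diff_right_mono hs_sum_le) auto
    also have "\<dots> \<le> e\<^sup>2" using F(3) by (simp add: dist_real_def)
    finally show "(\<Sum>e\<in>G. (norm (hs_op (T - S) e))\<^sup>2) \<le> e\<^sup>2" .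
  qed (use e in simp)
  then show ?thesis using that F(1) by (simp add: S_def)
qed

lemma eq_on_rank_one:
  fixes A B :: "'a::chilbert_space hs \<Rightarrow> 'b::chilbert_space"
  assumes A: "bounded_clinear A" and B: "bounded_clinear B"
    and eq: "\<And>u v. A (rank_one u v) = B (rank_one u v)"
  shows "A = B"
proof
  fix T
  define D where "D T = A T - B T" for T
  have D: "bounded_clinear D" unfolding D_def by (rule bounded_clinear_diff[OF A B])
  have "norm (D T) \<le> onorm D * e" if e: "0 < e" for e
  proof -
    obtain F where F: "norm (T - (\<Sum>e\<in>F. rank_one (hs_op T e) e)) \<le> e"
      using hs_rank_one_approx[OF e] by blast
    define S where "S = (\<Sum>e\<in>F. rank_one (hs_op T e) e)"
    have "norm (T - S) \<le> e" using F by (simp add: S_def)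
    moreover have "D S = 0" by (simp add: S_def bounded_clinear_apply_sum[OF D]) (simp add: D_def eq)
    then have "D T = D (T - S)" by (simp add: bounded_clinear_apply_diff[OF D])
    ultimately show ?thesis
      using norm_le_onorm[OF D, of "T - S"] mult_left_mono[of "norm (T - S)" e "onorm D"] onorm_nonneg[OF D]
      by simp
  qed
  then have le: "norm (D T) \<le> onorm D * e" if "0 < e" for e using that .
  have "norm (D T) \<le> 0"
  proof (rule field_le_epsilon)
    fix e :: real assume e: "0 < e"
    have "onorm D * (e / (onorm D + 1)) \<le> e"
      using e onorm_nonneg[OF D] by (simp add: divide_le_eq algebra_simps)
    then show "norm (D T) \<le> 0 + e"
      using le[of "e / (onorm D + 1)"] e onorm_nonneg[OF D] by (simp add: add_nonneg_pos)
  qed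
  then show "A T = B T" by (simp add: D_def)
qed

section \<open>The product spectral measure\<close>

lemma projection_pythagoras:
  assumes "orthogonal_projection P"
  shows "(norm x)\<^sup>2 = (norm (P x))\<^sup>2 + (norm (x - P x))\<^sup>2"
proof -
  have "cinner (P x) (x - P x) = 0"
    using orthogonal_projectionD(3)[OF assms, of x "x - P x"] orthogonal_projectionD(1,2)[OF assms]
    by (simp add: bounded_clinear_apply_diff)
  then have "inner (P x) (x - P x) = 0" by (simp add: inner_eq_Re_cinner)
  then have "(norm (P x + (x - P x)))\<^sup>2 = (norm (P x))\<^sup>2 + (norm (x - P x))\<^sup>2"
    by (simp only: norm_add_Pythagorean orthogonal_def)
  then show ?thesis by simp
qed

lemma projection_complement:
  assumes "orthogonal_projection P" shows "orthogonal_projection (\<lambda>x. x - P x)"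
proof (rule orthogonal_projectionI_contraction)
  note bc = orthogonal_projectionD(1)[OF assms]
  show "bounded_clinear (\<lambda>x. x - P x)" by (rule bounded_clinear_diff[OF bounded_clinear_ident bc])
  show "(x - P x) - P (x - P x) = x - P x" for x
    by (simp add: bounded_clinear_apply_diff[OF bc] orthogonal_projectionD(2)[OF assms])
  show "norm (x - P x) \<le> norm x" for x
    using projection_pythagoras[OF assms, of x] by (simp add: power2_le_imp_le)
qed

locale spectral_pair =
  fixes E1 E2 :: "real set \<Rightarrow> 'a::chilbert_space \<Rightarrow> 'a"
  assumes E1: "spectral_measure borel E1" and E2: "spectral_measure borel E2"
begin

definition rect :: "real set \<Rightarrow> real set \<Rightarrow> 'a hs \<Rightarrow> 'a hs"
  where "rect A B = hs_sandwich (E1 A) (E2 B)"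

lemma proj: "A \<in> sets borel \<Longrightarrow> orthogonal_projection (E1 A)"
  "B \<in> sets borel \<Longrightarrow> orthogonal_projection (E2 B)"
  using spectral_measureD(1)[OF E1] spectral_measureD(1)[OF E2] by auto

lemma
  assumes "A \<in> sets borel" "B \<in> sets borel"
  shows hs_op_rect: "hs_op (rect A B T) x = E1 A (hs_op T (E2 B x))"
    and norm_rect_le: "norm (rect A B T) \<le> norm T"
    and bounded_clinear_rect: "bounded_clinear (rect A B)"
  unfolding rect_def
  by (intro hs_op_sandwich norm_sandwich_le bounded_clinear_sandwich
      projection_norm_le orthogonal_projectionD(1) proj assms)+

lemma rect_rect:
  assumes "A \<in> sets borel" "B \<in> sets borel" "A' \<in> sets borel" "B' \<in> sets borel"
  shows "rect A B (rect A' B' T) = rect (A \<inter> A') (B \<inter> B') T"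
  by (rule hs_eqI)
    (simp add: hs_op_rect assms sets.Int spectral_measure_Int[OF E1] spectral_measure_Int[OF E2] Int_commute)

lemma projection_rect:
  assumes "A \<in> sets borel" "B \<in> sets borel" shows "orthogonal_projection (rect A B)"
  by (rule orthogonal_projectionI_contraction)
    (simp_all add: assms bounded_clinear_rect norm_rect_le rect_rect)

lemma rect_empty:
  assumes "A \<in> sets borel" "B \<in> sets borel" "A \<times> B = {}" shows "rect A B T = 0"
proof -
  have "A = {} \<or> B = {}" using assms(3) by auto
  then show ?thesis
    by (intro hs_eqI) (auto simp: hs_op_rect assms spectral_measure_empty[OF E1]
        spectral_measure_empty[OF E2] zero_hs.rep_eq bounded_clinear_apply_zero[OF bounded_clinear_hs_op]
        bounded_clinear_apply_zero[OF orthogonal_projectionD(1)[OF proj(1)]])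
qed

lemma rect_UNIV: "rect UNIV UNIV T = T"
  using spectral_measureD(2)[OF E1] spectral_measureD(2)[OF E2]
  by (intro hs_eqI) (simp add: hs_op_rect)

lemma rect_rank_one:
  assumes "A \<in> sets borel" "B \<in> sets borel"
  shows "rect A B (rank_one u v) = rank_one (E1 A u) (E2 B v)"
  by (rule hs_eqI)
    (simp add: hs_op_rect hs_op_rank_one assms orthogonal_projectionD(3)[OF proj(2)]
      bounded_clinear_apply_scaleC[OF orthogonal_projectionD(1)[OF proj(1)]])

text \<open>On rank one operators countable additivity is that of the product of two scalar measures;
  rank one operators span a dense subspace.\<close>

lemma rect_sums:
  assumes A: "\<And>n::nat. A n \<in> sets borel" and B: "\<And>n. B n \<in> sets borel"
    and A0: "A0 \<in> sets borel" and B0: "B0 \<in> sets borel"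
    and disj: "disjoint_family (\<lambda>n. A n \<times> B n)" and un: "(\<Union>n. A n \<times> B n) = A0 \<times> B0"
  shows "(\<lambda>n. (norm (rect (A n) (B n) T))\<^sup>2) sums (norm (rect A0 B0 T))\<^sup>2"
proof -
  have zero: "rect (A m) (B m) (rect (A n) (B n) S) = 0" if "m \<noteq> n" for m n S
  proof -
    have "(A m \<inter> A n) \<times> (B m \<inter> B n) = {}"
      using disjoint_family_onD[OF disj _ _ that] by (simp add: Times_Int_Times)
    then show ?thesis by (simp add: rect_rect A B sets.Int rect_empty)
  qed
  obtain Q where Q: "orthogonal_projection Q" "\<And>S. (\<lambda>n. rect (A n) (B n) S) sums Q S"
    "\<And>S. (\<lambda>n. (norm (rect (A n) (B n) S))\<^sup>2) sums (norm (Q S))\<^sup>2"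
    using sum_projections[of "\<lambda>n. rect (A n) (B n)", OF projection_rect[OF A B] zero] by blast
  note R = projection_rect[OF A0 B0]
  \<comment> \<open>\<open>Q\<close> is dominated by the projection of the union; hence equality of
    the two norms at a vector already gives equality of the two images.\<close>
  have Q_rect: "Q (rect A0 B0 S) = Q S" for S
  proof (rule sums_unique2[OF Q(2)])
    have "rect (A n) (B n) (rect A0 B0 S) = rect (A n) (B n) S" for n
    proof (cases "A n \<times> B n = {}")
      case True
      then have "(A n \<inter> A0) \<times> (B n \<inter> B0) = {}" by auto
      then show ?thesis using True by (simp add: rect_rect A B A0 B0 sets.Int rect_empty)
    next
      case False
      then have "A n \<inter> A0 = A n" "B n \<inter> B0 = B n" using un by auto
      then show ?thesis by (simp add: rect_rect A B A0 B0)
    qed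
    then show "(\<lambda>n. rect (A n) (B n) (rect A0 B0 S)) sums Q S" using Q(2)[of S] by simp
  qed
  have "rect A0 B0 = Q"
  proof (rule eq_on_rank_one[OF orthogonal_projectionD(1)[OF R] orthogonal_projectionD(1)[OF Q(1)]])
    fix u v
    let ?t = "rank_one u v" and ?\<mu> = "spectral_scalar_measure borel E1 u"
      and ?\<nu> = "spectral_scalar_measure borel E2 v"
    interpret \<nu>: finite_measure ?\<nu> by (rule finite_spectral_scalar_measure[OF E2])
    have prod: "emeasure (?\<mu> \<Otimes>\<^sub>M ?\<nu>) (A' \<times> B') = ennreal ((norm (rect A' B' ?t))\<^sup>2)"
      if "A' \<in> sets borel" "B' \<in> sets borel" for A' B'
      using that by (simp add: \<nu>.emeasure_pair_measure_Times rect_rank_one norm_rank_one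
          emeasure_spectral_scalar_measure[OF E1] emeasure_spectral_scalar_measure[OF E2]
          ennreal_mult power_mult_distrib)
    have "ennreal ((norm (Q ?t))\<^sup>2) = (\<Sum>n. ennreal ((norm (rect (A n) (B n) ?t))\<^sup>2))"
      using Q(3) by (intro suminf_ennreal_eq[symmetric]) auto
    also have "\<dots> = (\<Sum>n. emeasure (?\<mu> \<Otimes>\<^sub>M ?\<nu>) (A n \<times> B n))" by (simp add: prod A B)
    also have "\<dots> = emeasure (?\<mu> \<Otimes>\<^sub>M ?\<nu>) (\<Union>n. A n \<times> B n)"
      using A B disj by (intro suminf_emeasure) (auto intro!: pair_measureI)
    also have "\<dots> = ennreal ((norm (rect A0 B0 ?t))\<^sup>2)" by (simp only: un prod A0 B0)
    finally have "(norm (Q ?t))\<^sup>2 = (norm (rect A0 B0 ?t))\<^sup>2" by simp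
    moreover have "(norm (rect A0 B0 ?t))\<^sup>2 = (norm (Q ?t))\<^sup>2 + (norm (rect A0 B0 ?t - Q ?t))\<^sup>2"
      using projection_pythagoras[OF Q(1), of "rect A0 B0 ?t"] by (simp add: Q_rect)
    ultimately show "rect A0 B0 ?t = Q ?t" by simp
  qed
  then show ?thesis using Q(3) by simp
qed

text \<open>For a fixed \<open>T\<close> the squared norms form a premeasure on the semiring of
  rectangles, by \<open>rect_sums\<close>, and Caratheodory's theorem extends it to the Borel sets
  of the plane. The operators are recovered only afterwards, from these scalar measures.\<close>

lemma rect_measure:
  obtains M :: "(real \<times> real) measure" where "sets M = sets borel"
    "\<And>A B. A \<in> sets borel \<Longrightarrow> B \<in> sets borel \<Longrightarrow> emeasure M (A \<times> B) = ennreal ((norm (rect A B T))\<^sup>2)"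
proof -
  define R where "R = {A \<times> B | (A :: real set) (B :: real set). A \<in> sets borel \<and> B \<in> sets borel}"
  interpret semiring_of_sets UNIV R
  proof
    show "R \<subseteq> Pow UNIV" by simp
    show "{} \<in> R" by (auto simp: R_def intro!: exI[of _ "{}"])
  next
    fix a b assume "a \<in> R" "b \<in> R"
    then obtain A B A' B' where ab: "a = A \<times> B" "b = A' \<times> B'" and s: "A \<in> sets borel" "B \<in> sets borel"
      "A' \<in> sets borel" "B' \<in> sets borel" by (auto simp: R_def)
    show "a \<inter> b \<in> R" unfolding ab Times_Int_Times using s sets.Int by (auto simp: R_def)
    have "disjoint {(A - A') \<times> B, (A \<inter> A') \<times> (B - B')}" by (auto simp: disjoint_def)
    moreover have "a - b = \<Union>{(A - A') \<times> B, (A \<inter> A') \<times> (B - B')}" by (auto simp: ab)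
    moreover have "{(A - A') \<times> B, (A \<inter> A') \<times> (B - B')} \<subseteq> R" using s sets.Int sets.Diff by (auto simp: R_def)
    ultimately show "\<exists>C\<subseteq>R. finite C \<and> disjoint C \<and> a - b = \<Union> C"
      by (intro exI[of _ "{(A - A') \<times> B, (A \<inter> A') \<times> (B - B')}"]) auto
  qed
  \<comment> \<open>A nonempty rectangle is recovered from its two projections. An empty one
    determines only one of its sides to be empty, but the value is 0 in every
    representation.\<close>
  define m where "m r = ennreal ((norm (rect (fst ` r) (snd ` r) T))\<^sup>2)" for r :: "(real \<times> real) set"
  have m: "m (A \<times> B) = ennreal ((norm (rect A B T))\<^sup>2)" if "A \<in> sets borel" "B \<in> sets borel" for A B
  proof (cases "A \<times> B = {}")
    case True
    then show ?thesis using rect_empty[OF that, of T] rect_empty[of "{}" "{}" T] by (simp add: m_def)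
  next
    case False
    then show ?thesis by (auto simp: m_def fst_image_times snd_image_times)
  qed
  have "\<exists>\<mu>'. (\<forall>s\<in>R. \<mu>' s = m s) \<and> measure_space UNIV (sigma_sets UNIV R) \<mu>'"
  proof (rule caratheodory)
    show "positive R m" using rect_empty[of "{}" "{}" T] by (simp add: positive_def m_def)
    show "countably_additive R m"
    proof (rule countably_additiveI)
      fix F :: "nat \<Rightarrow> _" assume F: "range F \<subseteq> R" "disjoint_family F" "(\<Union>i. F i) \<in> R"
      have "\<forall>n. \<exists>A B. F n = A \<times> B \<and> A \<in> sets borel \<and> B \<in> sets borel" using F(1) unfolding R_def by (force simp: image_subset_iff)
      then obtain A B where AB: "\<And>n. F n = A n \<times> B n" "\<And>n. A n \<in> sets borel" "\<And>n. B n \<in> sets borel"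
        by metis
      obtain A0 B0 where AB0: "(\<Union>i. F i) = A0 \<times> B0" "A0 \<in> sets borel" "B0 \<in> sets borel"
        using F(3) by (auto simp: R_def)
      have "F = (\<lambda>n. A n \<times> B n)" using AB(1) by auto
      then have "(\<lambda>n. (norm (rect (A n) (B n) T))\<^sup>2) sums (norm (rect A0 B0 T))\<^sup>2"
        using F(2) AB0(1) by (intro rect_sums AB AB0) auto
      then have "(\<Sum>n. ennreal ((norm (rect (A n) (B n) T))\<^sup>2)) = ennreal ((norm (rect A0 B0 T))\<^sup>2)"
        by (intro suminf_ennreal_eq) auto
      then show "(\<Sum>i. m (F i)) = m (\<Union>i. F i)" unfolding AB0(1) m[OF AB0(2,3)] unfolding AB(1) m[OF AB(2,3)] .
    qed
  qed
  then obtain \<mu> where \<mu>: "\<And>s. s \<in> R \<Longrightarrow> \<mu> s = m s" "measure_space UNIV (sigma_sets UNIV R) \<mu>"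
    by blast
  have R_borel: "sigma_sets UNIV R = sets (borel :: (real \<times> real) measure)"
    unfolding borel_prod[symmetric] sets_pair_measure by (simp add: R_def)
  let ?M = "measure_of UNIV (sigma_sets UNIV R) \<mu>"
  have "emeasure ?M r = \<mu> r" if "r \<in> sigma_sets UNIV R" for r
    using \<mu>(2) that by (intro emeasure_measure_of_sigma) (auto simp: measure_space_def)
  moreover have "A \<times> B \<in> R" if "A \<in> sets borel" "B \<in> sets borel" for A B using that by (auto simp: R_def)
  moreover have "sets ?M = sets borel" by (simp add: R_borel[symmetric] sigma_sets_sigma_sets_eq)
  ultimately show ?thesis using that[of ?M] \<mu>(1) m by (metis sigma_sets.Basic)
qed

text \<open>Sets \<open>G\<close> for which all values \<open>emeasure (M T) G\<close> are the
  squared norms of one projection at \<open>T\<close> form a Dynkin system containing the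
  rectangles. A projection is determined by its norms, so the projections found in this way agree
  with \<open>rect\<close> on rectangles and are countably additive.\<close>

lemma product_spectral_measure_exists:
  "\<exists>\<E>. spectral_measure borel \<E> \<and>
    (\<forall>A\<in>sets borel. \<forall>B\<in>sets borel. \<forall>T. hs_op (\<E> (A \<times> B) T) = E1 A \<circ> hs_op T \<circ> E2 B)"
proof -
  have "\<forall>T. \<exists>M. sets M = sets borel \<and> (\<forall>A\<in>sets borel. \<forall>B\<in>sets borel.
    emeasure M (A \<times> B) = ennreal ((norm (rect A B T))\<^sup>2))"
    using rect_measure by metis
  then obtain M where M: "\<And>T. sets (M T) = sets (borel :: (real \<times> real) measure)"
    "\<And>T A B. A \<in> sets borel \<Longrightarrow> B \<in> sets borel \<Longrightarrow> emeasure (M T) (A \<times> B) = ennreal ((norm (rect A B T))\<^sup>2)"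
    by metis
  have UNIV: "emeasure (M T) UNIV = ennreal ((norm T)\<^sup>2)" for T
    using M(2)[of UNIV UNIV T] by (simp add: rect_UNIV)
  have space: "space (M T) = UNIV" for T using sets_eq_imp_space_eq[OF M(1)] by simp
  define good where "good G P \<longleftrightarrow> orthogonal_projection P \<and> (\<forall>T. emeasure (M T) G = ennreal ((norm (P T))\<^sup>2))" for G P
  have union_good: "\<exists>Q. good (\<Union>n. F n) Q \<and> (\<forall>T. (\<lambda>n. P n T) sums Q T)"
    if F: "range F \<subseteq> sets borel" "disjoint_family F" and P: "\<And>n::nat. good (F n) (P n)" for F P
  proof -
    have zero: "P m (P n T) = 0" if "m \<noteq> n" for m n T
    proof (rule projection_prod_zero[where P = "P m" and Q = "P n"])
      fix S
      have "ennreal ((norm (P m S))\<^sup>2 + (norm (P n S))\<^sup>2) = emeasure (M S) (F m) + emeasure (M S) (F n)"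
        using P by (simp add: good_def ennreal_plus)
      also have "\<dots> = emeasure (M S) (F m \<union> F n)"
        using F that by (intro plus_emeasure) (auto simp: M(1) disjoint_family_on_def)
      also have "\<dots> \<le> emeasure (M S) UNIV"
        by (rule emeasure_mono) (simp_all add: M(1))
      finally show "(norm (P m S))\<^sup>2 + (norm (P n S))\<^sup>2 \<le> (norm S)\<^sup>2" by (simp add: UNIV ennreal_plus[symmetric] del: ennreal_plus)
    qed (use P in \<open>auto simp: good_def\<close>)
    have "orthogonal_projection (P n)" for n using P by (simp add: good_def)
    then obtain Q where Q: "orthogonal_projection Q" "\<And>S. (\<lambda>n. P n S) sums Q S"
      "\<And>S. (\<lambda>n. (norm (P n S))\<^sup>2) sums (norm (Q S))\<^sup>2"
      using sum_projections[of P, OF _ zero] by blast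
    have "emeasure (M S) (\<Union>n. F n) = ennreal ((norm (Q S))\<^sup>2)" for S
    proof -
      have "emeasure (M S) (\<Union>n. F n) = (\<Sum>n. emeasure (M S) (F n))"
        using F by (intro suminf_emeasure[symmetric]) (auto simp: M(1))
      also have "\<dots> = (\<Sum>n. ennreal ((norm (P n S))\<^sup>2))" using P by (simp add: good_def)
      also have "\<dots> = ennreal ((norm (Q S))\<^sup>2)" using Q(3) by (intro suminf_ennreal_eq) auto
      finally show ?thesis .
    qed
    then show ?thesis using Q by (intro exI[of _ Q]) (simp add: good_def)
  qed
  define R where "R = {A \<times> B | (A :: real set) (B :: real set). A \<in> sets borel \<and> B \<in> sets borel}"
  have R_borel: "sigma_sets UNIV R = sets (borel :: (real \<times> real) measure)"
    unfolding borel_prod[symmetric] sets_pair_measure by (simp add: R_def)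
  have ex: "\<exists>P. good G P" if "G \<in> sets borel" for G
  proof -
    have "Int_stable R" unfolding Int_stable_def R_def
      by (auto simp: Times_Int_Times) (metis sets.Int)
    moreover have "R \<subseteq> Pow UNIV" by simp
    moreover have "G \<in> sigma_sets UNIV R" using that R_borel by simp
    ultimately show ?thesis
    proof (induction rule: sigma_sets_induct_disjoint)
      case (basic G)
      then obtain A B where "G = A \<times> B" "A \<in> sets borel" "B \<in> sets borel" by (auto simp: R_def)
      then show ?case using M(2) projection_rect by (intro exI[of _ "rect A B"]) (simp add: good_def)
    next
      case empty
      have "orthogonal_projection (\<lambda>_ :: 'a hs. 0 :: 'a hs)" by (simp add: orthogonal_projection_def)
      then show ?case by (intro exI[of _ "\<lambda>_. 0"]) (simp add: good_def)
    next
      case (compl G)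
      then obtain P where P: "good G P" by blast
      have "emeasure (M T) (UNIV - G) = ennreal ((norm (T - P T))\<^sup>2)" for T
      proof -
        have "emeasure (M T) (UNIV - G) = emeasure (M T) UNIV - emeasure (M T) G"
          using compl(1) P by (intro emeasure_Diff) (auto simp: M(1) R_borel good_def)
        also have "\<dots> = ennreal ((norm T)\<^sup>2 - (norm (P T))\<^sup>2)"
          using P by (simp add: UNIV good_def ennreal_minus)
        finally show ?thesis using projection_pythagoras[of P T] P by (simp add: good_def)
      qed
      then show ?case using P projection_complement[of P]
        by (intro exI[of _ "\<lambda>T. T - P T"]) (simp add: good_def)
    next
      case (union F)
      then obtain P where "\<And>n. good (F n) (P n)" by metis
      then show ?case using union_good[of F P] union(1,2) R_borel by auto
    qed
  qed
  then obtain \<E> where \<E>: "\<And>G. G \<in> sets borel \<Longrightarrow> good G (\<E> G)" by metis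
  have unique: "P = Q" if "good G P" "good G Q" for G P Q
  proof (rule projection_eqI)
    fix T
    have "ennreal ((norm (P T))\<^sup>2) = ennreal ((norm (Q T))\<^sup>2)" using that by (metis good_def)
    then show "norm (P T) = norm (Q T)" by (simp add: power2_eq_iff_nonneg)
  qed (use that in \<open>auto simp: good_def\<close>)
  have rect: "\<E> (A \<times> B) = rect A B" if "A \<in> sets borel" "B \<in> sets borel" for A B
  proof (rule unique)
    show "good (A \<times> B) (\<E> (A \<times> B))" using that by (intro \<E>) (simp add: borel_Times)
    show "good (A \<times> B) (rect A B)" using that M(2) projection_rect by (simp add: good_def)
  qed
  have "spectral_measure borel \<E>"
    unfolding spectral_measure_def
  proof (intro conjI ballI allI impI)
    show "\<E> (space borel) = id" using rect[of UNIV UNIV] by (auto simp: rect_UNIV)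
  next
    fix F :: "nat \<Rightarrow> (real \<times> real) set" and T assume F: "range F \<subseteq> sets borel" "disjoint_family F"
    then obtain Q where "good (\<Union>n. F n) Q" "\<And>T. (\<lambda>n. \<E> (F n) T) sums Q T"
      using union_good[of F "\<lambda>n. \<E> (F n)"] \<E> by blast
    moreover have "good (\<Union>n. F n) (\<E> (\<Union>n. F n))" using F by (intro \<E>) auto
    ultimately show "(\<lambda>n. \<E> (F n) T) sums \<E> (\<Union>n. F n) T" using unique by metis
  qed (use \<E> in \<open>auto simp: good_def\<close>)
  then show ?thesis using rect by (intro exI[of _ \<E>]) (auto simp: hs_op_rect fun_eq_iff)
qed

lemma
  shows spectral_measure_product: "spectral_measure borel (product_spectral_measure E1 E2)"
    and product_spectral_measure_Times: "A \<in> sets borel \<Longrightarrow> B \<in> sets borel \<Longrightarrow>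
      hs_op (product_spectral_measure E1 E2 (A \<times> B) T) = E1 A \<circ> hs_op T \<circ> E2 B"
  using someI_ex[OF product_spectral_measure_exists] unfolding product_spectral_measure_def by auto

end

section \<open>Double operator integrals as limits of finite sums\<close>

lemma has_bochner_integral_simple:
  assumes E: "spectral_measure M E" and K: "finite K" and A: "\<And>k. k \<in> K \<Longrightarrow> A k \<in> sets M"
  shows "has_bochner_integral (spectral_scalar_measure M E x) (\<lambda>y. \<Sum>k\<in>K. indicator (A k) y *\<^sub>R c k)
    (\<Sum>k\<in>K. c k * cinner (E (A k) x) x)"
proof -
  let ?\<mu> = "spectral_scalar_measure M E x"
  interpret finite_measure ?\<mu> by (rule finite_spectral_scalar_measure[OF E])
  have "has_bochner_integral ?\<mu> (\<lambda>y. \<Sum>k\<in>K. indicator (A k) y *\<^sub>R c k) (\<Sum>k\<in>K. measure ?\<mu> (A k) *\<^sub>R c k)"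
    using A by (intro has_bochner_integral_sum has_bochner_integral_indicator)
      (auto simp: emeasure_eq_measure)
  moreover have "measure ?\<mu> (A k) *\<^sub>R c k = c k * cinner (E (A k) x) x" if "k \<in> K" for k
    using A[OF that] projection_cinner[OF spectral_measureD(1)[OF E A[OF that]], of x]
    by (simp add: measure_spectral_scalar_measure[OF E] scaleR_conv_of_real mult.commute)
  ultimately show ?thesis by (simp cong: sum.cong)
qed

text \<open>Isometry of the integral on simple functions: \<open>cinner (E A x) (E B x)\<close> is
  the mass of \<open>A \<inter> B\<close>.\<close>

lemma has_bochner_integral_simple_product:
  assumes E: "spectral_measure M E" and K: "finite K" "\<And>k. k \<in> K \<Longrightarrow> A k \<in> sets M"
    and K': "finite K'" "\<And>k. k \<in> K' \<Longrightarrow> A' k \<in> sets M"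
  shows "has_bochner_integral (spectral_scalar_measure M E x)
    (\<lambda>y. (\<Sum>k\<in>K. indicator (A k) y *\<^sub>R c k) * cnj (\<Sum>k\<in>K'. indicator (A' k) y *\<^sub>R c' k))
    (cinner (\<Sum>k\<in>K. scaleC (c k) (E (A k) x)) (\<Sum>k\<in>K'. scaleC (c' k) (E (A' k) x)))"
proof -
  let ?\<mu> = "spectral_scalar_measure M E x"
  have "has_bochner_integral ?\<mu>
      (\<lambda>y. \<Sum>p\<in>K \<times> K'. indicator (A (fst p) \<inter> A' (snd p)) y *\<^sub>R (c (fst p) * cnj (c' (snd p))))
      (\<Sum>p\<in>K \<times> K'. c (fst p) * cnj (c' (snd p)) * cinner (E (A (fst p) \<inter> A' (snd p)) x) x)"
    using K K' by (intro has_bochner_integral_simple[OF E]) auto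
  moreover have "(\<Sum>p\<in>K \<times> K'. indicator (A (fst p) \<inter> A' (snd p)) y *\<^sub>R (c (fst p) * cnj (c' (snd p))))
      = (\<Sum>k\<in>K. indicator (A k) y *\<^sub>R c k) * cnj (\<Sum>k\<in>K'. indicator (A' k) y *\<^sub>R c' k)" for y
    unfolding cnj_sum sum_product sum.cartesian_product
    by (intro sum.cong refl) (auto simp: indicator_def split_beta)
  moreover have "(\<Sum>p\<in>K \<times> K'. c (fst p) * cnj (c' (snd p)) * cinner (E (A (fst p) \<inter> A' (snd p)) x) x)
      = cinner (\<Sum>k\<in>K. scaleC (c k) (E (A k) x)) (\<Sum>k\<in>K'. scaleC (c' k) (E (A' k) x))"
    unfolding cinner_sum_left
    unfolding cinner_sum_right sum.cartesian_product
    using K(2) K'(2)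
    by (intro sum.cong refl)
      (auto simp: split_beta cinner_scaleC_left cinner_scaleC_right spectral_measure_cinner[OF E] mult.assoc)
  ultimately show ?thesis by simp
qed

text \<open>The isometry for a difference, expanded into four products so that the two simple
  functions may have unrelated level sets.\<close>

lemma norm_diff_simple:
  assumes E: "spectral_measure M E" and K: "finite K" "\<And>k. k \<in> K \<Longrightarrow> A k \<in> sets M"
    and K': "finite K'" "\<And>k. k \<in> K' \<Longrightarrow> A' k \<in> sets M"
  shows "has_bochner_integral (spectral_scalar_measure M E x)
    (\<lambda>y. (cmod ((\<Sum>k\<in>K. indicator (A k) y *\<^sub>R c k) - (\<Sum>k\<in>K'. indicator (A' k) y *\<^sub>R c' k)))\<^sup>2)
    ((norm ((\<Sum>k\<in>K. scaleC (c k) (E (A k) x)) - (\<Sum>k\<in>K'. scaleC (c' k) (E (A' k) x))))\<^sup>2)"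
proof -
  let ?s = "\<lambda>y. \<Sum>k\<in>K. indicator (A k) y *\<^sub>R c k" and ?s' = "\<lambda>y. \<Sum>k\<in>K'. indicator (A' k) y *\<^sub>R c' k"
  let ?S = "\<Sum>k\<in>K. scaleC (c k) (E (A k) x)" and ?S' = "\<Sum>k\<in>K'. scaleC (c' k) (E (A' k) x)"
  have "has_bochner_integral (spectral_scalar_measure M E x)
      (\<lambda>y. (?s y * cnj (?s y) - ?s y * cnj (?s' y)) - (?s' y * cnj (?s y) - ?s' y * cnj (?s' y)))
      ((cinner ?S ?S - cinner ?S ?S') - (cinner ?S' ?S - cinner ?S' ?S'))"
    by (intro has_bochner_integral_diff has_bochner_integral_simple_product[OF E] K K')
  then have "has_bochner_integral (spectral_scalar_measure M E x)
      (\<lambda>y. Re ((?s y * cnj (?s y) - ?s y * cnj (?s' y)) - (?s' y * cnj (?s y) - ?s' y * cnj (?s' y))))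
      (Re ((cinner ?S ?S - cinner ?S ?S') - (cinner ?S' ?S - cinner ?S' ?S')))"
    by (rule has_bochner_integral_bounded_linear[OF bounded_linear_Re])
  moreover have "Re ((a * cnj a - a * cnj b) - (b * cnj a - b * cnj b)) = (cmod (a - b))\<^sup>2" for a b
  proof -
    have "(a * cnj a - a * cnj b) - (b * cnj a - b * cnj b) = (a - b) * cnj (a - b)"
      by (simp add: algebra_simps)
    then show ?thesis by (simp only: complex_norm_square[symmetric] Re_complex_of_real)
  qed
  moreover have "Re ((cinner a a - cinner a b) - (cinner b a - cinner b b)) = (norm (a - b))\<^sup>2" for a b :: 'b
    by (simp add: power2_norm_cinner[of "a - b"] cinner_diff_left cinner_diff_right)
  ultimately show ?thesis by (simp only:)
qed

text \<open>Dominated convergence makes the simple functions converge in the square mean for every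
  scalar measure, and the isometry turns this into convergence of vectors. The limit operator has
  the quadratic form required by \<open>spectral_integral\<close>, and \<open>polarization\<close>
  shows that it is the only one.\<close>

lemma spectral_integral_tendsto:
  fixes c :: "nat \<Rightarrow> 'i \<Rightarrow> complex" and E :: "'x set \<Rightarrow> 'a::chilbert_space \<Rightarrow> 'a"
    and K :: "nat \<Rightarrow> 'i set" and A :: "nat \<Rightarrow> 'i \<Rightarrow> 'x set"
  defines "s \<equiv> \<lambda>n y. \<Sum>k\<in>K n. indicator (A n k) y *\<^sub>R c n k"
  assumes E: "spectral_measure M E" and K: "\<And>n. finite (K n)" "\<And>n k. k \<in> K n \<Longrightarrow> A n k \<in> sets M"
    and \<Phi>: "\<Phi> \<in> borel_measurable M" "\<And>y. y \<in> space M \<Longrightarrow> (\<lambda>n. s n y) \<longlonglongrightarrow> \<Phi> y"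
    and L: "\<And>n y. y \<in> space M \<Longrightarrow> cmod (s n y) \<le> L"
  shows "(\<lambda>n. \<Sum>k\<in>K n. scaleC (c n k) (E (A n k) x)) \<longlonglongrightarrow> spectral_integral M E \<Phi> x"
proof -
  let ?\<mu> = "spectral_scalar_measure M E"
  define S where "S n x = (\<Sum>k\<in>K n. scaleC (c n k) (E (A n k) x))" for n x
  have fin: "finite_measure (?\<mu> x)" for x by (rule finite_spectral_scalar_measure[OF E])
  have sm [measurable]: "s n \<in> borel_measurable (?\<mu> x)" for n x
    using K unfolding s_def
    by (intro borel_measurable_sum borel_measurable_scaleR borel_measurable_const borel_measurable_indicator) auto
  have \<Phi>m [measurable]: "\<Phi> \<in> borel_measurable (?\<mu> x)" for x
    using \<Phi>(1) by (simp cong: measurable_cong_sets)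
  have \<Phi>L: "cmod (\<Phi> y) \<le> L" if "y \<in> space M" for y
    by (rule LIMSEQ_le_const2[OF tendsto_norm[OF \<Phi>(2)[OF that]]]) (use L[OF that] in auto)
  have norm_S: "(norm (S n x))\<^sup>2 \<le> (L * norm x)\<^sup>2" for n x
  proof -
    interpret finite_measure "?\<mu> x" by (rule fin)
    have hb: "has_bochner_integral (?\<mu> x) (\<lambda>y. (cmod (s n y))\<^sup>2) ((norm (S n x))\<^sup>2)"
      using norm_diff_simple[where K = "K n" and A = "A n" and c = "c n" and K' = "{} :: 'i set" and x = x,
          OF E K(1) K(2)] by (simp add: s_def S_def)
    then have "(norm (S n x))\<^sup>2 = (\<integral>y. (cmod (s n y))\<^sup>2 \<partial>?\<mu> x)" by (simp add: has_bochner_integral_integral_eq)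
    also have "\<dots> \<le> (\<integral>y. L\<^sup>2 \<partial>?\<mu> x)"
      using L by (intro integral_mono integrable.intros[OF hb]) (auto intro: power_mono)
    also have "\<dots> = (L * norm x)\<^sup>2"
      using measure_spectral_scalar_measure[OF E, of "space M" x] spectral_measureD(2)[OF E]
      by (simp add: power_mult_distrib mult.commute)
    finally show ?thesis .
  qed
  define I where "I n x = (\<integral>y. (cmod (s n y - \<Phi> y))\<^sup>2 \<partial>?\<mu> x)" for n x
  have err: "(cmod (s n y - \<Phi> y))\<^sup>2 \<le> (2 * L)\<^sup>2" if "y \<in> space M" for n y
    using norm_triangle_ineq4[of "s n y" "\<Phi> y"] L[OF that, of n] \<Phi>L[OF that]
    by (intro power_mono) auto
  have int_err: "integrable (?\<mu> x) (\<lambda>y. (cmod (s n y - \<Phi> y))\<^sup>2)" for n x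
    using err by (intro finite_measure.integrable_const_bound[OF fin, where B = "(2 * L)\<^sup>2"]) auto
  have I0: "(\<lambda>n. I n x) \<longlonglongrightarrow> 0" for x
  proof -
    interpret finite_measure "?\<mu> x" by (rule fin)
    have "(\<lambda>n. I n x) \<longlonglongrightarrow> (\<integral>y. 0 \<partial>?\<mu> x)"
      unfolding I_def
    proof (rule integral_dominated_convergence[where w = "\<lambda>_. (2 * L)\<^sup>2"])
      show "AE y in ?\<mu> x. (\<lambda>n. (cmod (s n y - \<Phi> y))\<^sup>2) \<longlonglongrightarrow> 0"
      proof (rule AE_I2)
        fix y assume "y \<in> space (?\<mu> x)"
        then have "(\<lambda>n. (cmod (s n y - \<Phi> y))\<^sup>2) \<longlonglongrightarrow> (cmod (\<Phi> y - \<Phi> y))\<^sup>2"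
          by (intro tendsto_intros \<Phi>(2)) simp
        then show "(\<lambda>n. (cmod (s n y - \<Phi> y))\<^sup>2) \<longlonglongrightarrow> 0" by simp
      qed
    qed (use err in auto)
    then show ?thesis by simp
  qed
  have diff: "(norm (S n x - S m x))\<^sup>2 \<le> 2 * I n x + 2 * I m x" for n m x
  proof -
    have hb: "has_bochner_integral (?\<mu> x) (\<lambda>y. (cmod (s n y - s m y))\<^sup>2) ((norm (S n x - S m x))\<^sup>2)"
      unfolding s_def S_def by (rule norm_diff_simple[OF E K K])
    then have "(norm (S n x - S m x))\<^sup>2 = (\<integral>y. (cmod (s n y - s m y))\<^sup>2 \<partial>?\<mu> x)"
      by (simp add: has_bochner_integral_integral_eq)
    also have "\<dots> \<le> (\<integral>y. 2 * (cmod (s n y - \<Phi> y))\<^sup>2 + 2 * (cmod (s m y - \<Phi> y))\<^sup>2 \<partial>?\<mu> x)"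
    proof (rule integral_mono)
      show "integrable (?\<mu> x) (\<lambda>y. (cmod (s n y - s m y))\<^sup>2)"
        using hb by (rule integrable.intros)
      show "integrable (?\<mu> x) (\<lambda>y. 2 * (cmod (s n y - \<Phi> y))\<^sup>2 + 2 * (cmod (s m y - \<Phi> y))\<^sup>2)"
        using int_err by auto
      fix y
      have "(cmod (s n y - s m y))\<^sup>2 \<le> (cmod (s n y - \<Phi> y) + cmod (s m y - \<Phi> y))\<^sup>2"
        using norm_triangle_ineq4[of "s n y - \<Phi> y" "s m y - \<Phi> y"] by (intro power_mono) auto
      then show "(cmod (s n y - s m y))\<^sup>2 \<le> 2 * (cmod (s n y - \<Phi> y))\<^sup>2 + 2 * (cmod (s m y - \<Phi> y))\<^sup>2"
        using sum_squares_bound[of "cmod (s n y - \<Phi> y)" "cmod (s m y - \<Phi> y)"] by (simp add: power2_sum)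
    qed
    also have "\<dots> = 2 * I n x + 2 * I m x" using int_err by (simp add: I_def)
    finally show ?thesis .
  qed
  have "Cauchy (\<lambda>n. S n x)" for x
  proof (rule CauchyI)
    fix e :: real assume e: "0 < e"
    then have "\<forall>\<^sub>F n in sequentially. I n x < e\<^sup>2 / 4" by (intro order_tendstoD(2)[OF I0]) simp
    then obtain N where N: "\<And>n. n \<ge> N \<Longrightarrow> I n x < e\<^sup>2 / 4" by (auto simp: eventually_sequentially)
    have "norm (S m x - S n x) < e" if "m \<ge> N" "n \<ge> N" for m n
    proof -
      have "(norm (S m x - S n x))\<^sup>2 < e\<^sup>2" using diff[of m x n] N[OF that(1)] N[OF that(2)] by linarith
      then show ?thesis using e by (simp add: power2_less_imp_less)
    qed
    then show "\<exists>N. \<forall>m\<ge>N. \<forall>n\<ge>N. norm (S m x - S n x) < e" by blast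
  qed
  then have "\<exists>q. (\<lambda>n. S n x) \<longlonglongrightarrow> q" for x using Cauchy_convergent convergent_def by blast
  then obtain Q where Q: "\<And>x. (\<lambda>n. S n x) \<longlonglongrightarrow> Q x" by metis
  have bcS: "bounded_clinear (S n)" for n
    unfolding S_def
    by (rule bounded_clinear_sum, rule bounded_clinear_scaleC)
      (use K in \<open>auto intro: orthogonal_projectionD(1)[OF spectral_measureD(1)[OF E]]\<close>)
  have bcQ: "bounded_clinear Q"
  proof (rule bounded_clinearI[where K = L])
    show "Q (x + y) = Q x + Q y" for x y
      using LIMSEQ_unique[OF Q[of "x + y"]] tendsto_add[OF Q[of x] Q[of y]]
      by (simp add: bounded_clinear_apply_add[OF bcS])
    show "Q (scaleC d x) = scaleC d (Q x)" for d x
      using LIMSEQ_unique[OF Q[of "scaleC d x"]] tendsto_scaleC[OF Q[of x], of d]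
      by (simp add: bounded_clinear_apply_scaleC[OF bcS])
    show "norm (Q x) \<le> norm x * L" for x
    proof (rule LIMSEQ_le_const2[OF tendsto_norm[OF Q]], intro exI allI impI)
      fix n
      \<comment> \<open>Over an empty space nothing bounds \<open>L\<close> from below, but there
        \<open>id = E {}\<close> makes the Hilbert space trivial.\<close>
      have "0 \<le> L \<or> space M = {}" using L order_trans[OF norm_ge_zero] by blast
      then have "0 \<le> L * norm x"
      proof
        assume "space M = {}"
        then have "x = 0" using spectral_measureD(2)[OF E] spectral_measure_empty[OF E, of x] by simp
        then show ?thesis by simp
      qed simp
      then show "norm (S n x) \<le> norm x * L"
        using power2_le_imp_le[OF norm_S] by (simp add: mult.commute)
    qed
  qed
  have form: "cinner (Q x) x = integral\<^sup>L (?\<mu> x) \<Phi>" for x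
  proof (rule LIMSEQ_unique)
    interpret finite_measure "?\<mu> x" by (rule fin)
    show "(\<lambda>n. cinner (S n x) x) \<longlonglongrightarrow> cinner (Q x) x" by (intro tendsto_cinner Q tendsto_const)
    have "cinner (S n x) x = integral\<^sup>L (?\<mu> x) (s n)" for n
      using has_bochner_integral_simple[where K = "K n" and A = "A n" and c = "c n" and x = x, OF E K(1) K(2),
          THEN has_bochner_integral_integral_eq]
      by (simp add: s_def S_def cinner_sum_left cinner_scaleC_left)
    moreover have "(\<lambda>n. integral\<^sup>L (?\<mu> x) (s n)) \<longlonglongrightarrow> integral\<^sup>L (?\<mu> x) \<Phi>"
      by (rule integral_dominated_convergence[where w = "\<lambda>_. L"]) (use \<Phi>(2) L in auto)
    ultimately show "(\<lambda>n. cinner (S n x) x) \<longlonglongrightarrow> integral\<^sup>L (?\<mu> x) \<Phi>" by simp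
  qed
  have "spectral_integral M E \<Phi> = Q"
    unfolding spectral_integral_def
  proof (rule the_equality)
    fix Q' assume Q': "bounded_clinear Q' \<and> (\<forall>x. cinner (Q' x) x = integral\<^sup>L (?\<mu> x) \<Phi>)"
    show "Q' = Q" by (rule polarization) (use Q' bcQ form in auto)
  qed (use bcQ form in auto)
  then show ?thesis using Q by (simp add: S_def)
qed

lemma lipschitz_divided_difference_measurable:
  assumes "\<exists>L. L-lipschitz_on UNIV f"
  shows "divided_difference f \<in> borel_measurable borel"
proof -
  have "continuous_on UNIV f" using assms lipschitz_on_continuous_on by blast
  then have [measurable]: "f \<in> borel_measurable borel" by (rule borel_measurable_continuous_onI)
  have "divided_difference f = (\<lambda>p. if fst p = snd p then 0
      else (f (fst p) - f (snd p)) / complex_of_real (fst p - snd p))"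
    by (auto simp: divided_difference_def fun_eq_iff)
  moreover have "\<dots> \<in> borel_measurable (borel \<Otimes>\<^sub>M borel)" by measurable
  ultimately show ?thesis by (simp add: borel_prod)
qed

text \<open>On the diagonal \<open>divided_difference f (g n t, g n t) = 0\<close>, so no continuity is needed there.\<close>

lemma divided_difference_tendsto:
  assumes f: "\<exists>L. L-lipschitz_on UNIV f" and g: "\<And>t :: real. (\<lambda>n. g n t) \<longlonglongrightarrow> t"
  shows "(\<lambda>n. divided_difference f (g n s, g n t)) \<longlonglongrightarrow> divided_difference f (s, t)"
proof (cases "s = t")
  case False
  have fg: "(\<lambda>n. f (g n t)) \<longlonglongrightarrow> f t" for t
  proof -
    have "continuous_on UNIV f" using f lipschitz_on_continuous_on by blast
    then show ?thesis
      using g continuous_on_tendsto_compose[of UNIV f "\<lambda>n. g n t" t sequentially] by simp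
  qed
  have "(\<lambda>n. g n s - g n t) \<longlonglongrightarrow> s - t" by (intro tendsto_intros g)
  then have "\<forall>\<^sub>F n in sequentially. g n s - g n t \<noteq> 0"
    using False by (intro tendsto_imp_eventually_ne) auto
  then have "\<forall>\<^sub>F n in sequentially. (f (g n s) - f (g n t)) / complex_of_real (g n s - g n t)
      = divided_difference f (g n s, g n t)"
    by eventually_elim (auto simp: divided_difference_def)
  moreover have "(\<lambda>n. (f (g n s) - f (g n t)) / complex_of_real (g n s - g n t))
      \<longlonglongrightarrow> (f s - f t) / complex_of_real (s - t)"
    using False by (intro tendsto_intros fg g) (simp del: of_real_diff)
  ultimately show ?thesis using False
    by (auto simp: divided_difference_def intro: Lim_transform_eventually)
qed (simp add: divided_difference_def)

text \<open>Step functions tending to the identity. Sampling both variables with the same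
  \<open>g n\<close> keeps the kernel a divided difference on a finite set of points, with its zero
  diagonal, so that \<open>discrete_doi_bound\<close> applies.\<close>

definition discrete_approx :: "(nat \<Rightarrow> real \<Rightarrow> real) \<Rightarrow> bool"
  where "discrete_approx g \<longleftrightarrow>
    (\<forall>n. finite (range (g n)) \<and> (\<forall>t. g n -` {t} \<in> sets borel)) \<and> (\<forall>t. (\<lambda>n. g n t) \<longlonglongrightarrow> t)"

lemma discrete_approx_exists: "\<exists>g. discrete_approx g"
proof -
  obtain F :: "nat \<Rightarrow> real \<Rightarrow> real" where F: "\<And>i. simple_function borel (F i)"
    "\<And>x. (\<lambda>i. F i x) \<longlonglongrightarrow> x"
    using borel_measurable_implies_sequence_metric[of "\<lambda>x::real. x" borel 0] by auto
  have "finite (range (F n))" "F n -` {t} \<in> sets borel" for n t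
    using simple_functionD(1)[OF F(1)[of n]] simple_functionD(2)[OF F(1)[of n], of "{t}"] by auto
  then have "discrete_approx F" using F(2) by (simp add: discrete_approx_def)
  then show ?thesis by blast
qed

context spectral_pair
begin

text \<open>It makes sense for every operator \<open>T\<close>, which is how the double operator
  integral is continued beyond the Hilbert--Schmidt class.\<close>

definition discrete_doi :: "(real \<Rightarrow> complex) \<Rightarrow> (real \<Rightarrow> real) \<Rightarrow> ('a \<Rightarrow> 'a) \<Rightarrow> 'a \<Rightarrow> 'a"
  where "discrete_doi f g T x = (\<Sum>i\<in>range g. \<Sum>j\<in>range g.
    scaleC (divided_difference f (i, j)) (E1 (g -` {i}) (T (E2 (g -` {j}) x))))"

lemma doi_lipschitz_tendsto:
  assumes f: "\<exists>L. L-lipschitz_on UNIV f" and g: "discrete_approx g"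
  shows "(\<lambda>n. discrete_doi f (g n) (hs_op T) x) \<longlonglongrightarrow> hs_op (doi_lipschitz E1 E2 f T) x"
proof -
  let ?E = "product_spectral_measure E1 E2"
  define D where "D n = (\<Sum>p\<in>range (g n) \<times> range (g n).
    scaleC (divided_difference f p) (?E ((g n -` {fst p}) \<times> (g n -` {snd p})) T))" for n
  have gD: "finite (range (g n))" "g n -` {t} \<in> sets borel" "(\<lambda>n. g n t) \<longlonglongrightarrow> t" for n t
    using g by (auto simp: discrete_approx_def)
  have s: "(\<Sum>p\<in>range (g n) \<times> range (g n). indicator ((g n -` {fst p}) \<times> (g n -` {snd p})) y
      *\<^sub>R divided_difference f p) = divided_difference f (g n (fst y), g n (snd y))" (is "?l = ?r") for n y
  proof -
    have "?l = (\<Sum>p\<in>range (g n) \<times> range (g n). if p = (g n (fst y), g n (snd y)) then divided_difference f p else 0)"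
      by (intro sum.cong refl) (auto simp: indicator_def prod_eq_iff mem_Times_iff)
    then show ?thesis using gD(1)[of n] by simp
  qed
  have "D \<longlonglongrightarrow> spectral_integral borel ?E (divided_difference f) T"
    unfolding D_def
  proof (rule spectral_integral_tendsto[OF spectral_measure_product])
    show "(\<lambda>n. \<Sum>p\<in>range (g n) \<times> range (g n). indicator ((g n -` {fst p}) \<times> (g n -` {snd p})) y
      *\<^sub>R divided_difference f p) \<longlonglongrightarrow> divided_difference f y" for y
      unfolding s using divided_difference_tendsto[OF f gD(3), of "fst y" "snd y"] by simp
    show "cmod (\<Sum>p\<in>range (g n) \<times> range (g n). indicator ((g n -` {fst p}) \<times> (g n -` {snd p})) y
      *\<^sub>R divided_difference f p) \<le> lip_norm f" for n y
      unfolding s by (rule norm_divided_difference_le[of f, OF lip_norm_bound[OF f]])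
  qed (use gD lipschitz_divided_difference_measurable[OF f] in \<open>auto simp: borel_Times\<close>)
  then have "D \<longlonglongrightarrow> doi_lipschitz E1 E2 f T"
    by (simp add: doi_lipschitz_def double_operator_integral_def)
  then have "(\<lambda>n. norm (D n - doi_lipschitz E1 E2 f T) * norm x) \<longlonglongrightarrow> 0"
    by (intro tendsto_mult_left_zero tendsto_norm_zero LIM_zero)
  then have "(\<lambda>n. hs_op (D n) x - hs_op (doi_lipschitz E1 E2 f T) x) \<longlonglongrightarrow> 0"
    by (rule Lim_null_comparison[rotated])
      (auto simp: hs_op_diff[symmetric] intro!: always_eventually hs_op_norm_le)
  moreover have "hs_op (D n) x = discrete_doi f (g n) (hs_op T) x" for n
    unfolding D_def discrete_doi_def hs_op_sum sum.cartesian_product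
    by (intro sum.cong refl)
      (auto simp: scaleC_hs.rep_eq product_spectral_measure_Times gD)
  ultimately show ?thesis by (simp add: LIM_zero_iff)
qed

end

section \<open>The extension to the Matsaev ideal\<close>

text \<open>Compactness of bounded sets in a finite dimensional subspace, built by adding one closed
  disc of coefficients at a time.\<close>

lemma bounded_combinations_compact:
  assumes "finite G"
  shows "\<exists>K. compact K \<and> (\<forall>c. (\<forall>g\<in>G. cmod (c g) \<le> b) \<longrightarrow> (\<Sum>g\<in>G. scaleC (c g) g) \<in> K)"
  using assms
proof induction
  case empty
  show ?case by (rule exI[of _ "{0}"]) simp
next
  case (insert g G)
  then obtain K where K: "compact K" "\<And>c. (\<forall>g\<in>G. cmod (c g) \<le> b) \<Longrightarrow> (\<Sum>g\<in>G. scaleC (c g) g) \<in> K"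
    by blast
  have "continuous_on (cball 0 b) (\<lambda>a. scaleC a g)"
  proof (rule linear_continuous_on)
    show "bounded_linear (\<lambda>a. scaleC a g)"
      by (rule bounded_linear_intro[where K = "norm g"])
        (auto simp: scaleC_add_left scaleR_scaleC scaleC_scaleC norm_scaleC scaleR_conv_of_real
          scaleC_complex_def)
  qed
  then have "compact ((\<lambda>a. scaleC a g) ` cball 0 b)" by (rule compact_continuous_image) simp
  then have "compact {x + y | x y. x \<in> (\<lambda>a. scaleC a g) ` cball 0 b \<and> y \<in> K}" (is "compact ?K'")
    using K(1) by (rule compact_sums)
  moreover have "(\<Sum>g\<in>insert g G. scaleC (c g) g) \<in> ?K'" if "\<forall>g\<in>insert g G. cmod (c g) \<le> b" for c
    unfolding mem_Collect_eq using that K(2)[of c] insert.hyps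
    by (intro exI[of _ "scaleC (c g) g"] exI[of _ "\<Sum>g\<in>G. scaleC (c g) g"]) auto
  ultimately show ?case by blast
qed

text \<open>Total boundedness: \<open>R\<close> maps the unit ball into a compact set of bounded
  combinations of orthonormal vectors, and an \<open>e / 4\<close> net of that set is an
  \<open>e\<close> net for the closure of the image under \<open>T\<close>.\<close>

lemma compact_operatorI_approx:
  assumes T: "bounded_clinear T"
    and approx: "\<And>e. 0 < e \<Longrightarrow> \<exists>R r. bounded_clinear R \<and> rank_le R r \<and> (\<forall>x. norm (T x - R x) \<le> e * norm x)"
  shows "compact_operator T"
proof -
  let ?S = "T ` cball 0 1"
  have "\<exists>k. finite k \<and> closure ?S \<subseteq> (\<Union>x\<in>k. ball x e)" if e: "0 < e" for e
  proof -
    obtain R r where R: "bounded_clinear R" "rank_le R r" "\<And>x. norm (T x - R x) \<le> e / 4 * norm x"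
      using approx[of "e / 4"] e by auto
    obtain B where "finite B" "range R \<subseteq> cspan B" using R(2) by (auto simp: rank_le_def)
    then obtain G where G: "finite G" "orthonormal G" "range R \<subseteq> cspan G" using gram_schmidt[of B] by blast
    obtain K where K: "compact K"
      "\<And>c. (\<forall>g\<in>G. cmod (c g) \<le> onorm R) \<Longrightarrow> (\<Sum>g\<in>G. scaleC (c g) g) \<in> K"
      using bounded_combinations_compact[OF G(1), of "onorm R"] by blast
    have RK: "R x \<in> K" if x: "norm x \<le> 1" for x
    proof -
      have "cmod (cinner (R x) g) \<le> onorm R" if "g \<in> G" for g
      proof -
        have "cmod (cinner (R x) g) \<le> onorm R * norm x * norm g" by (rule cinner_le_onorm[OF R(1)])
        also have "\<dots> \<le> onorm R" using x that G(2) onorm_nonneg[OF R(1)]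
          by (simp add: orthonormal_def mult_left_le)
        finally show ?thesis .
      qed
      then have "(\<Sum>g\<in>G. scaleC (cinner (R x) g) g) \<in> K" by (intro K(2) ballI)
      moreover have "R x \<in> cspan G" using G(3) by blast
      ultimately show ?thesis using orthonormal_expansion(1)[OF G(1,2), of "R x"] by simp
    qed
    obtain k where k: "finite k" "K \<subseteq> (\<Union>x\<in>k. ball x (e / 4))"
      using K(1) e unfolding compact_eq_totally_bounded by (metis zero_less_divide_iff zero_less_numeral)
    have "closure ?S \<subseteq> (\<Union>x\<in>k. ball x e)"
    proof
      fix z assume "z \<in> closure ?S"
      then obtain x where x: "norm x \<le> 1" "dist (T x) z < e / 4"
        using e unfolding closure_approachable by (metis (no_types, lifting) imageE mem_cball_0 zero_less_divide_iff zero_less_numeral)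
      obtain y where y: "y \<in> k" "dist y (R x) < e / 4" using RK[OF x(1)] k(2) by auto
      have "dist (R x) (T x) \<le> e / 4 * norm x" using R(3)[of x] by (simp add: dist_norm norm_minus_commute)
      also have "\<dots> \<le> e / 4" using x(1) e by (simp add: mult_left_le)
      finally have "dist y z < e"
        using y(2) x(2) dist_triangle[of y z "R x"] dist_triangle[of "R x" z "T x"] e by linarith
      then show "z \<in> (\<Union>x\<in>k. ball x e)" using y(1) by auto
    qed
    then show ?thesis using k(1) by blast
  qed
  then have "compact (closure ?S)"
    unfolding compact_eq_totally_bounded by (simp add: complete_eq_closed)
  then show ?thesis using T by (simp add: compact_operator_def)
qed

lemma finite_rank_hs_op_rank_one_sum:
  assumes "finite F" shows "\<exists>r. rank_le (hs_op (\<Sum>e\<in>F. rank_one (u e) e)) r"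
proof -
  have "hs_op (\<Sum>e\<in>F. rank_one (u e) e) x \<in> cspan (u ` F)" for x
    unfolding hs_op_sum hs_op_rank_one
    by (intro complex_vector.span_sum complex_vector.span_scale complex_vector.span_base) simp
  then show ?thesis using assms unfolding rank_le_def
    by (intro exI[of _ "card (u ` F)"] exI[of _ "u ` F"]) auto
qed

lemma hilbert_schmidt_finite_rank:
  fixes R :: "'a::chilbert_space \<Rightarrow> 'a"
  assumes "bounded_clinear R" "rank_le R r" shows "hilbert_schmidt R"
proof (rule hilbert_schmidtI[OF assms(1)])
  fix F :: "'a set" assume F: "finite F" "F \<subseteq> hilbert_basis"
  have "orthonormal F" by (rule orthonormal_subset[OF orthonormal_hilbert_basis F(2)])
  then show "(\<Sum>e\<in>F. (norm (R e))\<^sup>2) \<le> real r * (onorm R)\<^sup>2"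
    by (intro sum_norm_rank_le F(1) orthonormal_ortho_family assms) (auto simp: orthonormal_def)
qed

lemma spectral_measure_vimage_family:
  fixes g :: "real \<Rightarrow> real"
  assumes E: "spectral_measure borel E" and g: "finite (range g)" "\<And>t. g -` {t} \<in> sets borel"
  shows "ortho_family (\<lambda>t. E (g -` {t}) x) (range g)"
    and "(\<Sum>t\<in>range g. (norm (E (g -` {t}) x))\<^sup>2) \<le> (norm x)\<^sup>2"
proof -
  show o: "ortho_family (\<lambda>t. E (g -` {t}) x) (range g)"
    unfolding ortho_family_def
  proof (intro ballI impI)
    fix s t :: real assume "s \<noteq> t"
    then have "g -` {s} \<inter> g -` {t} = {}" by auto
    then show "cinner (E (g -` {s}) x) (E (g -` {t}) x) = 0"
      by (simp add: spectral_measure_cinner[OF E] g(2) spectral_measure_empty[OF E])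
  qed
  show "(\<Sum>t\<in>range g. (norm (E (g -` {t}) x))\<^sup>2) \<le> (norm x)\<^sup>2"
    by (rule sum_norm_projections_le[where P = "\<lambda>t. E (g -` {t})", OF g(1) _ o])
      (rule spectral_measureD(1)[OF E g(2)])
qed

context spectral_pair
begin

lemma bounded_clinear_discrete_doi:
  assumes g: "\<And>t. g -` {t} \<in> sets borel" and T: "bounded_clinear T"
  shows "bounded_clinear (discrete_doi f g T)"
proof -
  have "bounded_clinear (\<lambda>x. scaleC c (E1 (g -` {i}) (T (E2 (g -` {j}) x))))" for c i j
    by (rule bounded_clinear_scaleC,
        rule bounded_clinear_compose[OF orthogonal_projectionD(1)[OF proj(1)[OF g]]],
        rule bounded_clinear_compose[OF T orthogonal_projectionD(1)[OF proj(2)[OF g]]])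
  then have "bounded_clinear (\<lambda>x. discrete_doi f g T x)"
    unfolding discrete_doi_def by (intro bounded_clinear_sum)
  then show ?thesis by simp
qed

lemma discrete_doi_linear:
  assumes g: "\<And>t. g -` {t} \<in> sets borel"
  shows "discrete_doi f g (\<lambda>x. S x + T x) x = discrete_doi f g S x + discrete_doi f g T x"
    and "discrete_doi f g (\<lambda>x. S x - T x) x = discrete_doi f g S x - discrete_doi f g T x"
    and "discrete_doi f g (\<lambda>x. scaleC c (T x)) x = scaleC c (discrete_doi f g T x)"
proof -
  note bc = orthogonal_projectionD(1)[OF proj(1)[OF g]]
  show "discrete_doi f g (\<lambda>x. S x + T x) x = discrete_doi f g S x + discrete_doi f g T x"
    by (simp add: discrete_doi_def bounded_clinear_apply_add[OF bc] scaleC_add_right sum.distrib)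
  show "discrete_doi f g (\<lambda>x. S x - T x) x = discrete_doi f g S x - discrete_doi f g T x"
    by (simp add: discrete_doi_def bounded_clinear_apply_diff[OF bc]
        complex_vector.scale_right_diff_distrib sum_subtractf)
  show "discrete_doi f g (\<lambda>x. scaleC c (T x)) x = scaleC c (discrete_doi f g T x)"
    by (simp add: discrete_doi_def bounded_clinear_apply_scaleC[OF bc] scaleC_scaleC
        complex_vector.scale_sum_right mult.commute)
qed

text \<open>Paired with \<open>y\<close>, the sum lets its left projections pass to
  \<open>y\<close>; the pieces of \<open>x\<close> and of \<open>y\<close> are orthogonal families,
  to which the discrete inequality applies.\<close>

lemma norm_discrete_doi_le:
  assumes C: "discrete_doi_bound TYPE('a) C" "0 \<le> C" and f: "\<exists>L. L-lipschitz_on UNIV f"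
    and g: "finite (range g)" "\<And>t. g -` {t} \<in> sets borel" and T: "T \<in> matsaev_ideal"
  shows "norm (discrete_doi f g T x) \<le> C * lip_norm f * matsaev_norm T * norm x"
proof (rule norm_le_cinner)
  let ?K = "C * lip_norm f * matsaev_norm T"
  have K: "0 \<le> ?K"
    by (intro mult_nonneg_nonneg C(2) lip_norm_nonneg[OF f] matsaev_norm_nonneg[OF T])
  then show "0 \<le> ?K * norm x" by simp
  fix y
  note x' = spectral_measure_vimage_family[OF E2 g, of x]
  note y' = spectral_measure_vimage_family[OF E1 g, of y]
  have "cinner (discrete_doi f g T x) y = (\<Sum>i\<in>range g. \<Sum>j\<in>range g.
      divided_difference f (i, j) * cinner (T (E2 (g -` {j}) x)) (E1 (g -` {i}) y))"
    unfolding discrete_doi_def cinner_sum_left cinner_scaleC_left orthogonal_projectionD(3)[OF proj(1)[OF g(2)]] ..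
  moreover have "cmod (\<Sum>i\<in>range g. \<Sum>j\<in>range g.
      divided_difference f (i, j) * cinner (T (E2 (g -` {j}) x)) (E1 (g -` {i}) y))
      \<le> ?K * (sqrt (\<Sum>i\<in>range g. (norm (E2 (g -` {i}) x))\<^sup>2)
      * sqrt (\<Sum>i\<in>range g. (norm (E1 (g -` {i}) y))\<^sup>2))"
    using C(1)[unfolded discrete_doi_bound_def, rule_format, OF f g(1) x'(1) y'(1) T] .
  moreover have "?K * (sqrt (\<Sum>i\<in>range g. (norm (E2 (g -` {i}) x))\<^sup>2)
      * sqrt (\<Sum>i\<in>range g. (norm (E1 (g -` {i}) y))\<^sup>2)) \<le> ?K * (norm x * norm y)"
  proof (rule mult_left_mono[OF _ K], rule mult_mono)
    show "0 \<le> sqrt (\<Sum>i\<in>range g. (norm (E1 (g -` {i}) y))\<^sup>2)"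
      by (intro real_sqrt_ge_zero sum_nonneg) simp
  qed (rule real_le_lsqrt[OF norm_ge_zero x'(2)] real_le_lsqrt[OF norm_ge_zero y'(2)] norm_ge_zero)+
  ultimately show "cmod (cinner (discrete_doi f g T x) y) \<le> ?K * norm x * norm y"
    by (simp only: mult.assoc)
qed

text \<open>The extension is the pointwise limit of the discrete sums. For finite rank
  \<open>T\<close> the limit exists and is the double operator integral; the bound, uniform in
  \<open>n\<close>, and density of finite rank carry existence over to the whole ideal.\<close>

lemma matsaev_extension_of_discrete_bound:
  assumes C: "discrete_doi_bound TYPE('a) C" "0 \<le> C" and f: "\<exists>L. L-lipschitz_on UNIV f"
  shows "\<exists>J. matsaev_extension E1 E2 f J \<and>
    (\<forall>T\<in>matsaev_ideal. onorm (J T) \<le> C * lip_norm f * matsaev_norm T)"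
proof -
  obtain g where g: "discrete_approx g" using discrete_approx_exists by blast
  have gD: "finite (range (g n))" "g n -` {t} \<in> sets borel" for n t
    using g by (auto simp: discrete_approx_def)
  define I where "I n T = discrete_doi f (g n) T" for n T
  define J where "J T x = lim (\<lambda>n. I n T x)" for T x
  let ?K = "\<lambda>T. C * lip_norm f * matsaev_norm T"
  have CL: "0 \<le> C * lip_norm f" by (intro mult_nonneg_nonneg C(2) lip_norm_nonneg[OF f])
  have I_le: "norm (I n T x) \<le> ?K T * norm x" if "T \<in> matsaev_ideal" for n T x
    unfolding I_def by (rule norm_discrete_doi_le[OF C f gD that])
  note I_lin = discrete_doi_linear[where f = f, OF gD(2), folded I_def]
  have I_hs: "(\<lambda>n. I n (hs_op T) x) \<longlonglongrightarrow> hs_op (doi_lipschitz E1 E2 f T) x" for T x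
    unfolding I_def by (rule doi_lipschitz_tendsto[OF f g])
  have I_J: "(\<lambda>n. I n T x) \<longlonglongrightarrow> J T x" if T: "T \<in> matsaev_ideal" for T x
  proof -
    obtain R where R: "\<And>k. bounded_clinear (R k)" "\<And>k. rank_le (R k) k"
      "\<And>k. (\<lambda>x. T x - R k x) \<in> matsaev_ideal" "(\<lambda>k. matsaev_norm (\<lambda>x. T x - R k x)) \<longlonglongrightarrow> 0"
      using matsaev_finite_rank_dense[OF T] by blast
    have "Cauchy (\<lambda>n. I n T x)"
    proof (rule CauchyI)
      fix e :: real assume e: "0 < e"
      have "(\<lambda>k. ?K (\<lambda>x. T x - R k x) * norm x) \<longlonglongrightarrow> C * lip_norm f * 0 * norm x"
        by (intro tendsto_intros R(4))
      then have "\<forall>\<^sub>F k in sequentially. ?K (\<lambda>x. T x - R k x) * norm x < e / 3"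
        using e by (intro order_tendstoD(2)) auto
      then obtain k where k: "?K (\<lambda>x. T x - R k x) * norm x < e / 3"
        by (metis (no_types, lifting) eventually_sequentially order_refl)
      have "(\<lambda>n. I n (R k) x) \<longlonglongrightarrow> hs_op (doi_lipschitz E1 E2 f (Abs_hs (R k))) x"
        using I_hs[of "Abs_hs (R k)" x] hilbert_schmidt_finite_rank[OF R(1,2)]
        by (simp add: Abs_hs_inverse)
      then have "Cauchy (\<lambda>n. I n (R k) x)" by (rule LIMSEQ_imp_Cauchy)
      then obtain N where N: "\<And>m n. m \<ge> N \<Longrightarrow> n \<ge> N \<Longrightarrow> norm (I m (R k) x - I n (R k) x) < e / 3"
        using e CauchyD[of "\<lambda>n. I n (R k) x" "e / 3"] by auto
      have "norm (I m T x - I n T x) < e" if "m \<ge> N" "n \<ge> N" for m n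
      proof -
        have I_T: "I n T x = I n (\<lambda>x. T x - R k x) x + I n (R k) x" for n
          by (simp add: I_lin(2))
        let ?a = "I m (\<lambda>x. T x - R k x) x" and ?b = "I n (\<lambda>x. T x - R k x) x"
          and ?c = "I m (R k) x - I n (R k) x"
        have "I m T x - I n T x = (?a - ?b) + ?c" by (simp add: I_T[of m] I_T[of n])
        then have "norm (I m T x - I n T x) \<le> norm ?a + norm ?b + norm ?c"
          using norm_triangle_ineq[of "?a - ?b" ?c] norm_triangle_ineq4[of ?a ?b] by simp
        then show ?thesis
          using I_le[OF R(3), of m k x] I_le[OF R(3), of n k x] k N[OF that] by linarith
      qed
      then show "\<exists>N. \<forall>m\<ge>N. \<forall>n\<ge>N. norm (I m T x - I n T x) < e" by blast
    qed
    then show ?thesis unfolding J_def by (simp add: Cauchy_convergent convergent_LIMSEQ_iff[symmetric])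
  qed
  have J_hs: "J (hs_op T) = hs_op (doi_lipschitz E1 E2 f T)" for T
    unfolding J_def using I_hs by (intro ext limI)
  have J_add: "J (\<lambda>x. S x + T x) x = J S x + J T x" if "S \<in> matsaev_ideal" "T \<in> matsaev_ideal" for S T x
    unfolding J_def[of "\<lambda>x. S x + T x"] I_lin(1) by (intro limI tendsto_add I_J that)
  have J_scale: "J (\<lambda>x. scaleC c (T x)) x = scaleC c (J T x)" if "T \<in> matsaev_ideal" for c T x
    unfolding J_def[of "\<lambda>x. scaleC c (T x)"] I_lin(3) by (intro limI tendsto_scaleC I_J that)
  have J_le: "norm (J T x) \<le> ?K T * norm x" if "T \<in> matsaev_ideal" for T x
    by (rule LIMSEQ_le_const2[OF tendsto_norm[OF I_J[OF that]]]) (use I_le[OF that] in auto)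
  have J_bc: "bounded_clinear (J T)" if T: "T \<in> matsaev_ideal" for T
  proof (rule bounded_clinearI)
    note bc = bounded_clinear_discrete_doi[where f = f, OF gD(2) matsaev_idealD(1)[OF T], folded I_def]
    show "J T (x + y) = J T x + J T y" for x y
      using LIMSEQ_unique[OF I_J[OF T, of "x + y"]] tendsto_add[OF I_J[OF T, of x] I_J[OF T, of y]]
      by (simp add: bounded_clinear_apply_add[OF bc])
    show "J T (scaleC c x) = scaleC c (J T x)" for c x
      using LIMSEQ_unique[OF I_J[OF T, of "scaleC c x"]] tendsto_scaleC[OF I_J[OF T, of x], of c]
      by (simp add: bounded_clinear_apply_scaleC[OF bc])
    show "norm (J T x) \<le> norm x * ?K T" for x using J_le[OF T, of x] by (simp add: mult.commute)
  qed
  have J_compact: "compact_operator (J T)" if T: "T \<in> matsaev_ideal" for T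
  proof (rule compact_operatorI_approx[OF J_bc[OF T]])
    fix e :: real assume e: "0 < e"
    obtain R where R: "\<And>k. bounded_clinear (R k)" "\<And>k. rank_le (R k) k"
      "\<And>k. (\<lambda>x. T x - R k x) \<in> matsaev_ideal" "(\<lambda>k. matsaev_norm (\<lambda>x. T x - R k x)) \<longlonglongrightarrow> 0"
      using matsaev_finite_rank_dense[OF T] by blast
    have "(\<lambda>k. ?K (\<lambda>x. T x - R k x)) \<longlonglongrightarrow> C * lip_norm f * 0"
      by (intro tendsto_intros R(4))
    then have "\<forall>\<^sub>F k in sequentially. ?K (\<lambda>x. T x - R k x) < e / 2"
      using e by (intro order_tendstoD(2)) auto
    then obtain k where k: "?K (\<lambda>x. T x - R k x) < e / 2"
      by (metis (no_types, lifting) eventually_sequentially order_refl)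
    \<comment> \<open>The image of a finite rank operator is only known to be Hilbert--Schmidt, so
      it has to be truncated once more to reach finite rank.\<close>
    define D where "D = doi_lipschitz E1 E2 f (Abs_hs (R k))"
    have JR: "J (R k) x = hs_op D x" for x
      using J_hs[of "Abs_hs (R k)"] hilbert_schmidt_finite_rank[OF R(1,2)]
      by (simp add: Abs_hs_inverse D_def)
    obtain F where F: "finite F" "norm (D - (\<Sum>e\<in>F. rank_one (hs_op D e) e)) \<le> e / 2"
      using hs_rank_one_approx[of "e / 2" D] e by auto
    define S where "S = (\<Sum>e\<in>F. rank_one (hs_op D e) e)"
    obtain r where r: "rank_le (hs_op S) r"
      using finite_rank_hs_op_rank_one_sum[OF F(1)] unfolding S_def by blast
    have "norm (J T x - hs_op S x) \<le> e * norm x" for x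
    proof -
      have T_eq: "T = (\<lambda>x. (T x - R k x) + R k x)" by simp
      have "J T x = J (\<lambda>x. T x - R k x) x + J (R k) x"
        by (subst T_eq) (rule J_add[OF R(3) matsaev_finite_rank[OF R(1,2)]])
      then have "J T x - hs_op S x = J (\<lambda>x. T x - R k x) x + hs_op (D - S) x"
        by (simp add: JR hs_op_diff)
      also have "norm \<dots> \<le> ?K (\<lambda>x. T x - R k x) * norm x + norm (D - S) * norm x"
        by (intro order_trans[OF norm_triangle_ineq] add_mono J_le R(3) hs_op_norm_le)
      also have "\<dots> \<le> e / 2 * norm x + e / 2 * norm x"
        using k F(2) by (intro add_mono mult_right_mono) (auto simp: S_def)
      finally show ?thesis by simp
    qed
    then show "\<exists>S r. bounded_clinear S \<and> rank_le S r \<and> (\<forall>x. norm (J T x - S x) \<le> e * norm x)"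
      using r bounded_clinear_hs_op by blast
  qed
  have "matsaev_extension E1 E2 f J"
    unfolding matsaev_extension_def using J_add J_scale J_compact J_hs by (auto simp: fun_eq_iff)
  moreover have "onorm (J T) \<le> ?K T" if T: "T \<in> matsaev_ideal" for T
    by (rule onorm_bound) (use J_le[OF T] CL matsaev_norm_nonneg[OF T] in auto)
  ultimately show ?thesis by blast
qed

end

section \<open>Transfer from the space of square summable sequences\<close>

definition ell2_fin :: "nat \<Rightarrow> (nat \<Rightarrow> complex) \<Rightarrow> (nat, complex) ell2"
  where "ell2_fin N c = Abs_ell2 (\<lambda>n. if n < N then c n else 0)"

lemma ell2_coord_fin: "ell2_coord (ell2_fin N c) n = (if n < N then c n else 0)"
proof -
  have "(\<lambda>n. (norm (if n < N then c n else 0))\<^sup>2) summable_on UNIV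
      \<longleftrightarrow> (\<lambda>n. (norm (c n))\<^sup>2) summable_on {..<N}"
    by (rule summable_on_cong_neutral) auto
  then show ?thesis by (simp add: ell2_fin_def Abs_ell2_inverse)
qed

lemma ell2_eqI: "(\<And>n. ell2_coord a n = ell2_coord b n) \<Longrightarrow> a = b"
  by (metis ext ell2_coord_inject)

lemma cinner_ell2_fin: "cinner v (ell2_fin N c) = (\<Sum>n<N. ell2_coord v n * cnj (c n))"
proof -
  have "cinner v (ell2_fin N c) = (\<Sum>\<^sub>\<infinity>n\<in>{..<N}. ell2_coord v n * cnj (c n))"
    unfolding cinner_ell2_def
    by (rule infsum_cong_neutral) (auto simp: ell2_coord_fin cinner_complex_def)
  then show ?thesis by simp
qed

lemma norm_ell2_fin: "(norm (ell2_fin N c))\<^sup>2 = (\<Sum>n<N. (cmod (c n))\<^sup>2)"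
proof -
  have "(norm (ell2_fin N c))\<^sup>2 = (\<Sum>\<^sub>\<infinity>n\<in>{..<N}. (cmod (c n))\<^sup>2)"
    unfolding norm_ell2_sq by (rule infsum_cong_neutral) (auto simp: ell2_coord_fin)
  then show ?thesis by simp
qed

lemma ell2_coord_bounded_linear: "bounded_linear (\<lambda>a. ell2_coord a i)"
  by (rule bounded_linear_intro[where K = 1])
    (auto simp: plus_ell2.rep_eq scaleR_ell2.rep_eq norm_ell2_coord_le)

lemma ell2_coord_sum: "ell2_coord (sum f A) i = (\<Sum>a\<in>A. ell2_coord (f a) i)"
  by (rule linear_sum[OF bounded_linear.linear[OF ell2_coord_bounded_linear]])

definition unit_vector :: "nat \<Rightarrow> (nat, complex) ell2"
  where "unit_vector m = ell2_fin (Suc m) (\<lambda>n. if n = m then 1 else 0)"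

lemma ell2_coord_unit_vector: "ell2_coord (unit_vector m) n = (if n = m then 1 else 0)"
  by (simp add: unit_vector_def ell2_coord_fin)

lemma cinner_unit_vector: "cinner v (unit_vector m) = ell2_coord v m"
  by (simp add: unit_vector_def cinner_ell2_fin if_distrib[of cnj] if_distrib[of "(*) _"] cong: if_cong)

lemma ell2_fin_eq_sum: "ell2_fin N c = (\<Sum>m<N. scaleC (c m) (unit_vector m))"
  by (rule ell2_eqI)
    (simp add: ell2_coord_sum ell2_coord_fin scaleC_ell2.rep_eq scaleC_complex_def ell2_coord_unit_vector
      if_distrib[of "(*) _"] cong: if_cong)

text \<open>The spectral measure of the diagonal operator with eigenvalues
  \<open>\<alpha> n\<close>.\<close>

definition diagonal_measure :: "(nat \<Rightarrow> real) \<Rightarrow> real set \<Rightarrow> (nat, complex) ell2 \<Rightarrow> (nat, complex) ell2"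
  where "diagonal_measure \<alpha> A a = Abs_ell2 (\<lambda>n. if \<alpha> n \<in> A then ell2_coord a n else 0)"

lemma ell2_coord_diagonal:
  "ell2_coord (diagonal_measure \<alpha> A a) n = (if \<alpha> n \<in> A then ell2_coord a n else 0)"
proof -
  have "(\<lambda>n. (norm (if \<alpha> n \<in> A then ell2_coord a n else 0))\<^sup>2) summable_on UNIV"
    by (rule summable_on_comparison_test[OF ell2_sq_summable[of a]]) auto
  then show ?thesis by (simp add: diagonal_measure_def Abs_ell2_inverse)
qed

lemma orthogonal_projection_diagonal: "orthogonal_projection (diagonal_measure \<alpha> A)"
proof (rule orthogonal_projectionI_contraction)
  show le: "norm (diagonal_measure \<alpha> A a) \<le> norm a" for a
  proof -
    have "(norm (diagonal_measure \<alpha> A a))\<^sup>2 \<le> (norm a)\<^sup>2"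
      unfolding norm_ell2_sq
      by (rule infsum_mono[OF ell2_sq_summable ell2_sq_summable]) (simp add: ell2_coord_diagonal)
    then show ?thesis by (rule power2_le_imp_le) simp
  qed
  show "bounded_clinear (diagonal_measure \<alpha> A)"
    by (rule bounded_clinearI[where K = 1])
      (auto simp: le plus_ell2.rep_eq scaleC_ell2.rep_eq scaleC_complex_def ell2_coord_diagonal intro!: ell2_eqI)
  show "diagonal_measure \<alpha> A (diagonal_measure \<alpha> A a) = diagonal_measure \<alpha> A a" for a
    by (rule ell2_eqI) (simp add: ell2_coord_diagonal)
qed

lemma spectral_measure_diagonal: "spectral_measure borel (diagonal_measure \<alpha>)"
  unfolding spectral_measure_def
proof (intro conjI ballI allI impI)
  show "orthogonal_projection (diagonal_measure \<alpha> A)" for A by (rule orthogonal_projection_diagonal)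
  show "diagonal_measure \<alpha> (space borel) = id"
    by (auto simp: ell2_coord_diagonal fun_eq_iff intro!: ell2_eqI)
next
  fix F :: "nat \<Rightarrow> real set" and a
  assume F: "disjoint_family F"
  have zero: "diagonal_measure \<alpha> (F m) (diagonal_measure \<alpha> (F n) b) = 0" if "m \<noteq> n" for m n b
    using disjoint_family_onD[OF F _ _ that]
    by (intro ell2_eqI) (auto simp: ell2_coord_diagonal zero_ell2.rep_eq)
  obtain P where "orthogonal_projection P" "\<And>b. (\<lambda>n. diagonal_measure \<alpha> (F n) b) sums P b"
    "\<And>b. (\<lambda>n. (norm (diagonal_measure \<alpha> (F n) b))\<^sup>2) sums (norm (P b))\<^sup>2"
    using sum_projections[of "\<lambda>n. diagonal_measure \<alpha> (F n)", OF orthogonal_projection_diagonal zero] by blast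
  then obtain Q where Q: "(\<lambda>n. diagonal_measure \<alpha> (F n) a) sums Q" by blast
  have "Q = diagonal_measure \<alpha> (\<Union>n. F n) a"
  proof (rule ell2_eqI)
    fix i
    have "(\<lambda>n. ell2_coord (diagonal_measure \<alpha> (F n) a) i) sums ell2_coord Q i"
      by (rule bounded_linear.sums[OF ell2_coord_bounded_linear Q])
    moreover have "(\<lambda>n. ell2_coord (diagonal_measure \<alpha> (F n) a) i)
        sums ell2_coord (diagonal_measure \<alpha> (\<Union>n. F n) a) i"
    proof (cases "\<exists>n. \<alpha> i \<in> F n")
      case True
      then obtain m where m: "\<alpha> i \<in> F m" by blast
      have "\<alpha> i \<in> F n \<longleftrightarrow> n = m" for n using disjoint_family_onD[OF F, of n m] m by blast
      then have "(\<lambda>n. ell2_coord (diagonal_measure \<alpha> (F n) a) i) = (\<lambda>n. if n = m then ell2_coord a i else 0)"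
        by (simp add: ell2_coord_diagonal)
      then show ?thesis using m sums_single[of m "\<lambda>_. ell2_coord a i"] by (auto simp: ell2_coord_diagonal)
    qed (simp add: ell2_coord_diagonal)
    ultimately show "ell2_coord Q i = ell2_coord (diagonal_measure \<alpha> (\<Union>n. F n) a) i"
      by (rule sums_unique2)
  qed
  then show "(\<lambda>n. diagonal_measure \<alpha> (F n) a) sums diagonal_measure \<alpha> (\<Union>n. F n) a" using Q by simp
qed

text \<open>For diagonal spectral measures the double operator integral is the Schur multiplication
  of the matrix by the divided differences at the eigenvalues. In a discrete sum only the term with
  \<open>i = g k (\<alpha> n)\<close> and \<open>j = g k (\<alpha> m)\<close> survives.\<close>

lemma doi_lipschitz_diagonal:
  assumes f: "\<exists>L. L-lipschitz_on UNIV f"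
  shows "cinner (hs_op (doi_lipschitz (diagonal_measure \<alpha>) (diagonal_measure \<alpha>) f T) (unit_vector m)) (unit_vector n)
    = divided_difference f (\<alpha> n, \<alpha> m) * cinner (hs_op T (unit_vector m)) (unit_vector n)"
proof -
  let ?E = "diagonal_measure \<alpha>"
  interpret spectral_pair ?E ?E by unfold_locales (rule spectral_measure_diagonal)+
  obtain g where g: "discrete_approx g" using discrete_approx_exists by blast
  let ?I = "\<lambda>k. discrete_doi f (g k) (hs_op T) (unit_vector m)"
  note bc = bounded_clinear_hs_op[of T]
  have unit: "?E B (unit_vector m) = (if \<alpha> m \<in> B then unit_vector m else 0)" for B
    by (rule ell2_eqI) (auto simp: ell2_coord_diagonal ell2_coord_unit_vector zero_ell2.rep_eq)
  have entry: "cinner (?I k) (unit_vector n)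
      = divided_difference f (g k (\<alpha> n), g k (\<alpha> m)) * cinner (hs_op T (unit_vector m)) (unit_vector n)" for k
  proof -
    have fin: "finite (range (g k))" using g by (simp add: discrete_approx_def)
    have "cinner (?I k) (unit_vector n) = (\<Sum>i\<in>range (g k). \<Sum>j\<in>range (g k).
        divided_difference f (i, j) * ell2_coord (?E (g k -` {i}) (hs_op T (?E (g k -` {j}) (unit_vector m)))) n)"
      unfolding discrete_doi_def cinner_sum_left cinner_scaleC_left unfolding cinner_unit_vector ..
    also have "\<dots> = (\<Sum>i\<in>range (g k). \<Sum>j\<in>range (g k). if j = g k (\<alpha> m) then
        (if i = g k (\<alpha> n) then divided_difference f (i, j) * ell2_coord (hs_op T (unit_vector m)) n else 0) else 0)"
      by (intro sum.cong refl)
        (auto simp: ell2_coord_diagonal unit bounded_clinear_apply_zero[OF bc] zero_ell2.rep_eq)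
    also have "\<dots> = divided_difference f (g k (\<alpha> n), g k (\<alpha> m)) * ell2_coord (hs_op T (unit_vector m)) n"
      using fin by simp
    finally show ?thesis by (simp add: cinner_unit_vector)
  qed
  have "(\<lambda>k. cinner (?I k) (unit_vector n))
      \<longlonglongrightarrow> cinner (hs_op (doi_lipschitz ?E ?E f T) (unit_vector m)) (unit_vector n)"
    by (intro tendsto_cinner doi_lipschitz_tendsto[OF f g] tendsto_const)
  moreover have "(\<lambda>k. cinner (?I k) (unit_vector n))
      \<longlonglongrightarrow> divided_difference f (\<alpha> n, \<alpha> m) * cinner (hs_op T (unit_vector m)) (unit_vector n)"
    unfolding entry using g
    by (intro tendsto_intros divided_difference_tendsto[OF f]) (simp add: discrete_approx_def)
  ultimately show ?thesis by (rule LIMSEQ_unique)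
qed

text \<open>The condition under the choice operator in \<open>matsaev_constant\<close>, apart from
  positivity.\<close>

definition ell2_doi_bound :: "real \<Rightarrow> bool"
  where "ell2_doi_bound C \<longleftrightarrow>
    (\<forall>f (E1 :: real set \<Rightarrow> (nat, complex) ell2 \<Rightarrow> (nat, complex) ell2) E2.
      (\<exists>L. L-lipschitz_on UNIV f) \<longrightarrow> spectral_measure borel E1 \<longrightarrow> spectral_measure borel E2 \<longrightarrow>
      (\<exists>J. matsaev_extension E1 E2 f J \<and>
        (\<forall>T\<in>matsaev_ideal. onorm (J T) \<le> C * lip_norm f * matsaev_norm T)))"

text \<open>Only the matrix of \<open>T\<close> with respect to the normalized families matters, and it is the
  matrix of an operator on \<open>ell2\<close> whose singular values do not exceed those of \<open>T\<close>.\<close>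

lemma discrete_doi_bound_of_ell2:
  assumes C: "ell2_doi_bound C" "0 \<le> C"
  shows "discrete_doi_bound TYPE('h::chilbert_space) C"
  unfolding discrete_doi_bound_def
proof (intro allI impI)
  fix f :: "real \<Rightarrow> complex" and \<Lambda> and x y :: "real \<Rightarrow> 'h" and T :: "'h \<Rightarrow> 'h"
  assume f: "\<exists>L. L-lipschitz_on UNIV f" and \<Lambda>: "finite \<Lambda>" and x: "ortho_family x \<Lambda>"
    and y: "ortho_family y \<Lambda>" and T: "T \<in> matsaev_ideal"
  note bc = matsaev_idealD(1)[OF T]
  obtain \<alpha> where "bij_betw \<alpha> {0..<card \<Lambda>} \<Lambda>" using ex_bij_betw_nat_finite[OF \<Lambda>] by blast
  define N where "N = card \<Lambda>"
  have \<alpha>: "bij_betw \<alpha> {..<N} \<Lambda>" using \<open>bij_betw \<alpha> _ _\<close> by (simp add: N_def atLeast0LessThan)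
  define u where "u z n = scaleC (complex_of_real (inverse (norm (z (\<alpha> n))))) (z (\<alpha> n))" for z :: "real \<Rightarrow> 'h" and n
  have u_ortho: "ortho_family (u z) {..<N}" if "ortho_family z \<Lambda>" for z
    unfolding u_def
  proof (rule ortho_family_scaleC)
    show "ortho_family (\<lambda>n. z (\<alpha> n)) {..<N}"
      using that \<alpha> unfolding ortho_family_def bij_betw_def inj_on_def by blast
  qed
  have u1: "norm (u z n) \<le> 1" for z n
    by (cases "z (\<alpha> n) = 0") (simp_all add: u_def norm_scaleC norm_inverse)
  have u_eq: "z (\<alpha> n) = scaleC (complex_of_real (norm (z (\<alpha> n)))) (u z n)" for z n
    by (cases "z (\<alpha> n) = 0") (simp_all add: u_def scaleC_scaleC scaleC_one)
  \<comment> \<open>\<open>V\<close> sends unit vectors to the normalized \<open>x\<close>, and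
    \<open>W\<close> reads off the coefficients against the normalized \<open>y\<close>. Both are
    contractions, even if some members of the families vanish.\<close>
  define W where "W h = ell2_fin N (\<lambda>n. cinner h (u y n))" for h
  define V where "V a = (\<Sum>n<N. scaleC (ell2_coord a n) (u x n))" for a
  have W_le: "norm (W h) \<le> norm h" for h
  proof -
    have "(norm (W h))\<^sup>2 \<le> (norm h)\<^sup>2"
      unfolding W_def norm_ell2_fin by (rule bessel[OF _ u_ortho[OF y] u1]) simp
    then show ?thesis by (rule power2_le_imp_le) simp
  qed
  have W: "bounded_clinear W"
  proof (rule bounded_clinearI[where K = 1])
    show "norm (W h) \<le> norm h * 1" for h using W_le by simp
  qed (auto simp: W_def plus_ell2.rep_eq scaleC_ell2.rep_eq scaleC_complex_def ell2_coord_fin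
      cinner_add_left cinner_scaleC_left intro!: ell2_eqI)
  have V_le: "norm (V a) \<le> norm a" for a
  proof -
    have "(norm (V a))\<^sup>2 \<le> (\<Sum>n<N. (cmod (ell2_coord a n))\<^sup>2)"
      unfolding V_def by (rule norm_combination_le[OF _ u_ortho[OF x] u1]) simp
    also have "\<dots> \<le> (norm a)\<^sup>2" by (rule sum_le_norm_ell2) simp
    finally show ?thesis by (rule power2_le_imp_le) simp
  qed
  have V: "bounded_clinear V"
  proof (rule bounded_clinearI[where K = 1])
    show "norm (V a) \<le> norm a * 1" for a using V_le by simp
  qed (simp_all add: V_def plus_ell2.rep_eq scaleC_ell2.rep_eq scaleC_complex_def
      scaleC_add_left sum.distrib complex_vector.scale_sum_right scaleC_scaleC)
  define T' where "T' a = W (T (V a))" for a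
  have WT: "bounded_clinear (\<lambda>h. W (T h))" by (rule bounded_clinear_compose[OF W bc])
  have T': "bounded_clinear T'" unfolding T'_def by (rule bounded_clinear_compose[OF WT V])
  have T'_ideal: "T' \<in> matsaev_ideal" "matsaev_norm T' \<le> matsaev_norm T"
  proof -
    have "singular_value j T' \<le> singular_value j T" for j
      unfolding T'_def by (rule singular_value_compose_le[OF bc W W_le V V_le])
    then show "T' \<in> matsaev_ideal" "matsaev_norm T' \<le> matsaev_norm T"
      by (rule matsaev_mono[OF T' T])+
  qed
  \<comment> \<open>Finite rank makes \<open>T'\<close> Hilbert--Schmidt, and on that class
    \<open>matsaev_extension\<close> prescribes the values of \<open>J\<close>.\<close>
  have "rank_le V N"
    unfolding rank_le_def
  proof (intro exI[of _ "u x ` {..<N}"] conjI)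
    show "card (u x ` {..<N}) \<le> N" using card_image_le[of "{..<N}" "u x"] by simp
    have "V a \<in> cspan (u x ` {..<N})" for a
      unfolding V_def
      by (intro complex_vector.span_sum complex_vector.span_scale complex_vector.span_base) simp
    then show "range V \<subseteq> cspan (u x ` {..<N})" by blast
  qed simp
  then have "rank_le T' N" unfolding T'_def using rank_le_compose[OF _ WT, of V N "\<lambda>a. a"] by simp
  then have T'_hs: "hs_op (Abs_hs T') = T'"
    using hilbert_schmidt_finite_rank[OF T'] by (simp add: Abs_hs_inverse)
  let ?E = "diagonal_measure \<alpha>"
  obtain J where J: "matsaev_extension ?E ?E f J"
    "\<And>S. S \<in> matsaev_ideal \<Longrightarrow> onorm (J S) \<le> C * lip_norm f * matsaev_norm S"
    using C(1) f spectral_measure_diagonal[of \<alpha>] unfolding ell2_doi_bound_def by blast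
  have J_T': "J T' = hs_op (doi_lipschitz ?E ?E f (Abs_hs T'))"
    using J(1) T'_hs unfolding matsaev_extension_def by metis
  have bcJ: "bounded_clinear (J T')" unfolding J_T' by (rule bounded_clinear_hs_op)
  have entry: "cinner (J T' (unit_vector m)) (unit_vector n)
      = divided_difference f (\<alpha> n, \<alpha> m) * cinner (T (u x m)) (u y n)" if "m < N" "n < N" for m n
  proof -
    have "V (unit_vector m) = u x m"
      using that(1) by (simp add: V_def ell2_coord_unit_vector if_distrib[of "\<lambda>c. scaleC c _"]
          scaleC_one complex_vector.scale_zero_left cong: if_cong)
    then have "cinner (T' (unit_vector m)) (unit_vector n) = cinner (T (u x m)) (u y n)"
      using that(2) by (simp add: T'_def W_def cinner_unit_vector ell2_coord_fin)
    then show ?thesis by (simp add: J_T' doi_lipschitz_diagonal[OF f] T'_hs)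
  qed
  \<comment> \<open>The lengths removed by normalization return as coefficients, so that the whole
    sum becomes a single value of the form of \<open>J T'\<close>.\<close>
  define a where "a z = ell2_fin N (\<lambda>n. complex_of_real (norm (z (\<alpha> n))))" for z :: "real \<Rightarrow> 'h"
  have reindex: "(\<Sum>i\<in>\<Lambda>. h i) = (\<Sum>n<N. h (\<alpha> n))" for h :: "real \<Rightarrow> 'z::comm_monoid_add"
    using sum.reindex_bij_betw[OF \<alpha>, of h] by simp
  have norm_a: "norm (a z) = sqrt (\<Sum>i\<in>\<Lambda>. (norm (z i))\<^sup>2)" for z
    using norm_ell2_fin[of N "\<lambda>n. complex_of_real (norm (z (\<alpha> n)))"]
    by (simp add: a_def sum.reindex_bij_betw[OF \<alpha>, of "\<lambda>i. (norm (z i))\<^sup>2", symmetric] real_sqrt_unique)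
  have "(\<Sum>i\<in>\<Lambda>. \<Sum>j\<in>\<Lambda>. divided_difference f (i, j) * cinner (T (x j)) (y i))
      = (\<Sum>n<N. \<Sum>m<N. divided_difference f (\<alpha> n, \<alpha> m) * cinner (T (x (\<alpha> m))) (y (\<alpha> n)))"
    using sum.reindex_bij_betw[OF \<alpha>, symmetric] by (simp add: sum.reindex_bij_betw[OF \<alpha>, symmetric])
  also have "\<dots> = (\<Sum>n<N. \<Sum>m<N. complex_of_real (norm (x (\<alpha> m))) * complex_of_real (norm (y (\<alpha> n)))
      * cinner (J T' (unit_vector m)) (unit_vector n))"
  proof (intro sum.cong refl)
    fix n m assume "n \<in> {..<N}" "m \<in> {..<N}"
    then show "divided_difference f (\<alpha> n, \<alpha> m) * cinner (T (x (\<alpha> m))) (y (\<alpha> n))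
        = complex_of_real (norm (x (\<alpha> m))) * complex_of_real (norm (y (\<alpha> n)))
          * cinner (J T' (unit_vector m)) (unit_vector n)"
      by (subst u_eq[of x m], subst u_eq[of y n])
        (simp add: entry bounded_clinear_apply_scaleC[OF bc] cinner_scaleC_left cinner_scaleC_right)
  qed
  also have "\<dots> = cinner (J T' (a x)) (a y)"
    unfolding a_def ell2_fin_eq_sum bounded_clinear_apply_sum[OF bcJ] bounded_clinear_apply_scaleC[OF bcJ]
      cinner_sum_right cinner_sum_left cinner_scaleC_left cinner_scaleC_right
    by (simp add: sum_distrib_left mult_ac)
  also have "cmod \<dots> \<le> onorm (J T') * norm (a x) * norm (a y)" by (rule cinner_le_onorm[OF bcJ])
  also have "\<dots> \<le> C * lip_norm f * matsaev_norm T * norm (a x) * norm (a y)"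
  proof (intro mult_right_mono)
    have "onorm (J T') \<le> C * lip_norm f * matsaev_norm T'" by (rule J(2)[OF T'_ideal(1)])
    also have "\<dots> \<le> C * lip_norm f * matsaev_norm T"
      by (intro mult_left_mono T'_ideal(2) mult_nonneg_nonneg C(2) lip_norm_nonneg[OF f])
    finally show "onorm (J T') \<le> C * lip_norm f * matsaev_norm T" .
  qed auto
  finally show "cmod (\<Sum>i\<in>\<Lambda>. \<Sum>j\<in>\<Lambda>. divided_difference f (i, j) * cinner (T (x j)) (y i))
      \<le> C * lip_norm f * matsaev_norm T
        * (sqrt (\<Sum>i\<in>\<Lambda>. (norm (x i))\<^sup>2) * sqrt (\<Sum>i\<in>\<Lambda>. (norm (y i))\<^sup>2))"
    by (simp add: norm_a mult.assoc)
qed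

text \<open>The explicit constant shows that the condition under the choice operator can be met; the
  chosen constant itself may be a different one.\<close>

lemma matsaev_constant_bound: "0 < matsaev_constant" "ell2_doi_bound matsaev_constant"
proof -
  have "ell2_doi_bound 2400"
    unfolding ell2_doi_bound_def
  proof (intro allI impI)
    fix f :: "real \<Rightarrow> complex" and E1 E2 :: "real set \<Rightarrow> (nat, complex) ell2 \<Rightarrow> (nat, complex) ell2"
    assume f: "\<exists>L. L-lipschitz_on UNIV f" and "spectral_measure borel E1" "spectral_measure borel E2"
    then interpret spectral_pair E1 E2 by unfold_locales
    show "\<exists>J. matsaev_extension E1 E2 f J \<and>
        (\<forall>T\<in>matsaev_ideal. onorm (J T) \<le> 2400 * lip_norm f * matsaev_norm T)"
      by (rule matsaev_extension_of_discrete_bound[OF discrete_doi_bound_2400 _ f]) simp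
  qed
  then have "\<exists>C. 0 < C \<and> ell2_doi_bound C" by (intro exI[of _ 2400]) simp
  then have "0 < matsaev_constant \<and> ell2_doi_bound matsaev_constant"
    unfolding matsaev_constant_def ell2_doi_bound_def by (rule someI_ex)
  then show "0 < matsaev_constant" "ell2_doi_bound matsaev_constant" by auto
qed

theorem theorem2p3:
  shows "0 < matsaev_constant \<and>
    (\<forall>(f :: real \<Rightarrow> complex)
      (E1 :: real set \<Rightarrow> 'h::chilbert_space \<Rightarrow> 'h) (E2 :: real set \<Rightarrow> 'h \<Rightarrow> 'h).
      (\<exists>L. L-lipschitz_on UNIV f) \<longrightarrow> spectral_measure borel E1 \<longrightarrow> spectral_measure borel E2 \<longrightarrow>
      (\<exists>J. matsaev_extension E1 E2 f J \<and>
        (\<forall>T\<in>matsaev_ideal. onorm (J T) \<le> matsaev_constant * lip_norm f * matsaev_norm T)))"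
proof (intro conjI allI impI)
  show "0 < matsaev_constant" by (rule matsaev_constant_bound)
  fix f :: "real \<Rightarrow> complex" and E1 E2 :: "real set \<Rightarrow> 'h \<Rightarrow> 'h"
  assume f: "\<exists>L. L-lipschitz_on UNIV f" and "spectral_measure borel E1" "spectral_measure borel E2"
  then interpret spectral_pair E1 E2 by unfold_locales
  have "discrete_doi_bound TYPE('h) matsaev_constant"
    using matsaev_constant_bound by (intro discrete_doi_bound_of_ell2) auto
  then show "\<exists>J. matsaev_extension E1 E2 f J \<and>
      (\<forall>T\<in>matsaev_ideal. onorm (J T) \<le> matsaev_constant * lip_norm f * matsaev_norm T)"
    using matsaev_constant_bound(1) f by (intro matsaev_extension_of_discrete_bound) auto
qed

end
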